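(* Let $n\ge 5$ be an integer, and let $H$, $N_0$, $a$, $b$, $v$ be the groups and elements (depending on $n$) defined in the context. Then: (i) $[b,_n a]N_0=[b^{-2},_n a]N_0$, and this element has infinite order in $\dfrac{H}{N_0}$; (ii) $[b^{-1},_n h]\in N_0$ for all $h\in H$; (iii) $[b^{-k},_n a]N_0=v^{\binom{k}{2}}N_0$ for all integers $k\ge 2$.
   Context: For elements $x,y$ of a group, $[x,y]=x^{-1}y^{-1}xy$, $[x,_0 y]=x$ and $[x,_m y]=[[x,_{m-1}y],y]$ for $m\ge1$; longer commutators are left-normed, so for example $[x,_i y,z,_j y]=[[[x,_i y],z],_j y]$. $\gamma_k$ denotes the $k$th term of the lower central series. Fix an integer $n\ge 5$. Let $F$ be the relatively free group on $\{a,b\}$ in the variety of groups that are nilpotent of class at most $n+2$ and whose $\gamma_4$ is abelian; i.e. $F=F_2/\big(\gamma_{n+3}(F_2)\,[\gamma_4(F_2),\gamma_4(F_2)]\big)$, where $F_2$ is the free group on $\{a,b\}$. Let $M$ be the normal subgroup of $F$ generated by all commutators in $a,b$ with at least $3$ entries $b$ together with the commutators $[b,_{n+1}a]$ and $[b,_n a,b]$. Put $H=F/M$, and denote the images of the generators in $H$ again by $a,b$. In $H$ define $$t=[b,_n a],\qquad u_j=[b,_{n-1-j}a,b,_j a]\quad(0\le j\le n-2),$$ $$u=\prod_{j=0}^{n-2}u_j,\qquad v=[u_{n-2},a],\qquad w=\prod_{j=0}^{n-3}[u_j,a].$$ Let $N_0=\langle u,\ vw,\ vt^{-1}\rangle$,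 which is a normal subgroup of $H$. *)

theory Defs
  imports "HOL-Algebra.Algebra"
begin

section \<open>Free groups\<close>

text \<open>
  The free group on a type \<open>'g\<close> of generators, realised by freely reduced words.  A letter
  \<open>(True, g)\<close> is the generator \<open>g\<close>, and \<open>(False, g)\<close> is its formal inverse.
  The product of two reduced words is computed by pushing the letters of the first word onto the
  second one from right to left, cancelling whenever possible.
\<close>

type_synonym 'g word = "(bool \<times> 'g) list"

definition letter_inv :: "bool \<times> 'g \<Rightarrow> bool \<times> 'g" where
  "letter_inv x = (\<not> fst x, snd x)"

definition reduced :: "'g word \<Rightarrow> bool" where
  "reduced w \<longleftrightarrow> successively (\<lambda>x y. y \<noteq> letter_inv x) w"

fun push :: "bool \<times> 'g \<Rightarrow> 'g word \<Rightarrow> 'g word" where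
  "push x [] = [x]"
| "push x (y # ys) = (if y = letter_inv x then ys else x # y # ys)"

definition free_group :: "'g word monoid" where
  "free_group = \<lparr>carrier = {w. reduced w}, monoid.mult = (\<lambda>u w. foldr push u w), one = []\<rparr>"

lemma letter_inv_letter_inv [simp]: "letter_inv (letter_inv x) = x"
  by (simp add: letter_inv_def)

lemma reduced_push: "reduced w \<Longrightarrow> reduced (push x w)"
  by (cases w) (auto simp: reduced_def successively_Cons)

lemma reduced_foldr_push: "reduced w \<Longrightarrow> reduced (foldr push u w)"
  by (induction u) (auto intro: reduced_push)

lemma push_letter_inv: "reduced w \<Longrightarrow> push x (push (letter_inv x) w) = w"
proof (cases w)
  case (Cons y ys)
  assume "reduced w"
  with Cons show ?thesis by (cases ys) (auto simp: reduced_def)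
qed simp

lemma foldr_push_push:
  "reduced w \<Longrightarrow> foldr push (push x v) w = push x (foldr push v w)"
  by (cases v) (auto simp: push_letter_inv reduced_foldr_push)

lemma foldr_push_assoc:
  "reduced w \<Longrightarrow> foldr push (foldr push u v) w = foldr push u (foldr push v w)"
  by (induction u) (auto simp: foldr_push_push)

lemma foldr_push_Nil: "reduced u \<Longrightarrow> foldr push u [] = u"
proof (induction u)
  case (Cons x u)
  then show ?case by (cases u) (auto simp: reduced_def)
qed simp

lemma foldr_push_inverse: "foldr push (rev (map letter_inv w)) w = []"
  by (induction w) auto

lemma group_free_group: "group (free_group :: 'g word monoid)"
proof (rule groupI)
  fix w :: "'g word" assume w: "w \<in> carrier free_group"
  have "foldr push (foldr push (rev (map letter_inv w)) []) w = []"
    by (subst foldr_push_assoc) (use w in \<open>auto simp: free_group_def foldr_push_inverse\<close>)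
  moreover have "reduced (foldr push (rev (map letter_inv w)) [])"
    by (intro reduced_foldr_push) (simp add: reduced_def)
  ultimately show "\<exists>v\<in>carrier free_group. v \<otimes>\<^bsub>free_group\<^esub> w = \<one>\<^bsub>free_group\<^esub>"
    by (auto simp: free_group_def)
qed (auto simp: free_group_def reduced_foldr_push foldr_push_assoc, simp add: reduced_def)

section \<open>Commutators, the lower central series and normal closures\<close>

text \<open>The convention is \<open>[x,y] = x\<inverse>y\<inverse>xy\<close>; note that the library's
  \<^const>\<open>derived\<close> is phrased with \<open>xyx\<inverse>y\<inverse>\<close> instead.\<close>

definition comm :: "('g, 'm) monoid_scheme \<Rightarrow> 'g \<Rightarrow> 'g \<Rightarrow> 'g" where
  "comm G x y = inv\<^bsub>G\<^esub> x \<otimes>\<^bsub>G\<^esub> inv\<^bsub>G\<^esub> y \<otimes>\<^bsub>G\<^esub> x \<otimes>\<^bsub>G\<^esub> y"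

text \<open>\<open>engel G x m y\<close> is \<open>[x,\<^sub>m y]\<close>.\<close>

primrec engel :: "('g, 'm) monoid_scheme \<Rightarrow> 'g \<Rightarrow> nat \<Rightarrow> 'g \<Rightarrow> 'g" where
  "engel G x 0 y = x"
| "engel G x (Suc m) y = comm G (engel G x m y) y"

definition comm_subgroup :: "('g, 'm) monoid_scheme \<Rightarrow> 'g set \<Rightarrow> 'g set \<Rightarrow> 'g set" where
  "comm_subgroup G S T = generate G {comm G x y | x y. x \<in> S \<and> y \<in> T}"

text \<open>\<open>lcs G k\<close> is \<open>\<gamma>\<^sub>k(G)\<close> for \<open>k \<ge> 1\<close>, with \<open>\<gamma>\<^sub>1(G) = G\<close>; the value at \<open>0\<close> is a dummy.\<close>

fun lcs :: "('g, 'm) monoid_scheme \<Rightarrow> nat \<Rightarrow> 'g set" where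
  "lcs G 0 = carrier G"
| "lcs G (Suc 0) = carrier G"
| "lcs G (Suc (Suc k)) = comm_subgroup G (lcs G (Suc k)) (carrier G)"

definition normal_closure :: "('g, 'm) monoid_scheme \<Rightarrow> 'g set \<Rightarrow> 'g set" where
  "normal_closure G S = \<Inter>{N. N \<lhd> G \<and> S \<subseteq> N}"

text \<open>\<open>commutator_in G a b k x\<close>: \<open>x\<close> is the value of a commutator in \<open>a, b\<close> (with an arbitrary
  arrangement of brackets) that has exactly \<open>k\<close> entries \<open>b\<close>.\<close>

inductive commutator_in :: "('g, 'm) monoid_scheme \<Rightarrow> 'g \<Rightarrow> 'g \<Rightarrow> nat \<Rightarrow> 'g \<Rightarrow> bool"
  for G a b where
  entry_a: "commutator_in G a b 0 a"
| entry_b: "commutator_in G a b 1 b"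
| bracket: "commutator_in G a b k x \<Longrightarrow> commutator_in G a b l y \<Longrightarrow>
    commutator_in G a b (k + l) (comm G x y)"

section \<open>The groups \<open>F\<close> and \<open>H\<close> and the subgroup \<open>N\<^sub>0\<close>\<close>

datatype generator = Gen_a | Gen_b

definition F2 :: "generator word monoid" where
  "F2 = free_group"

definition F_rel :: "nat \<Rightarrow> generator word set" where
  "F_rel n = lcs F2 (n + 3) <#>\<^bsub>F2\<^esub> comm_subgroup F2 (lcs F2 4) (lcs F2 4)"

definition F_grp :: "nat \<Rightarrow> generator word set monoid" where
  "F_grp n = F2 Mod F_rel n"

definition F_a :: "nat \<Rightarrow> generator word set" where
  "F_a n = F_rel n #>\<^bsub>F2\<^esub> [(True, Gen_a)]"

definition F_b :: "nat \<Rightarrow> generator word set" where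
  "F_b n = F_rel n #>\<^bsub>F2\<^esub> [(True, Gen_b)]"

definition M_sub :: "nat \<Rightarrow> generator word set set" where
  "M_sub n = normal_closure (F_grp n)
     ({x. \<exists>k\<ge>3. commutator_in (F_grp n) (F_a n) (F_b n) k x} \<union>
      {engel (F_grp n) (F_b n) (n + 1) (F_a n),
       comm (F_grp n) (engel (F_grp n) (F_b n) n (F_a n)) (F_b n)})"

definition H_grp :: "nat \<Rightarrow> generator word set set monoid" where
  "H_grp n = F_grp n Mod M_sub n"

definition H_a :: "nat \<Rightarrow> generator word set set" where
  "H_a n = M_sub n #>\<^bsub>F_grp n\<^esub> F_a n"

definition H_b :: "nat \<Rightarrow> generator word set set" where
  "H_b n = M_sub n #>\<^bsub>F_grp n\<^esub> F_b n"

definition t_elt :: "nat \<Rightarrow> generator word set set" where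
  "t_elt n = engel (H_grp n) (H_b n) n (H_a n)"

definition uj_elt :: "nat \<Rightarrow> nat \<Rightarrow> generator word set set" where
  "uj_elt n j =
     engel (H_grp n) (comm (H_grp n) (engel (H_grp n) (H_b n) (n - 1 - j) (H_a n)) (H_b n)) j (H_a n)"

definition ordered_prod :: "('g, 'm) monoid_scheme \<Rightarrow> 'g list \<Rightarrow> 'g" where
  "ordered_prod G xs = foldr (\<otimes>\<^bsub>G\<^esub>) xs \<one>\<^bsub>G\<^esub>"

text \<open>The factors of \<open>u\<close> and \<open>w\<close> are taken in increasing order of \<open>j\<close> (with \<open>j \<le> n - 2\<close> for \<open>u\<close>
  and \<open>j \<le> n - 3\<close> for \<open>w\<close>); as they all lie in the abelian group \<open>\<gamma>\<^sub>4(H)\<close>, the order is immaterial.\<close>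

definition u_elt :: "nat \<Rightarrow> generator word set set" where
  "u_elt n = ordered_prod (H_grp n) (map (uj_elt n) [0..<n - 1])"

definition v_elt :: "nat \<Rightarrow> generator word set set" where
  "v_elt n = comm (H_grp n) (uj_elt n (n - 2)) (H_a n)"

definition w_elt :: "nat \<Rightarrow> generator word set set" where
  "w_elt n = ordered_prod (H_grp n) (map (\<lambda>j. comm (H_grp n) (uj_elt n j) (H_a n)) [0..<n - 2])"

definition N0 :: "nat \<Rightarrow> generator word set set set" where
  "N0 n = generate (H_grp n)
     {u_elt n, v_elt n \<otimes>\<^bsub>H_grp n\<^esub> w_elt n, v_elt n \<otimes>\<^bsub>H_grp n\<^esub> inv\<^bsub>H_grp n\<^esub> t_elt n}"

end

theory Submission
  imports Defs "HOL-Library.Function_Algebras"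
begin

text \<open>
  Let \<open>B\<close> be the normal closure of \<open>b\<close> in \<open>H\<close>.  It is generated by the \<open>c\<^sub>i = [b,\<^sub>i a]\<close> and has
  class at most \<open>2\<close>, because commutators with three entries \<open>b\<close> vanish; so \<open>[x,y]\<close> is bilinear on
  \<open>B\<close> with central values, and \<open>B'\<close> and \<open>B/B'\<close> are modules over the integral group ring of \<open>\<langle>a\<rangle>\<close>.
  Counting entries \<open>a\<close> gives a filtration of \<open>B\<close> that is trivial beyond degree \<open>n\<close>.

  On \<open>B\<close> the map \<open>x \<mapsto> [x,a]\<close> is a homomorphism up to \<open>[[x,a],y]\<close>, whence
  \<open>[b\<^sup>k\<^sup>+\<^sup>1,\<^sub>n a] = [b\<^sup>k,\<^sub>n a] t v\<^sup>k\<close>; this is (iii) and, modulo \<open>N\<^sub>0\<close>, the equation in (i).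

  For \<open>h = a\<^sup>r g\<close> with \<open>g \<in> B\<close>, the commutator \<open>[b,\<^sub>n h]\<close> is \<open>[b,\<^sub>n a\<^sup>r]\<close> times a correction in \<open>B'\<close> that
  is multiplicative in \<open>g\<close>.  Expanding \<open>[x,\<^sub>j a\<^sup>r]\<close> to second order in \<open>[\<cdot>,a]\<close> is exact in the degrees
  that matter: the correction is trivial for \<open>g = c\<^sub>l\<close>, \<open>l \<ge> 2\<close>, telescopes to \<open>1\<close> for \<open>g = c\<^sub>1\<close>, and is
  a product of powers of \<open>u\<close> and \<open>vw\<close> for \<open>g = b\<close>.  With \<open>[b\<^sup>-\<^sup>1,\<^sub>n a\<^sup>r] = (v t\<^sup>-\<^sup>1)\<^bsup>r^n\<^esup>\<close> this gives (ii).

  That \<open>t\<close> has infinite order modulo \<open>N\<^sub>0\<close> is seen in a quotient of \<open>H\<close> realised on triples of an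
  integer and two polynomial sequences on which \<open>a\<close> acts by the shift; the commutator form on
  sequences is a shift invariant bilinear differential form, chosen so that \<open>u\<close> and \<open>vw\<close> die and
  \<open>v\<close> does not.
\<close>

section \<open>Commutators in groups\<close>

text \<open>Why two terms of each expansion suffice: \<open>[c_i, c_l,_j a]\<close> is trivial once
  \<open>i + j + l > n\<close>, while every factor of the correction starts with
  \<open>i + j = n - 1\<close>. Only degrees \<open>n - 1\<close> and \<open>n\<close> are visible,
  hence only the two lowest coefficients of \<open>(z^r - 1)^j\<close>.

  Why the form on sequences looks as it does: it is built from
  \<open>D^i p D^j q - D^j p D^i q\<close> with \<open>D = fdiff\<close>. Nilpotency asks for
  \<open>i + j >= n\<close>, the relation \<open>[b,_n a,b] = 1\<close> excludes
  \<open>i = 0\<close>, and commutativity of \<open>\<gamma>_4\<close> asks that one of the orders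
  be at least \<open>n - 2\<close>. In total order \<open>n\<close> this leaves
  \<open>(1, n-1)\<close> and \<open>(2, n-2)\<close>. Each pair alone would leave
  \<open>v w\<close> nontrivial, so a combination of both is required, and for \<open>n = 4\<close>
  the second pair degenerates; this is where \<open>n >= 5\<close> enters. Once \<open>v w\<close>
  is trivial, \<open>u\<close> is a constant sequence, and the pair \<open>(1, n)\<close>, of total
  order \<open>n + 1\<close>, changes that constant and nothing else among \<open>u\<close>,
  \<open>v\<close>, \<open>w\<close>. Cancelling it requires a division, hence rational
  values.\<close>

context group
begin

lemma inv_mult_cancel_left [simp]:
  "x \<in> carrier G \<Longrightarrow> y \<in> carrier G \<Longrightarrow> inv x \<otimes> (x \<otimes> y) = y"
  "x \<in> carrier G \<Longrightarrow> y \<in> carrier G \<Longrightarrow> x \<otimes> (inv x \<otimes> y) = y"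
  by (simp_all flip: m_assoc)

lemmas group_normalize = m_assoc inv_mult_group

lemma comm_closed [intro, simp]:
  "x \<in> carrier G \<Longrightarrow> y \<in> carrier G \<Longrightarrow> comm G x y \<in> carrier G"
  by (simp add: comm_def)

lemma engel_closed [intro, simp]:
  "x \<in> carrier G \<Longrightarrow> y \<in> carrier G \<Longrightarrow> engel G x m y \<in> carrier G"
  by (induction m) auto

lemma engel_add: "engel G x (i + j) y = engel G (engel G x i y) j y"
  by (induction j) auto

lemma engel_Suc_left: "engel G x (Suc m) y = engel G (comm G x y) m y"
  using engel_add[of x 1 m y] by simp

lemma mult_comm:
  "x \<in> carrier G \<Longrightarrow> y \<in> carrier G \<Longrightarrow> x \<otimes> comm G x y = inv y \<otimes> x \<otimes> y"
  by (simp add: comm_def group_normalize)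

lemma comm_mult_left:
  "x \<in> carrier G \<Longrightarrow> y \<in> carrier G \<Longrightarrow> z \<in> carrier G \<Longrightarrow>
    comm G (x \<otimes> y) z = inv y \<otimes> comm G x z \<otimes> y \<otimes> comm G y z"
  by (simp add: comm_def group_normalize)

lemma comm_mult_right:
  "x \<in> carrier G \<Longrightarrow> y \<in> carrier G \<Longrightarrow> z \<in> carrier G \<Longrightarrow>
    comm G x (y \<otimes> z) = comm G x z \<otimes> (inv z \<otimes> comm G x y \<otimes> z)"
  by (simp add: comm_def group_normalize)

lemma comm_inv_left:
  "x \<in> carrier G \<Longrightarrow> y \<in> carrier G \<Longrightarrow> comm G (inv x) y = x \<otimes> inv (comm G x y) \<otimes> inv x"
  by (simp add: comm_def group_normalize)

lemma inv_of_comm: "x \<in> carrier G \<Longrightarrow> y \<in> carrier G \<Longrightarrow> inv (comm G x y) = comm G y x"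
  by (simp add: comm_def group_normalize)

lemma comm_one [simp]:
  "x \<in> carrier G \<Longrightarrow> comm G x \<one> = \<one>" "x \<in> carrier G \<Longrightarrow> comm G \<one> x = \<one>"
  by (simp_all add: comm_def)

lemma comm_eq_one_iff:
  assumes [simp]: "x \<in> carrier G" "y \<in> carrier G"
  shows "comm G x y = \<one> \<longleftrightarrow> x \<otimes> y = y \<otimes> x"
proof -
  have "comm G x y = inv (y \<otimes> x) \<otimes> (x \<otimes> y)"
    by (simp add: comm_def group_normalize)
  then show ?thesis
    by (metis assms inv_closed inv_equality inv_inv l_inv m_closed)
qed

lemma engel_one [simp]: "y \<in> carrier G \<Longrightarrow> engel G \<one> m y = \<one>"
  by (induction m) auto

lemma commute_generate:
  assumes "S \<subseteq> carrier G" "y \<in> carrier G" "\<And>s. s \<in> S \<Longrightarrow> s \<otimes> y = y \<otimes> s" "x \<in> generate G S"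
  shows "x \<otimes> y = y \<otimes> x"
  using assms(4)
proof (induction rule: generate.induct)
  case (inv h)
  then have [simp]: "h \<in> carrier G" using assms(1) by auto
  have "h \<otimes> y = y \<otimes> h" using inv assms by auto
  then have "inv h \<otimes> (h \<otimes> y) \<otimes> inv h = inv h \<otimes> (y \<otimes> h) \<otimes> inv h" by simp
  then show ?case using assms(2) by (simp add: m_assoc)
next
  case (eng h1 h2)
  then have [simp]: "h1 \<in> carrier G" "h2 \<in> carrier G"
    using assms(1) generate_in_carrier by auto
  show ?case using eng.IH assms(2) by (metis \<open>h1 \<in> carrier G\<close> \<open>h2 \<in> carrier G\<close> m_assoc)
qed (use assms in auto)

lemma conj_generate:
  assumes "S \<subseteq> carrier G" "g \<in> carrier G" "subgroup K G"
    "\<And>s. s \<in> S \<Longrightarrow> inv g \<otimes> s \<otimes> g \<in> K" "x \<in> generate G S"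
  shows "inv g \<otimes> x \<otimes> g \<in> K"
  using assms(5)
proof (induction rule: generate.induct)
  case one then show ?case using assms by (simp add: subgroup.one_closed)
next
  case (incl h) then show ?case using assms by auto
next
  case (inv h)
  then have [simp]: "h \<in> carrier G" using assms(1) by auto
  have "inv (inv g \<otimes> h \<otimes> g) \<in> K" using inv assms by (intro subgroup.m_inv_closed) auto
  then show ?case using assms(2) by (simp add: group_normalize)
next
  case (eng h1 h2)
  then have [simp]: "h1 \<in> carrier G" "h2 \<in> carrier G"
    using assms(1) generate_in_carrier by auto
  have "(inv g \<otimes> h1 \<otimes> g) \<otimes> (inv g \<otimes> h2 \<otimes> g) \<in> K"
    by (rule subgroup.m_closed[OF assms(3) eng.IH])
  then show ?case using assms(2) by (simp add: group_normalize)
qed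

text \<open>For infinite \<open>K\<close> an inclusion of a conjugate of \<open>K\<close> in
  \<open>K\<close> may be proper, so conjugation by a generator and by its inverse are checked
  separately.\<close>

lemma normal_if_normalized_by_generators:
  assumes K: "subgroup K G" and U: "U \<subseteq> carrier G" "carrier G = generate G U"
    and "\<And>x k. x \<in> U \<Longrightarrow> k \<in> K \<Longrightarrow> inv x \<otimes> k \<otimes> x \<in> K"
    and "\<And>x k. x \<in> U \<Longrightarrow> k \<in> K \<Longrightarrow> x \<otimes> k \<otimes> inv x \<in> K"
  shows "K \<lhd> G"
proof -
  have KG: "K \<subseteq> carrier G" using K by (simp add: subgroup.subset)
  have "\<forall>k\<in>K. x \<otimes> k \<otimes> inv x \<in> K" if "x \<in> generate G U" for x
    using that
  proof (induction rule: generate.induct)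
    case (eng h1 h2)
    then have [simp]: "h1 \<in> carrier G" "h2 \<in> carrier G" using U by auto
    show ?case
    proof
      fix k assume k: "k \<in> K"
      then have "h1 \<otimes> (h2 \<otimes> k \<otimes> inv h2) \<otimes> inv h1 \<in> K" using eng by auto
      then show "h1 \<otimes> h2 \<otimes> k \<otimes> inv (h1 \<otimes> h2) \<in> K"
        using k KG by (auto simp: group_normalize subset_iff)
    qed
  qed (use assms KG in \<open>auto simp: subset_iff\<close>)
  then show ?thesis using K U by (auto simp: normal_inv_iff)
qed

lemma normal_generate:
  assumes U: "U \<subseteq> carrier G" "carrier G = generate G U" and S: "S \<subseteq> carrier G"
    and 1: "\<And>x s. x \<in> U \<Longrightarrow> s \<in> S \<Longrightarrow> inv x \<otimes> s \<otimes> x \<in> generate G S"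
    and 2: "\<And>x s. x \<in> U \<Longrightarrow> s \<in> S \<Longrightarrow> x \<otimes> s \<otimes> inv x \<in> generate G S"
  shows "generate G S \<lhd> G"
proof (rule normal_if_normalized_by_generators[OF _ U])
  show sub: "subgroup (generate G S) G" using S by (rule generate_is_subgroup)
  fix x k assume x: "x \<in> U" and k: "k \<in> generate G S"
  have [simp]: "x \<in> carrier G" using x U by auto
  show "inv x \<otimes> k \<otimes> x \<in> generate G S"
    by (rule conj_generate[OF S _ sub _ k]) (use 1 x in auto)
  have "inv (inv x) \<otimes> k \<otimes> inv x \<in> generate G S"
    by (rule conj_generate[OF S _ sub _ k]) (use 2 x in auto)
  then show "x \<otimes> k \<otimes> inv x \<in> generate G S" by simp
qed

text \<open>By \<open>[xy,z] = [x,z]^y [y,z]\<close> and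
  \<open>[x^{-1},z] = x [x,z]^{-1} x^{-1}\<close>, only conjugation by elements of
  \<open>generate G S\<close> occurs, so invariance under those is all that is assumed of
  \<open>K\<close>. This makes the lemma applicable to \<open>B'\<close> in \<open>comm_B\<close>,
  before \<open>B'\<close> is known to be normal in the whole group.\<close>

lemma comm_generate_left:
  assumes S: "S \<subseteq> carrier G" and y [simp]: "y \<in> carrier G" and K: "subgroup K G"
    and norm: "\<And>x k. x \<in> generate G S \<Longrightarrow> k \<in> K \<Longrightarrow> inv x \<otimes> k \<otimes> x \<in> K"
    and gen: "\<And>s. s \<in> S \<Longrightarrow> comm G s y \<in> K" and x: "x \<in> generate G S"
  shows "comm G x y \<in> K"
  using x
proof (induction rule: generate.induct)
  case one then show ?case using K by (simp add: subgroup.one_closed)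
next
  case (incl h) then show ?case using gen by auto
next
  case (inv h)
  then have [simp]: "h \<in> carrier G" using S by auto
  have "inv (inv h) \<otimes> inv (comm G h y) \<otimes> inv h \<in> K"
    using inv gen K by (intro norm generate.inv subgroup.m_inv_closed) auto
  then show ?case by (simp add: comm_inv_left)
next
  case (eng h1 h2)
  then have [simp]: "h1 \<in> carrier G" "h2 \<in> carrier G" using S generate_in_carrier by auto
  show ?case
    using eng norm K by (auto simp: comm_mult_left subgroup.m_closed)
qed

lemma comm_generate_right:
  assumes S: "S \<subseteq> carrier G" and y [simp]: "y \<in> carrier G" and K: "subgroup K G"
    and norm: "\<And>x k. x \<in> generate G S \<Longrightarrow> k \<in> K \<Longrightarrow> inv x \<otimes> k \<otimes> x \<in> K"
    and gen: "\<And>s. s \<in> S \<Longrightarrow> comm G y s \<in> K" and x: "x \<in> generate G S"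
  shows "comm G y x \<in> K"
proof -
  have xG: "x \<in> carrier G" using S x generate_in_carrier by auto
  have "comm G s y \<in> K" if "s \<in> S" for s
    using subgroup.m_inv_closed[OF K gen[OF that]] that S by (auto simp: inv_of_comm)
  then have "comm G x y \<in> K" using comm_generate_left[OF S y K norm _ x] by blast
  from subgroup.m_inv_closed[OF K this] show ?thesis using xG by (simp add: inv_of_comm)
qed

lemma comm_in_normal:
  assumes "N \<lhd> G" "x \<in> N" "y \<in> carrier G"
  shows "comm G x y \<in> N" "comm G y x \<in> N"
proof -
  interpret normal N G by fact
  have x: "x \<in> carrier G" using assms by auto
  have "inv x \<otimes> (inv y \<otimes> x \<otimes> y) \<in> N" using assms by (simp add: inv_op_closed1)
  then show 1: "comm G x y \<in> N" using x assms by (simp add: comm_def m_assoc)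
  show "comm G y x \<in> N" using m_inv_closed[OF 1] x assms by (simp add: inv_of_comm)
qed

lemma rcoset_eq_iff:
  assumes "N \<lhd> G" "x \<in> carrier G" "y \<in> carrier G"
  shows "N #> x = N #> y \<longleftrightarrow> inv x \<otimes> y \<in> N"
proof -
  interpret normal N G by fact
  have "N #> x = N #> y \<longleftrightarrow> y \<in> N #> x"
    using assms is_subgroup repr_independence repr_independenceD by metis
  also have "\<dots> \<longleftrightarrow> y \<otimes> inv x \<in> N"
    using assms rcos_module[of x y] is_group by auto
  also have "\<dots> \<longleftrightarrow> inv x \<otimes> y \<in> N"
  proof
    assume "y \<otimes> inv x \<in> N"
    then have "inv x \<otimes> (y \<otimes> inv x) \<otimes> x \<in> N" using assms by (simp add: inv_op_closed1)
    then show "inv x \<otimes> y \<in> N" using assms by (simp add: m_assoc)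
  next
    assume "inv x \<otimes> y \<in> N"
    from inv_op_closed2[OF _ this, of x] show "y \<otimes> inv x \<in> N" using assms by (simp add: m_assoc)
  qed
  finally show ?thesis .
qed

lemma rcoset_eq_self_iff:
  assumes "subgroup N G" "x \<in> carrier G"
  shows "N #> x = N \<longleftrightarrow> x \<in> N"
  using assms coset_join1 coset_join2 by blast

text \<open>Both power laws come from writing a conjugate of \<open>x\<close> (or of \<open>y\<close>) as a product of two
  commuting factors.\<close>

lemma comm_int_pow_left:
  assumes [simp]: "x \<in> carrier G" "y \<in> carrier G" and "comm G x y \<otimes> x = x \<otimes> comm G x y"
  shows "comm G (x [^] (r::int)) y = comm G x y [^] r"
proof -
  have hom: "inv y \<otimes> x [^] r \<otimes> y = (inv y \<otimes> x \<otimes> y) [^] r"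
  proof -
    have conj: "(\<lambda>z. inv y \<otimes> z \<otimes> y) \<in> hom G G" by (auto simp: hom_def group_normalize)
    show ?thesis using hom_int_pow[OF conj _ group_axioms group_axioms, of x r] by simp
  qed
  also have "\<dots> = (x \<otimes> comm G x y) [^] r" by (simp add: mult_comm)
  also have "\<dots> = x [^] r \<otimes> comm G x y [^] r"
    using assms by (intro int_pow_mult_distrib) auto
  finally have "inv y \<otimes> x [^] r \<otimes> y = x [^] r \<otimes> comm G x y [^] r" .
  then have "inv (x [^] r) \<otimes> (inv y \<otimes> x [^] r \<otimes> y) = comm G x y [^] r" by simp
  then show ?thesis by (simp add: comm_def m_assoc)
qed

lemma comm_int_pow_right:
  assumes [simp]: "x \<in> carrier G" "y \<in> carrier G" and "comm G x y \<otimes> y = y \<otimes> comm G x y"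
  shows "comm G x (y [^] (r::int)) = comm G x y [^] r"
proof -
  have "comm G y x = inv (comm G x y)" by (simp add: inv_of_comm)
  moreover have "inv (comm G x y) \<otimes> y = y \<otimes> inv (comm G x y)"
    using commute_generate[of "{comm G x y}" y "inv (comm G x y)"] assms
    by (auto intro: generate.inv)
  ultimately have "comm G (y [^] r) x = inv (comm G x y) [^] r"
    using comm_int_pow_left[of y x r] by simp
  then have "inv (comm G (y [^] r) x) = comm G x y [^] r" by (simp add: int_pow_inv)
  then show ?thesis by (simp add: inv_of_comm)
qed

end

lemma (in group_hom) hom_comm:
  "x \<in> carrier G \<Longrightarrow> y \<in> carrier G \<Longrightarrow> h (comm G x y) = comm H (h x) (h y)"
  by (simp add: comm_def)

lemma (in group_hom) hom_engel:
  "x \<in> carrier G \<Longrightarrow> y \<in> carrier G \<Longrightarrow> h (engel G x m y) = engel H (h x) m (h y)"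
  by (induction m) (auto simp: hom_comm)

lemma (in normal) group_hom_rcoset: "group_hom G (G Mod H) (\<lambda>x. H #> x)"
  using factorgroup_is_group r_coset_hom_Mod is_group
  by (simp add: group_hom_def group_hom_axioms_def)

section \<open>Expansion of iterated commutators in abelian normal subgroups\<close>

text \<open>Since \<open>[x,z] = x^{-1} x^z\<close>, commutation with \<open>z\<close> is the
  operator \<open>z - 1\<close> on \<open>H\<close> written additively. The lemmas below are
  identities between such operators.\<close>

locale abelian_normal = normal +
  assumes abelian: "x \<in> H \<Longrightarrow> y \<in> H \<Longrightarrow> x \<otimes> y = y \<otimes> x"
begin

lemma in_carrier [simp]: "x \<in> H \<Longrightarrow> x \<in> carrier G"
  by (rule mem_carrier)

lemma abelian_left: "x \<in> H \<Longrightarrow> y \<in> H \<Longrightarrow> z \<in> H \<Longrightarrow> x \<otimes> (y \<otimes> z) = y \<otimes> (x \<otimes> z)"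
  by (metis abelian in_carrier m_assoc)

lemmas abelian_ac = m_assoc abelian abelian_left

lemma pow_in [simp, intro]: "x \<in> H \<Longrightarrow> x [^] (r::int) \<in> H"
  by (rule subgroup_int_pow_closed[OF is_subgroup])

lemma comm_in [simp, intro]: "x \<in> H \<Longrightarrow> y \<in> carrier G \<Longrightarrow> comm G x y \<in> H"
  by (rule comm_in_normal(1)[OF normal_axioms])

lemma engel_in [simp, intro]: "x \<in> H \<Longrightarrow> y \<in> carrier G \<Longrightarrow> engel G x m y \<in> H"
  by (induction m) auto

lemma abelian_pow_mult: "x \<in> H \<Longrightarrow> y \<in> H \<Longrightarrow> (x \<otimes> y) [^] (r::int) = x [^] r \<otimes> y [^] r"
  by (intro int_pow_mult_distrib) (auto simp: abelian)

lemma comm_mult: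
  "x \<in> H \<Longrightarrow> y \<in> H \<Longrightarrow> z \<in> carrier G \<Longrightarrow> comm G (x \<otimes> y) z = comm G x z \<otimes> comm G y z"
  using abelian[of "comm G x z" y] by (simp add: comm_mult_left m_assoc)

lemma comm_pow: "x \<in> H \<Longrightarrow> z \<in> carrier G \<Longrightarrow> comm G (x [^] (r::int)) z = comm G x z [^] r"
  by (rule comm_int_pow_left) (auto simp: abelian)

lemma comm_inv: "x \<in> H \<Longrightarrow> z \<in> carrier G \<Longrightarrow> comm G (inv x) z = inv (comm G x z)"
  using comm_pow[of x z "-1"] by (simp add: int_pow_neg)

lemma engel_mult:
  "x \<in> H \<Longrightarrow> y \<in> H \<Longrightarrow> z \<in> carrier G \<Longrightarrow> engel G (x \<otimes> y) m z = engel G x m z \<otimes> engel G y m z"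
  by (induction m) (auto simp: comm_mult)

lemma engel_pow: "x \<in> H \<Longrightarrow> z \<in> carrier G \<Longrightarrow> engel G (x [^] (r::int)) m z = engel G x m z [^] r"
  by (induction m) (auto simp: comm_pow)

lemma engel_inv: "x \<in> H \<Longrightarrow> z \<in> carrier G \<Longrightarrow> engel G (inv x) m z = inv (engel G x m z)"
  by (induction m) (auto simp: comm_inv)

text \<open>Additively, both sides are the image of \<open>x\<close> under
  \<open>yz - y - z + 1\<close>.\<close>

lemma comm_comm_swap:
  assumes x: "x \<in> H" and y: "y \<in> carrier G" and z: "z \<in> carrier G" and yz: "y \<otimes> z = z \<otimes> y"
  shows "comm G (comm G x y) z = comm G (comm G x z) y"
proof -
  have cj: "inv g \<otimes> x \<otimes> g \<in> H" if "g \<in> carrier G" for g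
    using x that by (simp add: inv_op_closed1)
  have *: "comm G (comm G x y) z
      = (x \<otimes> inv (inv z \<otimes> x \<otimes> z)) \<otimes> (inv (inv y \<otimes> x \<otimes> y) \<otimes> (inv (y \<otimes> z) \<otimes> x \<otimes> (y \<otimes> z)))"
    if y: "y \<in> carrier G" and z: "z \<in> carrier G" for y z
  proof -
    have "comm G (comm G x y) z
      = (inv (inv y \<otimes> x \<otimes> y) \<otimes> x) \<otimes> (inv (inv z \<otimes> x \<otimes> z) \<otimes> (inv (y \<otimes> z) \<otimes> x \<otimes> (y \<otimes> z)))"
      using x y z by (simp add: comm_def group_normalize)
    also have "\<dots> = (x \<otimes> inv (inv z \<otimes> x \<otimes> z)) \<otimes> (inv (inv y \<otimes> x \<otimes> y) \<otimes> (inv (y \<otimes> z) \<otimes> x \<otimes> (y \<otimes> z)))"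
      using x y z cj[OF y] cj[OF z] cj[of "y \<otimes> z"]
      by (simp only: abelian_ac m_inv_closed m_closed subgroup.m_closed in_carrier)
    finally show ?thesis .
  qed
  have "inv (inv z \<otimes> x \<otimes> z) \<in> H" "inv (inv y \<otimes> x \<otimes> y) \<in> H" "inv (y \<otimes> z) \<otimes> x \<otimes> (y \<otimes> z) \<in> H"
    using cj y z by auto
  then show ?thesis
    unfolding *[OF y z] *[OF z y] yz[symmetric] using x by (simp only: abelian_ac m_closed in_carrier)
qed

lemma comm_engel_swap:
  assumes "x \<in> H" "y \<in> carrier G" "z \<in> carrier G" "y \<otimes> z = z \<otimes> y"
  shows "comm G (engel G x m y) z = engel G (comm G x z) m y"
proof (induction m)
  case (Suc m)
  then show ?case using assms comm_comm_swap[of "engel G x m y" y z] by simp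
qed simp

text \<open>This is \<open>z^r - 1 = r (z-1) + C(r,2) (z-1)^2 + ...\<close>, for exponents of either
  sign. The remainder is kept only as an unspecified third-order term, because it is going to vanish
  for reasons of degree.\<close>

lemma comm_pow_right_expand:
  fixes r :: int
  assumes z [simp]: "z \<in> carrier G"
  shows "x \<in> H \<Longrightarrow> \<exists>y\<in>H. comm G x (z [^] r)
    = comm G x z [^] r \<otimes> engel G x 2 z [^] (r * (r - 1) div 2) \<otimes> engel G y 3 z"
proof (induction r arbitrary: x rule: int_induct[where k = 0])
  case base
  then show ?case by (intro bexI[of _ "\<one>"]) (auto simp: numeral_2_eq_2)
next
  case (step1 r)
  note x = \<open>x \<in> H\<close>
  obtain y where y: "y \<in> H" and eq: "comm G x (z [^] r)
    = comm G x z [^] r \<otimes> engel G x 2 z [^] (r * (r - 1) div 2) \<otimes> engel G y 3 z"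
    using step1 by blast
  define C where "C = r * (r - 1) div 2"
  have C: "(r + 1) * (r + 1 - 1) div 2 = C + r"
  proof -
    have "even ((r + 1) * (r + 1 - 1))" "even (r * (r-1))" by auto
    then show ?thesis unfolding C_def by (auto simp: algebra_simps elim!: evenE)
  qed
  have "comm G x (z [^] (r + 1)) = comm G x (z [^] r \<otimes> z)"
    using int_pow_mult[of z r 1] by simp
  also have "\<dots> = comm G x z \<otimes> (inv z \<otimes> comm G x (z [^] r) \<otimes> z)"
    using x by (simp add: comm_mult_right)
  also have "\<dots> = comm G x z \<otimes> (comm G x (z [^] r) \<otimes> comm G (comm G x (z [^] r)) z)"
    using x by (simp add: mult_comm)
  also have "comm G (comm G x (z [^] r)) z
      = engel G x 2 z [^] r \<otimes> engel G x 3 z [^] C \<otimes> engel G (comm G y z) 3 z"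
    using x y by (simp add: eq C_def comm_mult comm_pow numeral_2_eq_2 numeral_3_eq_3)
  also have "comm G x z \<otimes> (comm G x (z [^] r) \<otimes> (engel G x 2 z [^] r \<otimes> engel G x 3 z [^] C \<otimes> engel G (comm G y z) 3 z))
     = (comm G x z [^] r \<otimes> comm G x z) \<otimes> (engel G x 2 z [^] C \<otimes> engel G x 2 z [^] r) \<otimes> (engel G x 3 z [^] C \<otimes> engel G y 3 z \<otimes> engel G (comm G y z) 3 z)"
    unfolding eq C_def[symmetric]
    using x y by (simp add: abelian_ac)
  also have "engel G x 3 z [^] C \<otimes> engel G y 3 z \<otimes> engel G (comm G y z) 3 z = engel G (x [^] C \<otimes> y \<otimes> comm G y z) 3 z"
    using x y by (simp add: engel_mult engel_pow)
  also have "comm G x z [^] r \<otimes> comm G x z = comm G x z [^] (r + 1)"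
    using int_pow_mult[of "comm G x z" r 1] x by simp
  also have "engel G x 2 z [^] C \<otimes> engel G x 2 z [^] r = engel G x 2 z [^] (C + r)"
    using x by (simp add: int_pow_mult)
  finally show ?case unfolding C
    using x y by (intro bexI[of _ "x [^] C \<otimes> y \<otimes> comm G y z"]) auto
next
  case (step2 r)
  note x = \<open>x \<in> H\<close>
  \<comment> \<open>For the downward step, \<open>x = z x'\<close> additively, so \<open>x\<close>
    under \<open>z^(r-1) - 1\<close> equals \<open>x'\<close> under
    \<open>(z^r - 1) - (z - 1)\<close>, to which the induction hypothesis for \<open>x'\<close>
    applies.\<close>
  define x' where "x' = z \<otimes> x \<otimes> inv z"
  have x': "x' \<in> H" using x by (simp add: x'_def inv_op_closed2)
  have xx': "x = x' \<otimes> comm G x' z"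
    using x by (simp add: mult_comm x' x'_def) (simp add: m_assoc)
  obtain y where y: "y \<in> H" and eq: "comm G x' (z [^] r)
    = comm G x' z [^] r \<otimes> engel G x' 2 z [^] (r * (r - 1) div 2) \<otimes> engel G y 3 z"
    using step2(2) x' by blast
  define C where "C = r * (r - 1) div 2"
  have C: "(r - 1) * (r - 1 - 1) div 2 = C - (r - 1)"
  proof -
    have "even ((r-1) * (r-1-1))" "even (r * (r-1))" by auto
    then show ?thesis unfolding C_def by (auto simp: algebra_simps elim!: evenE)
  qed
  have inv_x': "x' = x \<otimes> inv (comm G x' z)"
    using x x' by (subst xx') (simp add: m_assoc)
  \<comment> \<open>Replacing \<open>x'\<close> by \<open>x\<close> again costs one order each time,
    so two such replacements move the difference into the third-order remainder.\<close>
  have d1: "comm G x' z = comm G x z \<otimes> inv (engel G x' 2 z)"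
    using x x' by (subst inv_x') (simp add: comm_mult comm_inv numeral_2_eq_2)
  have d2: "engel G x' 2 z = engel G x 2 z \<otimes> inv (engel G x' 3 z)"
    using x x' by (subst inv_x') (simp add: comm_mult comm_inv numeral_2_eq_2 numeral_3_eq_3)
  have zr: "z [^] (r - 1) = inv z \<otimes> z [^] r"
    using int_pow_mult[of z "-1" r] by (simp add: int_pow_neg)
  have "comm G x (z [^] (r - 1)) = inv x \<otimes> x' \<otimes> comm G x' (z [^] r)"
    using x by (simp add: zr x'_def comm_def group_normalize)
  also have "inv x \<otimes> x' = inv (comm G x' z)"
    using x' by (subst xx') (simp add: group_normalize)
  also have "inv (comm G x' z) \<otimes> comm G x' (z [^] r)
    = (inv (comm G x' z) \<otimes> comm G x' z [^] r) \<otimes> engel G x' 2 z [^] C \<otimes> engel G y 3 z"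
    unfolding eq C_def[symmetric] using x' y by (simp add: m_assoc)
  also have "inv (comm G x' z) \<otimes> comm G x' z [^] r = comm G x' z [^] (r - 1)"
    using int_pow_mult[of "comm G x' z" "-1" r] x' by (simp add: int_pow_neg)
  also have "\<dots> = comm G x z [^] (r - 1) \<otimes> engel G x' 2 z [^] (- (r - 1))"
    using x x' by (subst d1) (simp add: abelian_pow_mult int_pow_inv int_pow_neg[symmetric])
  also have "comm G x z [^] (r - 1) \<otimes> engel G x' 2 z [^] (- (r - 1)) \<otimes> engel G x' 2 z [^] C
     = comm G x z [^] (r - 1) \<otimes> engel G x' 2 z [^] (C - (r - 1))"
    using int_pow_mult[of "engel G x' 2 z" "- (r - 1)" C] x x' by (simp add: m_assoc) (simp add: algebra_simps)
  also have "engel G x' 2 z [^] (C - (r - 1)) = engel G x 2 z [^] (C - (r - 1)) \<otimes> engel G (inv x' [^] (C - (r - 1))) 3 z"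
    using x x' by (subst d2) (simp add: abelian_pow_mult int_pow_inv int_pow_neg engel_pow engel_inv)
  finally have "comm G x (z [^] (r - 1)) = comm G x z [^] (r - 1) \<otimes> engel G x 2 z [^] (C - (r - 1))
     \<otimes> engel G (inv x' [^] (C - (r - 1)) \<otimes> y) 3 z"
    using x x' y by (simp add: m_assoc engel_mult)
  then show ?case unfolding C
    using x x' y by (intro bexI[of _ "inv x' [^] (C - (r - 1)) \<otimes> y"]) auto
qed

text \<open>The two lowest terms of the \<open>j\<close>-th power of
  \<open>r (z-1) + C(r,2) (z-1)^2 + ...\<close>. For \<open>j = 0\<close> the exponent
  \<open>j - 1\<close> is truncated, but the factor \<open>int j\<close> removes that term.\<close>

lemma engel_pow_right_expand:
  fixes r :: int
  assumes z [simp]: "z \<in> carrier G"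
  shows "x \<in> H \<Longrightarrow> \<exists>y\<in>H. engel G x j (z [^] r) = engel G x j z [^] (r ^ j)
    \<otimes> engel G x (j + 1) z [^] (int j * r ^ (j - 1) * (r * (r - 1) div 2)) \<otimes> engel G y (j + 2) z"
proof (induction j)
  case 0
  then show ?case by (intro bexI[of _ "\<one>"]) auto
next
  case (Suc j)
  note x = \<open>x \<in> H\<close>
  define C where "C = r * (r - 1) div 2"
  define K where "K = int j * r ^ (j - 1) * C"
  obtain y where y: "y \<in> H" and eq: "engel G x j (z [^] r) = engel G x j z [^] (r ^ j)
    \<otimes> engel G x (j + 1) z [^] K \<otimes> engel G y (j + 2) z"
    using Suc unfolding C_def K_def by blast
  obtain y0 where y0: "y0 \<in> H" and eq0: "comm G x (z [^] r)
      = comm G x z [^] r \<otimes> engel G x 2 z [^] C \<otimes> engel G y0 3 z"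
    using comm_pow_right_expand[OF z x] unfolding C_def by blast
  obtain y1 where y1: "y1 \<in> H" and eq1: "comm G y (z [^] r)
      = comm G y z [^] r \<otimes> engel G y 2 z [^] C \<otimes> engel G y1 3 z"
    using comm_pow_right_expand[OF z y] unfolding C_def by blast
  have zz: "z \<otimes> z [^] r = z [^] r \<otimes> z"
    using int_pow_mult[of z r 1] int_pow_mult[of z 1 r] by (simp add: add.commute)
  have P: "comm G (engel G x i z) (z [^] r)
      = engel G x (i + 1) z [^] r \<otimes> engel G x (i + 2) z [^] C \<otimes> engel G y0 (i + 3) z" for i
  proof -
    have "engel G (engel G x k z) i z = engel G x (i + k) z" "engel G (engel G y0 k z) i z = engel G y0 (i + k) z" for k
      by (simp_all add: add.commute flip: engel_add)
    note this[of 2] this[of 3] this[of 1]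
    moreover have "engel G (comm G x z) i z = engel G x (i + 1) z"
      using engel_Suc_left[of x i z] by (simp only: Suc_eq_plus1)
    moreover have "comm G (engel G x i z) (z [^] r) = engel G (comm G x (z [^] r)) i z"
      using x by (intro comm_engel_swap zz) auto
    ultimately show ?thesis
      using x y0 by (simp add: eq0 engel_mult engel_pow del: engel.simps)
  qed
  define w where "w = y [^] r \<otimes> comm G y z [^] C \<otimes> engel G y1 2 z"
  have w: "w \<in> H" using y y1 by (auto simp: w_def)
  have Y: "comm G (engel G y (j + 2) z) (z [^] r) = engel G w (j + 3) z"
  proof -
    have "comm G y (z [^] r) = comm G w z"
      using y y1 by (simp add: eq1 w_def comm_mult comm_pow numeral_2_eq_2 numeral_3_eq_3)
    then have "comm G (engel G y (j + 2) z) (z [^] r) = engel G (comm G w z) (j + 2) z"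
      using y by (subst comm_engel_swap) (auto simp: zz)
    also have "\<dots> = engel G w (j + 3) z"
      using engel_Suc_left[of w "j + 2" z] by (simp only: add_Suc_right[symmetric] eval_nat_numeral)
    finally show ?thesis .
  qed
  define y' where "y' = y0 [^] (r ^ j) \<otimes> (x [^] C \<otimes> comm G y0 z) [^] K \<otimes> w"
  have y': "y' \<in> H" using x y0 w by (auto simp: y'_def)
  have S: "C * r ^ j + r * K = int (Suc j) * r ^ (Suc j - 1) * C"
    unfolding K_def by (cases j) (auto simp: algebra_simps)
  have "engel G x (Suc j) (z [^] r) = comm G (engel G x j (z [^] r)) (z [^] r)"
    by simp
  also have "\<dots> = comm G (engel G x j z) (z [^] r) [^] (r ^ j)
     \<otimes> comm G (engel G x (j + 1) z) (z [^] r) [^] K \<otimes> comm G (engel G y (j + 2) z) (z [^] r)"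
    unfolding eq using x y by (simp add: comm_mult comm_pow del: engel.simps)
  also have "\<dots> = (engel G x (j + 1) z [^] r \<otimes> engel G x (j + 2) z [^] C \<otimes> engel G y0 (j + 3) z) [^] (r ^ j)
     \<otimes> (engel G x (j + 2) z [^] r \<otimes> engel G x (j + 3) z [^] C \<otimes> engel G y0 (j + 4) z) [^] K \<otimes> engel G w (j + 3) z"
    unfolding Y P by (simp add: add.assoc eval_nat_numeral del: engel.simps add_Suc_right)
  also have "engel G y0 (j + 4) z = engel G (comm G y0 z) (j + 3) z"
    using engel_Suc_left[of y0 "j + 3" z] by (simp del: engel.simps add: eval_nat_numeral)
  also have "(engel G x (j + 1) z [^] r \<otimes> engel G x (j + 2) z [^] C \<otimes> engel G y0 (j + 3) z) [^] (r ^ j)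
     \<otimes> (engel G x (j + 2) z [^] r \<otimes> engel G x (j + 3) z [^] C \<otimes> engel G (comm G y0 z) (j + 3) z) [^] K \<otimes> engel G w (j + 3) z
    = engel G x (j + 1) z [^] (r * r ^ j) \<otimes> (engel G x (j + 2) z [^] (C * r ^ j) \<otimes> engel G x (j + 2) z [^] (r * K))
     \<otimes> engel G y' (j + 3) z"
    using x y0 w
    by (simp add: y'_def abelian_pow_mult int_pow_pow engel_mult engel_pow abelian_ac del: engel.simps)
  also have "engel G x (j + 2) z [^] (C * r ^ j) \<otimes> engel G x (j + 2) z [^] (r * K)
    = engel G x (j + 2) z [^] (int (Suc j) * r ^ (Suc j - 1) * C)"
    using x by (simp only: int_pow_mult S[symmetric] in_carrier engel_in z)
  finally show ?case
    using y' unfolding C_def by (intro bexI[of _ y']) (auto simp: eval_nat_numeral simp del: engel.simps)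
qed

end

section \<open>Groups satisfying the relations of \<open>H\<close>\<close>

text \<open>The relations of \<open>H\<close> in the form in which they act.
  \<open>engel_comm_trivial\<close> is what class at most \<open>n + 2\<close> says about
  \<open>[b,_i a,b,_m a]\<close>, a commutator of weight \<open>i + m + 2\<close>;
  \<open>class_two\<close> concerns a commutator with three entries \<open>b\<close>.\<close>

locale two_generator = group +
  fixes a b :: 'a and n :: nat
  assumes a [simp]: "a \<in> carrier G" and b [simp]: "b \<in> carrier G"
    and generators: "carrier G = generate G {a, b}"
    and engel_b_a_trivial: "engel G b (Suc n) a = \<one>"
    and comm_engel_b_trivial: "comm G (engel G b n a) b = \<one>"
    and engel_comm_trivial: "i + m > n \<Longrightarrow> engel G (comm G (engel G b i a) b) m a = \<one>"
    and class_two: "comm G (comm G (engel G b i a) (engel G b j a)) (engel G b k a) = \<one>"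
begin

definition c :: "nat \<Rightarrow> 'a" where "c i = engel G b i a"

definition B :: "'a set" where "B = generate G (range c)"

definition B' :: "'a set" where "B' = generate G {comm G (c i) (c j) | i j. True}"

lemma c_in_carrier [simp]: "c i \<in> carrier G"
  by (simp add: c_def)

lemma c_0: "c 0 = b" and c_Suc: "c (Suc i) = comm G (c i) a"
  by (simp_all add: c_def)

lemma c_trivial: "i > n \<Longrightarrow> c i = \<one>"
  using engel_b_a_trivial engel_add[of b "Suc n" "i - Suc n" a] by (simp add: c_def)

lemma subgroup_B: "subgroup B G"
  unfolding B_def by (rule generate_is_subgroup) auto

lemma subgroup_B': "subgroup B' G"
  unfolding B'_def by (rule generate_is_subgroup) auto

lemma c_in_B [simp, intro]: "c i \<in> B"
  unfolding B_def by (auto intro: generate.incl)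

lemma b_in_B [simp, intro]: "b \<in> B"
  by (metis c_0 c_in_B)

lemma B_carrier [simp]: "x \<in> B \<Longrightarrow> x \<in> carrier G"
  by (rule subgroup.mem_carrier[OF subgroup_B])

lemma B'_carrier [simp]: "x \<in> B' \<Longrightarrow> x \<in> carrier G"
  by (rule subgroup.mem_carrier[OF subgroup_B'])

lemma B'_central:
  assumes "x \<in> B'" "y \<in> B"
  shows "x \<otimes> y = y \<otimes> x"
proof -
  have 1: "z \<otimes> c k = c k \<otimes> z" if "z \<in> B'" for z k
    using that unfolding B'_def
  proof (rule commute_generate[rotated -1])
    fix s assume "s \<in> {comm G (c i) (c j) |i j. True}"
    then obtain i j where s: "s = comm G (c i) (c j)" by auto
    show "s \<otimes> c k = c k \<otimes> s"
      using class_two[of i j k] s by (simp add: comm_eq_one_iff flip: c_def)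
  qed auto
  show ?thesis
    using commute_generate[of "range c" x y] 1 assms unfolding B_def[symmetric] by fastforce
qed

lemma B_closed [simp, intro]:
  "x \<in> B \<Longrightarrow> y \<in> B \<Longrightarrow> x \<otimes> y \<in> B" "x \<in> B \<Longrightarrow> inv x \<in> B" "x \<in> B \<Longrightarrow> x [^] (r::int) \<in> B" "\<one> \<in> B"
  using subgroup_B by (auto simp: subgroup.m_closed subgroup.m_inv_closed subgroup_int_pow_closed subgroup.one_closed)

lemma B'_closed [simp, intro]:
  "x \<in> B' \<Longrightarrow> y \<in> B' \<Longrightarrow> x \<otimes> y \<in> B'" "x \<in> B' \<Longrightarrow> inv x \<in> B'" "x \<in> B' \<Longrightarrow> x [^] (r::int) \<in> B'" "\<one> \<in> B'"
  using subgroup_B' by (auto simp: subgroup.m_closed subgroup.m_inv_closed subgroup_int_pow_closed subgroup.one_closed)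

lemma comm_B: "x \<in> B \<Longrightarrow> y \<in> B \<Longrightarrow> comm G x y \<in> B'"
proof -
  assume x: "x \<in> B" and y: "y \<in> B"
  have norm: "inv x \<otimes> k \<otimes> x \<in> B'" if "x \<in> generate G (range c)" "k \<in> B'" for x k
  proof -
    have "x \<in> B" using that by (simp add: B_def)
    then show ?thesis using B'_central[OF that(2), of x] that(2) by (simp add: m_assoc)
  qed
  have yG: "y \<in> carrier G" and x': "x \<in> generate G (range c)" and y': "y \<in> generate G (range c)"
    using x y by (simp_all add: B_def[symmetric])
  have cG: "range c \<subseteq> carrier G" by auto
  have "comm G (c i) s \<in> B'" if "s \<in> range c" for i s
    using that unfolding B'_def by (auto intro: generate.incl)
  from comm_generate_right[OF cG c_in_carrier subgroup_B' norm this y']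
  have "comm G s y \<in> B'" if "s \<in> range c" for s using that by auto
  from comm_generate_left[OF cG yG subgroup_B' norm this x']
  show ?thesis .
qed

lemma comm_mult_left_B:
  assumes "x \<in> B" "y \<in> B" "z \<in> B"
  shows "comm G (x \<otimes> y) z = comm G x z \<otimes> comm G y z"
  using assms B'_central[OF comm_B[of x z], of y] by (simp add: comm_mult_left m_assoc)

lemma comm_mult_right_B:
  assumes "x \<in> B" "y \<in> B" "z \<in> B"
  shows "comm G z (x \<otimes> y) = comm G z x \<otimes> comm G z y"
proof -
  have "comm G z (x \<otimes> y) = comm G z y \<otimes> comm G z x"
    using assms B'_central[OF comm_B[of z x], of y] by (simp add: comm_mult_right m_assoc)
  moreover have "comm G z y \<in> B" using assms by (simp add: comm_def)
  ultimately show ?thesis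
    using assms B'_central[OF comm_B[of z x], of "comm G z y"] by simp
qed

lemma comm_pow_left_B:
  "x \<in> B \<Longrightarrow> z \<in> B \<Longrightarrow> comm G (x [^] (r::int)) z = comm G x z [^] r"
  by (rule comm_int_pow_left) (auto simp: B'_central[OF comm_B])

lemma comm_inv_left_B: "x \<in> B \<Longrightarrow> z \<in> B \<Longrightarrow> comm G (inv x) z = inv (comm G x z)"
  using comm_pow_left_B[of x z "-1"] by (simp add: int_pow_neg)

lemma comm_B'_B [simp]: "x \<in> B' \<Longrightarrow> y \<in> B \<Longrightarrow> comm G x y = \<one>"
  using B'_central[of x y] by (simp add: comm_eq_one_iff)

lemma comm_B_B' [simp]: "x \<in> B' \<Longrightarrow> y \<in> B \<Longrightarrow> comm G y x = \<one>"
  using B'_central[of x y] by (simp add: comm_eq_one_iff)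

lemma B'_subset_B: "B' \<subseteq> B"
proof -
  have "{comm G (c i) (c j) | i j. True} \<subseteq> B" by (auto simp: comm_def)
  then show ?thesis unfolding B'_def using generate_subgroup_incl subgroup_B by blast
qed

lemma c_conj: "inv a \<otimes> c i \<otimes> a = c i \<otimes> c (Suc i)"
  by (simp add: c_Suc mult_comm)

text \<open>Conjugation by \<open>a\<^sup>-\<^sup>1\<close> is handled by descending induction, since \<open>c i = \<one>\<close> for \<open>i > n\<close>.\<close>

lemma c_conj_inv:
  assumes K: "subgroup K G" and "\<And>l. l \<ge> k \<Longrightarrow> c l \<in> K" and "i \<ge> k"
  shows "a \<otimes> c i \<otimes> inv a \<in> K"
  using \<open>i \<ge> k\<close>
proof (induction "Suc n - i" arbitrary: i rule: less_induct)
  case less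
  show ?case
  proof (cases "i > n")
    case True
    then show ?thesis using K by (simp add: c_trivial subgroup.one_closed)
  next
    case False
    have "a \<otimes> c i \<otimes> inv a = c i \<otimes> inv (a \<otimes> c (Suc i) \<otimes> inv a)"
    proof -
      have "c i = (a \<otimes> c i \<otimes> inv a) \<otimes> (a \<otimes> c (Suc i) \<otimes> inv a)"
        by (simp add: c_Suc comm_def group_normalize)
      then show ?thesis by (metis a c_in_carrier inv_closed inv_solve_right m_closed)
    qed
    moreover have "a \<otimes> c (Suc i) \<otimes> inv a \<in> K"
      using less False by auto
    ultimately show ?thesis
      using less(2) assms by (simp add: subgroup.m_closed subgroup.m_inv_closed)
  qed
qed

lemma normal_B: "B \<lhd> G"
  unfolding B_def
proof (rule normal_generate[OF _ generators]; (fold B_def)?)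
  fix x s assume x: "x \<in> {a, b}" and s: "s \<in> range c"
  then obtain i where s: "s = c i" by auto
  show "inv x \<otimes> s \<otimes> x \<in> B" using x s by (auto simp: c_conj)
  show "x \<otimes> s \<otimes> inv x \<in> B"
    using x s c_conj_inv[OF subgroup_B, of 0 i] by auto
qed auto

lemma conj_comm:
  "x \<in> carrier G \<Longrightarrow> y \<in> carrier G \<Longrightarrow> g \<in> carrier G \<Longrightarrow>
    inv g \<otimes> comm G x y \<otimes> g = comm G (inv g \<otimes> x \<otimes> g) (inv g \<otimes> y \<otimes> g)"
  by (simp add: comm_def group_normalize)

lemma normal_B': "B' \<lhd> G"
  unfolding B'_def
proof (rule normal_generate[OF _ generators]; (fold B'_def)?)
  interpret B: normal B G by (rule normal_B)
  have *: "inv g \<otimes> comm G (c i) (c j) \<otimes> g \<in> B'" if "g \<in> carrier G" for g i j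
    using that by (simp add: conj_comm comm_B B.inv_op_closed1)
  fix x s assume x: "x \<in> {a, b}" and s: "s \<in> {comm G (c i) (c j) | i j. True}"
  then obtain i j where s: "s = comm G (c i) (c j)" by auto
  have xG: "x \<in> carrier G" using x by auto
  show "inv x \<otimes> s \<otimes> x \<in> B'" using * xG s by auto
  show "x \<otimes> s \<otimes> inv x \<in> B'" using *[of "inv x"] xG s by auto
qed auto

sublocale B': abelian_normal B' G
  by (intro abelian_normal.intro normal_B' abelian_normal_axioms.intro)
     (use B'_central B'_subset_B in auto)

sublocale B: normal B G
  by (rule normal_B)

subsection \<open>Weight filtrations\<close>

text \<open>\<open>D k\<close> stands in for \<open>B' \<inter> \<gamma>\<^bsub>k+2\<^esub>\<close>: all that is ever used of weight is how many entries \<open>a\<close>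
  still have to be added to reach the identity.\<close>

definition D :: "nat \<Rightarrow> 'a set" where
  "D k = {x \<in> B'. \<forall>m. m + k > n \<longrightarrow> engel G x m a = \<one>}"

lemma D_subset: "D k \<subseteq> B'"
  by (auto simp: D_def)

lemma D_mono: "l \<le> k \<Longrightarrow> x \<in> D k \<Longrightarrow> x \<in> D l"
  by (auto simp: D_def)

lemma D_trivial: "x \<in> D k \<Longrightarrow> k > n \<Longrightarrow> x = \<one>"
  unfolding D_def by (auto dest: spec[of _ 0])

lemma D_engel: "x \<in> D k \<Longrightarrow> m + k > n \<Longrightarrow> engel G x m a = \<one>"
  by (auto simp: D_def)

lemma D_comm: "x \<in> D k \<Longrightarrow> comm G x a \<in> D (Suc k)"
  by (auto simp: D_def engel_Suc_left[symmetric] simp del: engel.simps)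

lemma subgroup_D: "subgroup (D k) G"
  by (rule subgroupI) (auto simp: D_def B'.engel_inv B'.engel_mult)

lemma normal_D: "D k \<lhd> G"
proof (rule normal_if_normalized_by_generators[OF subgroup_D _ generators])
  fix x d assume x: "x \<in> {a, b}" and d: "d \<in> D k"
  have dB: "d \<in> B'" using d D_subset by auto
  have engel_conj: "engel G (a \<otimes> d \<otimes> inv a) m a = a \<otimes> engel G d m a \<otimes> inv a" for m
  proof (induction m)
    case (Suc m)
    then show ?case using dB by (simp add: comm_def group_normalize)
  qed (use dB in simp)
  have "a \<otimes> d \<otimes> inv a \<in> D k"
    using d dB by (auto simp: D_def B'.inv_op_closed2 engel_conj)
  moreover have "inv a \<otimes> d \<otimes> a \<in> D k"
  proof -
    have "d \<otimes> comm G d a \<in> D k"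
      using d D_comm[OF d] D_mono[of k "Suc k"] subgroup_D by (auto simp: subgroup.m_closed)
    then show ?thesis using dB by (simp add: mult_comm)
  qed
  moreover have "inv b \<otimes> d \<otimes> b = d" "b \<otimes> d \<otimes> inv b = d"
    using B'_central[OF dB, of b] B'_central[OF dB, of "inv b"] dB by (simp_all add: m_assoc)
  ultimately show "inv x \<otimes> d \<otimes> x \<in> D k" "x \<otimes> d \<otimes> inv x \<in> D k"
    using x d by auto
qed auto

text \<open>Conjugation by \<open>a\<close> sends \<open>x\<close> to \<open>x [x,a]\<close>, and
  the commutator is bilinear on \<open>B\<close>; expanding \<open>[x,y]^a = [x^a,y^a]\<close> gives
  a Leibniz rule with one quadratic term. On sequences the same rule is
  \<open>fdiff_mult\<close>.\<close>

lemma comm_comm_a: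
  assumes x: "x \<in> B" and y: "y \<in> B"
  shows "comm G (comm G x y) a
    = comm G x (comm G y a) \<otimes> comm G (comm G x a) y \<otimes> comm G (comm G x a) (comm G y a)"
proof -
  have d: "comm G x a \<in> B" "comm G y a \<in> B"
    using comm_in_normal[OF normal_B] x y by auto
  have "comm G x y \<otimes> comm G (comm G x y) a = comm G (x \<otimes> comm G x a) (y \<otimes> comm G y a)"
    using x y by (simp add: mult_comm conj_comm)
  also have "\<dots> = comm G x y \<otimes> (comm G x (comm G y a) \<otimes> comm G (comm G x a) y \<otimes> comm G (comm G x a) (comm G y a))"
    using x y d comm_B by (simp add: comm_mult_left_B comm_mult_right_B B'.abelian_ac)
  finally show ?thesis using x y d by simp
qed

text \<open>The relations only speak of \<open>[c_i, b]\<close>. An entry \<open>a\<close> is moved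
  to the second argument by solving \<open>comm_comm_a\<close> for \<open>[c_i, c_{j+1}]\<close>.
  The quadratic term \<open>[c_{i+1}, c_{j+1}]\<close> has the same second index, so an inner
  descending induction on \<open>i\<close> is needed; it starts from \<open>c_i = 1\<close> for
  \<open>i > n\<close>.\<close>

lemma comm_c_in_D: "comm G (c i) (c j) \<in> D (i + j)"
proof (induction j arbitrary: i)
  case 0
  show ?case
    using engel_comm_trivial[of i] comm_B[OF c_in_B c_in_B, of i 0]
    by (auto simp: D_def c_def add.commute)
next
  case (Suc j)
  show ?case
  proof (induction "Suc n - i" arbitrary: i rule: less_induct)
    case less
    show ?case
    proof (cases "i > n")
      case True
      then show ?thesis using subgroup_D by (simp add: c_trivial subgroup.one_closed)
    next
      case False
      interpret D: subgroup "D (i + Suc j)" G by (rule subgroup_D)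
      have 1: "comm G (c (Suc i)) (c (Suc j)) \<in> D (i + Suc j)"
        using less[of "Suc i"] False D_mono[of "i + Suc j" "Suc i + Suc j"] by auto
      have 2: "comm G (c (Suc i)) (c j) \<in> D (i + Suc j)"
        using Suc[of "Suc i"] by simp
      have 3: "comm G (comm G (c i) (c j)) a \<in> D (i + Suc j)"
        using D_comm[OF Suc[of i]] by simp
      have eq: "comm G (comm G (c i) (c j)) a
        = comm G (c i) (c (Suc j)) \<otimes> comm G (c (Suc i)) (c j) \<otimes> comm G (c (Suc i)) (c (Suc j))"
        using comm_comm_a[of "c i" "c j"] by (simp add: c_Suc)
      have "comm G (c i) (c (Suc j)) = comm G (comm G (c i) (c j)) a
         \<otimes> inv (comm G (c (Suc i)) (c j) \<otimes> comm G (c (Suc i)) (c (Suc j)))"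
        unfolding eq by (simp add: group_normalize)
      then show ?thesis using 1 2 3 by (simp only: D.m_closed D.m_inv_closed)
    qed
  qed
qed

end

section \<open>Commutators of powers and products modulo a normal subgroup\<close>

context group
begin

lemma comm_pow_right_in_normal:
  assumes "N \<lhd> G" "x \<in> carrier G" "y \<in> carrier G" "comm G x y \<in> N"
  shows "comm G x (y [^] (r::int)) \<in> N"
proof -
  interpret N: normal N G by fact
  have y: "{y} \<subseteq> carrier G" using assms by auto
  have "y [^] r \<in> generate G {y}" using generate_pow[OF assms(3)] by auto
  moreover have "inv g \<otimes> k \<otimes> g \<in> N" if "g \<in> generate G {y}" "k \<in> N" for g k
    by (rule N.inv_op_closed1[OF generate_in_carrier[OF y that(1)] that(2)])
  ultimately show ?thesis
    using comm_generate_right[OF y assms(2) N.is_subgroup] assms by blast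
qed

lemma comm_pow_right_mod:
  assumes "N \<lhd> G" and [simp]: "x \<in> carrier G" "y \<in> carrier G" and "comm G (comm G x y) y \<in> N"
  shows "N #> comm G x (y [^] (r::int)) = N #> comm G x y [^] r"
proof -
  interpret N: normal N G by fact
  interpret h: group_hom G "G Mod N" "\<lambda>x. N #> x" by (rule N.group_hom_rcoset)
  have "comm (G Mod N) (comm (G Mod N) (N #> x) (N #> y)) (N #> y) = \<one>\<^bsub>G Mod N\<^esub>"
    using assms rcoset_eq_self_iff[OF N.is_subgroup] by (simp flip: h.hom_comm)
  then have "comm (G Mod N) (N #> x) ((N #> y) [^]\<^bsub>G Mod N\<^esub> r) = comm (G Mod N) (N #> x) (N #> y) [^]\<^bsub>G Mod N\<^esub> r"
    by (intro h.H.comm_int_pow_right) (auto simp: h.H.comm_eq_one_iff simp del: one_FactGroup mult_FactGroup)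
  then show ?thesis by (simp add: h.hom_comm h.hom_int_pow)
qed

lemma comm_pow_left_mod:
  assumes "N \<lhd> G" and [simp]: "x \<in> carrier G" "y \<in> carrier G" and "comm G (comm G x y) x \<in> N"
  shows "N #> comm G (x [^] (r::int)) y = N #> comm G x y [^] r"
proof -
  interpret N: normal N G by fact
  interpret h: group_hom G "G Mod N" "\<lambda>x. N #> x" by (rule N.group_hom_rcoset)
  have "comm (G Mod N) (comm (G Mod N) (N #> x) (N #> y)) (N #> x) = \<one>\<^bsub>G Mod N\<^esub>"
    using assms rcoset_eq_self_iff[OF N.is_subgroup] by (simp flip: h.hom_comm)
  then have "comm (G Mod N) ((N #> x) [^]\<^bsub>G Mod N\<^esub> r) (N #> y) = comm (G Mod N) (N #> x) (N #> y) [^]\<^bsub>G Mod N\<^esub> r"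
    by (intro h.H.comm_int_pow_left) (auto simp: h.H.comm_eq_one_iff simp del: one_FactGroup mult_FactGroup)
  then show ?thesis by (simp add: h.hom_comm h.hom_int_pow)
qed

lemma comm_mult_left_mod:
  assumes "N \<lhd> G" and [simp]: "x \<in> carrier G" "y \<in> carrier G" "z \<in> carrier G"
    and "comm G z y \<in> N" "comm G (comm G x y) z \<in> N"
  shows "N #> comm G (x \<otimes> z) y = N #> comm G x y"
proof -
  interpret N: normal N G by fact
  have "comm G (x \<otimes> z) y = comm G x y \<otimes> comm G (comm G x y) z \<otimes> comm G z y"
    by (simp add: comm_mult_left mult_comm)
  then have "inv (comm G x y) \<otimes> comm G (x \<otimes> z) y = comm G (comm G x y) z \<otimes> comm G z y"
    by (simp add: m_assoc)
  then have "N #> comm G x y = N #> comm G (x \<otimes> z) y"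
    using assms by (subst rcoset_eq_iff) auto
  then show ?thesis by simp
qed

lemma rcoset_pow_cong:
  assumes "N \<lhd> G" "x \<in> carrier G" "y \<in> carrier G" "N #> x = N #> y"
  shows "N #> x [^] (r::int) = N #> y [^] r"
proof -
  interpret N: normal N G by fact
  interpret h: group_hom G "G Mod N" "\<lambda>x. N #> x" by (rule N.group_hom_rcoset)
  show ?thesis using assms by (simp add: h.hom_int_pow)
qed

end

text \<open>Used twice. With \<open>W = D\<close> the subgroups \<open>Fil k\<close> descend to the
  identity and give exact identities in the end; with \<open>W\<close> constantly \<open>B'\<close>
  they describe \<open>B\<close> modulo \<open>B'\<close>, which is enough for elements that are
  afterwards commuted with some \<open>c l\<close>.\<close>

locale weight_filtration = two_generator +
  fixes W :: "nat \<Rightarrow> 'a set"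
  assumes W_subset: "W k \<subseteq> B'" and normal_W: "W k \<lhd> G"
    and W_mono: "l \<le> k \<Longrightarrow> x \<in> W k \<Longrightarrow> x \<in> W l"
    and W_comm: "x \<in> W k \<Longrightarrow> comm G x a \<in> W (Suc k)"
    and comm_c_in_W: "comm G (c i) (c j) \<in> W (i + j)"
begin

definition Fil :: "nat \<Rightarrow> 'a set" where
  "Fil k = generate G ({c l | l. k \<le> l} \<union> W k)"

lemma Fil_generators: "{c l | l. k \<le> l} \<union> W k \<subseteq> B"
  using W_subset B'_subset_B by auto

lemma Fil_generators_carrier: "{c l | l. k \<le> l} \<union> W k \<subseteq> carrier G"
  using Fil_generators[of k] B_carrier by blast

lemma subgroup_Fil: "subgroup (Fil k) G"
  unfolding Fil_def by (rule generate_is_subgroup[OF Fil_generators_carrier])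

lemma Fil_subset: "x \<in> Fil k \<Longrightarrow> x \<in> B"
  using generate_subgroup_incl[OF Fil_generators subgroup_B] by (auto simp: Fil_def)

lemma c_in_Fil: "k \<le> l \<Longrightarrow> c l \<in> Fil k"
  unfolding Fil_def by (auto intro: generate.incl)

lemma W_in_Fil: "x \<in> W k \<Longrightarrow> x \<in> Fil k"
  unfolding Fil_def by (auto intro: generate.incl)

lemma Fil_mono: "l \<le> k \<Longrightarrow> x \<in> Fil k \<Longrightarrow> x \<in> Fil l"
  unfolding Fil_def using mono_generate[of "{c i | i. k \<le> i} \<union> W k" "{c i | i. l \<le> i} \<union> W l"]
  using W_mono[of l k] by fastforce

lemma B_eq_Fil: "x \<in> B \<longleftrightarrow> x \<in> Fil 0"
proof -
  have "B \<subseteq> Fil 0" unfolding B_def Fil_def by (rule mono_generate) auto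
  then show ?thesis using Fil_subset by blast
qed

text \<open>Generators taken from \<open>W\<close> lie in \<open>B'\<close> and commute with all of
  \<open>B\<close>, so only pairs of \<open>c\<close>'s contribute, and for these the bound is
  \<open>comm_c_in_W\<close>.\<close>

lemma comm_Fil:
  assumes x: "x \<in> Fil i" and y: "y \<in> Fil j"
  shows "comm G x y \<in> W (i + j)"
proof -
  interpret W: normal "W (i + j)" G by (rule normal_W)
  have norm: "inv g \<otimes> k \<otimes> g \<in> W (i + j)" if "g \<in> generate G ({c l | l. k' \<le> l} \<union> W k')" "k \<in> W (i + j)" for g k k'
    by (rule W.inv_op_closed1[OF generate_in_carrier[OF Fil_generators_carrier that(1)] that(2)])
  have yB: "y \<in> B" by (rule Fil_subset[OF y])
  have gen: "comm G s t \<in> W (i + j)"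
    if s: "s \<in> {c l | l. i \<le> l} \<union> W i" and t: "t \<in> {c l | l. j \<le> l} \<union> W j" for s t
  proof (cases "s \<in> B' \<or> t \<in> B'")
    case True
    moreover have "s \<in> B" "t \<in> B"
      using subsetD[OF Fil_generators s] subsetD[OF Fil_generators t] .
    ultimately have "comm G s t = \<one>" by auto
    then show ?thesis by simp
  next
    case False
    then obtain l l' where "s = c l" "t = c l'" "i \<le> l" "j \<le> l'"
      using s t W_subset by blast
    then show ?thesis using W_mono[OF _ comm_c_in_W, of "i + j" l l'] by auto
  qed
  have "comm G s y \<in> W (i + j)" if s: "s \<in> {c l | l. i \<le> l} \<union> W i" for s
  proof (rule comm_generate_right[OF Fil_generators_carrier _ W.is_subgroup norm gen[OF s]])
    show "s \<in> carrier G" using s Fil_generators_carrier by blast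
  qed (use y Fil_def in auto)
  from comm_generate_left[OF Fil_generators_carrier _ W.is_subgroup norm this]
  show ?thesis using x yB by (auto simp: Fil_def)
qed

lemma normal_Fil: "Fil k \<lhd> G"
  unfolding Fil_def
proof (rule normal_generate[OF _ generators Fil_generators_carrier]; (fold Fil_def)?)
  interpret W: normal "W k" G by (rule normal_W)
  interpret F: subgroup "Fil k" G by (rule subgroup_Fil)
  fix x s assume x: "x \<in> {a, b}" and s: "s \<in> {c l | l. k \<le> l} \<union> W k"
  have xG: "x \<in> carrier G" using x by auto
  have sF: "s \<in> Fil k" using s by (auto simp: c_in_Fil W_in_Fil)
  have sG: "s \<in> carrier G" using s Fil_generators_carrier by blast
  have b: "inv g \<otimes> s \<otimes> g \<in> Fil k" if "g \<in> B" for g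
  proof -
    have "s \<otimes> comm G s g \<in> Fil k"
      using comm_Fil[OF sF, of g 0] that sF W_in_Fil by (auto simp: B_eq_Fil)
    then show ?thesis using sG that by (simp add: mult_comm)
  qed
  have "inv a \<otimes> s \<otimes> a \<in> Fil k \<and> a \<otimes> s \<otimes> inv a \<in> Fil k"
    using s
  proof
    assume "s \<in> W k"
    then show ?thesis using W.inv_op_closed1 W.inv_op_closed2 W_in_Fil by simp
  next
    assume "s \<in> {c l | l. k \<le> l}"
    then obtain l where l: "s = c l" "k \<le> l" by auto
    then show ?thesis
      using c_conj_inv[OF subgroup_Fil, of k k l] by (simp add: c_conj c_in_Fil)
  qed
  then show "inv x \<otimes> s \<otimes> x \<in> Fil k" "x \<otimes> s \<otimes> inv x \<in> Fil k"
    using x b[of b] b[of "inv b"] by auto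
qed auto

lemma comm_Fil_a: "x \<in> Fil k \<Longrightarrow> comm G x a \<in> Fil (Suc k)"
proof -
  assume x: "x \<in> Fil k"
  interpret F: normal "Fil (Suc k)" G by (rule normal_Fil)
  have norm: "inv g \<otimes> z \<otimes> g \<in> Fil (Suc k)"
    if "g \<in> generate G ({c l | l. k \<le> l} \<union> W k)" "z \<in> Fil (Suc k)" for g z
    by (rule F.inv_op_closed1[OF generate_in_carrier[OF Fil_generators_carrier that(1)] that(2)])
  have gen: "comm G s a \<in> Fil (Suc k)" if "s \<in> {c l | l. k \<le> l} \<union> W k" for s
    using that
  proof
    assume "s \<in> {c l | l. k \<le> l}"
    then show ?thesis using c_in_Fil[of "Suc k"] by (auto simp flip: c_Suc)
  next
    assume "s \<in> W k"
    then show ?thesis using W_comm W_in_Fil by blast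
  qed
  from comm_generate_left[OF Fil_generators_carrier a F.is_subgroup norm gen]
  show ?thesis using x by (simp add: Fil_def)
qed

lemma engel_Fil: "x \<in> Fil k \<Longrightarrow> engel G x m a \<in> Fil (k + m)"
  by (induction m) (auto intro: comm_Fil_a)

lemma comm_Fil_pow: "x \<in> Fil k \<Longrightarrow> comm G x (a [^] (r::int)) \<in> Fil (Suc k)"
  by (intro comm_pow_right_in_normal normal_Fil comm_Fil_a) (auto dest: Fil_subset)

lemma engel_Fil_pow: "x \<in> Fil k \<Longrightarrow> engel G x m (a [^] (r::int)) \<in> Fil (k + m)"
  by (induction m) (auto intro: comm_Fil_pow)

text \<open>For \<open>e\<close> in \<open>Fil m\<close>, the element \<open>[e,a,a]\<close> lies in
  \<open>Fil (m + 2)\<close>; modulo that subgroup \<open>[e,a^r]\<close> is therefore the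
  \<open>r\<close>-th power of \<open>[e,a]\<close>. Changing \<open>e\<close> within its coset also
  alters \<open>[e,a]\<close> only there. Each step multiplies the exponent by
  \<open>r\<close>.\<close>

lemma engel_pow_right_leading:
  assumes x: "x \<in> B"
  shows "Fil (Suc m) #> engel G x m (a [^] (r::int)) = Fil (Suc m) #> engel G x m a [^] (r ^ m)"
proof (induction m)
  case 0
  then show ?case using x by simp
next
  case (Suc m)
  define e where "e = engel G x m (a [^] r)"
  define f where "f = engel G x m a"
  define R where "R = r ^ m"
  let ?N = "Fil (Suc (Suc m))"
  have e: "e \<in> Fil m" and f: "f \<in> Fil m"
    using x engel_Fil[of x 0] engel_Fil_pow[of x 0] by (auto simp: B_eq_Fil e_def f_def)
  have [simp]: "e \<in> carrier G" "f \<in> carrier G" using Fil_subset[OF e] Fil_subset[OF f] by auto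
  interpret Fm: subgroup "Fil m" G by (rule subgroup_Fil)
  define z where "z = inv (f [^] R) \<otimes> e"
  have z: "z \<in> Fil (Suc m)"
    using Suc rcoset_eq_iff[OF normal_Fil, of "f [^] R" e "Suc m"]
    by (simp flip: e_def f_def R_def z_def)
  have [simp]: "z \<in> carrier G" using Fil_subset[OF z] by auto
  have ez: "e = f [^] R \<otimes> z" by (simp add: z_def)
  have fR: "f [^] R \<in> Fil m" using f by (simp add: subgroup_int_pow_closed[OF subgroup_Fil])
  have "?N #> engel G x (Suc m) (a [^] r) = ?N #> comm G e (a [^] r)"
    by (simp add: e_def)
  also have "\<dots> = ?N #> comm G e a [^] r"
    using e comm_Fil_a by (intro comm_pow_right_mod normal_Fil) auto
  also have "\<dots> = ?N #> (comm G f a [^] R) [^] r"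
  proof (rule rcoset_pow_cong[OF normal_Fil])
    have "?N #> comm G e a = ?N #> comm G (f [^] R) a"
      unfolding ez
    proof (rule comm_mult_left_mod[OF normal_Fil])
      show "comm G z a \<in> ?N" using z by (rule comm_Fil_a)
      show "comm G (comm G (f [^] R) a) z \<in> ?N"
        using comm_Fil[OF comm_Fil_a[OF fR] z] W_in_Fil[of _ "Suc m + Suc m"] Fil_mono[of "Suc (Suc m)" "Suc m + Suc m"] by auto
    qed auto
    also have "\<dots> = ?N #> comm G f a [^] R"
    \<comment> \<open>The power law in the first argument needs \<open>[[f,a],f]\<close> in level
      \<open>m + 2\<close>, whereas \<open>comm_Fil\<close> gives level \<open>2 m + 1\<close>. This
      is too weak precisely for \<open>m = 0\<close>, where \<open>R = 1\<close> leaves nothing to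
      prove.\<close>
    proof (cases "m = 0")
      case True
      then show ?thesis by (simp add: R_def)
    next
      case False
      then have "comm G (comm G f a) f \<in> ?N"
        using comm_Fil[OF comm_Fil_a[OF f] f] W_in_Fil[of _ "Suc m + m"] Fil_mono[of "Suc (Suc m)" "Suc m + m"] by auto
      then show ?thesis by (intro comm_pow_left_mod normal_Fil) auto
    qed
    finally show "?N #> comm G e a = ?N #> comm G f a [^] R" .
  qed auto
  also have "\<dots> = ?N #> engel G x (Suc m) a [^] (r ^ Suc m)"
    using x by (simp add: int_pow_pow f_def R_def mult.commute)
  finally show ?case .
qed

end

context two_generator
begin

sublocale DF: weight_filtration G a b n D
  by (intro weight_filtration.intro two_generator_axioms weight_filtration_axioms.intro)
     (fact D_subset normal_D D_mono D_comm comm_c_in_D)+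

sublocale BF: weight_filtration G a b n "\<lambda>_. B'"
  by (intro weight_filtration.intro two_generator_axioms weight_filtration_axioms.intro)
     (auto simp: normal_B' comm_B)

end

section \<open>Ordered products\<close>

context group
begin

lemma ordered_prod_closed:
  "(\<And>j. j < m \<Longrightarrow> f j \<in> carrier G) \<Longrightarrow> ordered_prod G (map f [0..<m]) \<in> carrier G"
proof (induction m arbitrary: f)
  case (Suc m)
  have "ordered_prod G (map (\<lambda>j. f (Suc j)) [0..<m]) \<in> carrier G"
    by (rule Suc.IH) (use Suc.prems in auto)
  then show ?case
    using Suc.prems[of 0] by (simp add: ordered_prod_def upt_conv_Cons map_Suc_upt[symmetric] comp_def del: upt_Suc)
qed (simp add: ordered_prod_def)

lemma ordered_prod_Suc_shift:
  "ordered_prod G (map f [0..<Suc m]) = f 0 \<otimes> ordered_prod G (map (\<lambda>j. f (Suc j)) [0..<m])"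
  by (simp add: ordered_prod_def upt_conv_Cons map_Suc_upt[symmetric] comp_def del: upt_Suc)

lemma ordered_prod_Suc:
  "(\<And>j. j \<le> m \<Longrightarrow> f j \<in> carrier G) \<Longrightarrow>
    ordered_prod G (map f [0..<Suc m]) = ordered_prod G (map f [0..<m]) \<otimes> f m"
proof (induction m arbitrary: f)
  case 0
  then show ?case by (simp add: ordered_prod_def)
next
  case (Suc m)
  have "ordered_prod G (map f [0..<Suc (Suc m)]) = f 0 \<otimes> ordered_prod G (map (\<lambda>j. f (Suc j)) [0..<Suc m])"
    by (rule ordered_prod_Suc_shift)
  also have "\<dots> = f 0 \<otimes> (ordered_prod G (map (\<lambda>j. f (Suc j)) [0..<m]) \<otimes> f (Suc m))"
    using Suc.IH[of "\<lambda>j. f (Suc j)"] Suc.prems by (simp del: upt_Suc)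
  also have "\<dots> = ordered_prod G (map f [0..<Suc m]) \<otimes> f (Suc m)"
    using Suc.prems ordered_prod_closed[of m "\<lambda>j. f (Suc j)"]
    by (simp add: ordered_prod_Suc_shift m_assoc del: upt_Suc)
  finally show ?case .
qed

end

context abelian_normal
begin

lemma ordered_prod_in:
  "(\<And>j. j < m \<Longrightarrow> f j \<in> H) \<Longrightarrow> ordered_prod G (map f [0..<m]) \<in> H"
proof (induction m)
  case (Suc m)
  then have "ordered_prod G (map f [0..<Suc m]) = ordered_prod G (map f [0..<m]) \<otimes> f m"
    by (intro ordered_prod_Suc) auto
  then show ?case using Suc by (simp del: upt_Suc)
qed (simp add: ordered_prod_def)

lemma comm_ordered_prod:
  assumes "\<And>j. j < m \<Longrightarrow> f j \<in> H" "z \<in> carrier G"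
  shows "comm G (ordered_prod G (map f [0..<m])) z = ordered_prod G (map (\<lambda>j. comm G (f j) z) [0..<m])"
  using assms
proof (induction m)
  case (Suc m)
  have "comm G (ordered_prod G (map f [0..<Suc m])) z = comm G (ordered_prod G (map f [0..<m]) \<otimes> f m) z"
    using Suc.prems by (subst ordered_prod_Suc) auto
  also have "\<dots> = ordered_prod G (map (\<lambda>j. comm G (f j) z) [0..<m]) \<otimes> comm G (f m) z"
    using Suc ordered_prod_in[of m f] by (simp add: comm_mult)
  also have "\<dots> = ordered_prod G (map (\<lambda>j. comm G (f j) z) [0..<Suc m])"
    using Suc.prems by (subst ordered_prod_Suc) auto
  finally show ?case .
qed (simp add: ordered_prod_def)

end

context two_generator
begin

lemma comm_in_B [simp, intro]: "x \<in> B \<Longrightarrow> y \<in> carrier G \<Longrightarrow> comm G x y \<in> B"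
  by (rule comm_in_normal(1)[OF normal_B])

lemma engel_in_B [simp, intro]: "x \<in> B \<Longrightarrow> y \<in> carrier G \<Longrightarrow> engel G x m y \<in> B"
  by (induction m) auto

lemma conj_in_B [simp, intro]: "x \<in> B \<Longrightarrow> y \<in> carrier G \<Longrightarrow> inv y \<otimes> x \<otimes> y \<in> B"
  by (rule B.inv_op_closed1)

lemma B'_in_B [simp]: "x \<in> B' \<Longrightarrow> x \<in> B"
  using B'_subset_B by blast

subsection \<open>Iterated commutators with a product\<close>

text \<open>With \<open>e = [x,_m y]\<close> and a factor \<open>\<beta>\<close> in
  \<open>B'\<close>, one has \<open>[e \<beta>, y g] = [e,y] [e^y,g] [\<beta>,y]\<close>, because
  \<open>B'\<close> is central in \<open>B\<close>. The last two factors form the recursion.\<close>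

primrec correction :: "'a \<Rightarrow> 'a \<Rightarrow> 'a \<Rightarrow> nat \<Rightarrow> 'a" where
  "correction x y g 0 = \<one>"
| "correction x y g (Suc m) =
    comm G (inv y \<otimes> engel G x m y \<otimes> y) g \<otimes> comm G (correction x y g m) y"

context
  fixes x y assumes x: "x \<in> B" and y [simp]: "y \<in> carrier G"
begin

lemma correction_in_B': "g \<in> B \<Longrightarrow> correction x y g m \<in> B'"
  by (induction m) (use x in \<open>simp_all add: comm_B\<close>)

lemma engel_mult_right:
  assumes g: "g \<in> B"
  shows "engel G x m (y \<otimes> g) = engel G x m y \<otimes> correction x y g m"
proof (induction m)
  case 0
  then show ?case using x by simp
next
  case (Suc m)
  define e where "e = engel G x m y"
  define \<beta> where "\<beta> = correction x y g m"
  have e: "e \<in> B" using x by (simp add: e_def)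
  have \<beta>: "\<beta> \<in> B'" using correction_in_B'[OF g] by (simp add: \<beta>_def)
  have yg: "y \<otimes> g \<in> carrier G" using g by simp
  have k: "comm G e g \<in> B'" "comm G (comm G e y) g \<in> B'" using e g by (simp_all add: comm_B)
  have "comm G \<beta> (y \<otimes> g) = comm G \<beta> y"
    using \<beta> g B'_central[of "comm G \<beta> y" g] by (simp add: comm_mult_right m_assoc)
  moreover have "comm G e (y \<otimes> g) = comm G e y \<otimes> (comm G e g \<otimes> comm G (comm G e y) g)"
  proof -
    have "comm G e (y \<otimes> g) = comm G e g \<otimes> (comm G e y \<otimes> comm G (comm G e y) g)"
      using e g by (simp add: comm_mult_right mult_comm)
    also have "\<dots> = comm G e y \<otimes> (comm G e g \<otimes> comm G (comm G e y) g)"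
      using e g k B'_central[OF k(1), of "comm G e y"] by (simp flip: m_assoc)
    finally show ?thesis .
  qed
  moreover have "comm G (e \<otimes> \<beta>) (y \<otimes> g) = comm G e (y \<otimes> g) \<otimes> comm G \<beta> (y \<otimes> g)"
    using e \<beta> yg by (simp add: comm_mult_left m_assoc B'_central[OF \<beta>, of "comm G e (y \<otimes> g)", symmetric])
  moreover have "comm G (inv y \<otimes> e \<otimes> y) g = comm G e g \<otimes> comm G (comm G e y) g"
    using e g comm_mult_left_B[of e "comm G e y" g] by (simp add: mult_comm)
  ultimately show ?case
    using Suc e \<beta> g k by (simp add: e_def[symmetric] \<beta>_def[symmetric] m_assoc)
qed

lemma correction_mult:
  assumes "g \<in> B" "g' \<in> B"
  shows "correction x y (g \<otimes> g') m = correction x y g m \<otimes> correction x y g' m"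
proof (induction m)
  case (Suc m)
  define q where "q = inv y \<otimes> engel G x m y \<otimes> y"
  have q: "q \<in> B" using x by (simp add: q_def)
  have "comm G q g \<in> B'" "comm G q g' \<in> B'"
    using assms q by (simp_all add: comm_B)
  moreover have "comm G (correction x y g m) y \<in> B'" "comm G (correction x y g' m) y \<in> B'"
    using correction_in_B' assms by auto
  ultimately show ?case
    using q assms correction_in_B'
    by (simp add: Suc q_def[symmetric] comm_mult_right_B[of g g' q] B'.comm_mult B'.abelian_ac)
qed simp

lemma correction_one: "correction x y \<one> m = \<one>"
  by (induction m) (use x in auto)

lemma correction_inv:
  assumes "g \<in> B"
  shows "correction x y (inv g) m = inv (correction x y g m)"
proof -
  have "correction x y (inv g) m \<otimes> correction x y g m = \<one>"
    using correction_mult[of "inv g" g m] assms by (simp add: correction_one)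
  then show ?thesis using correction_in_B' assms by (metis B'_carrier B_closed(2) inv_equality)
qed

lemma engel_inv_mod: "\<exists>z\<in>B'. engel G (inv x) m y = inv (engel G x m y) \<otimes> z"
proof (induction m)
  case 0
  then show ?case using x by (intro bexI[of _ "\<one>"]) auto
next
  case (Suc m)
  define e where "e = engel G x m y"
  have e: "e \<in> B" using x by (simp add: e_def)
  obtain z where z: "z \<in> B'" and eq: "engel G (inv x) m y = inv e \<otimes> z"
    using Suc by (auto simp: e_def)
  define q where "q = inv (comm G e y)"
  have q: "q \<in> B" using e by (simp add: q_def)
  have k: "comm G q (inv e) \<in> B'" using e q by (intro comm_B) auto
  have "comm G (inv e) y = e \<otimes> q \<otimes> inv e"
    using e by (simp add: comm_inv_left q_def)
  also have "\<dots> = q \<otimes> comm G q (inv e)"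
    using e q by (simp add: mult_comm)
  finally have eq': "comm G (inv e) y = q \<otimes> comm G q (inv e)" .
  have "comm G (inv e \<otimes> z) y = q \<otimes> (comm G q (inv e) \<otimes> comm G z y)"
    using e q z k B'_central[OF z, of "q \<otimes> comm G q (inv e)", symmetric]
    by (simp add: comm_mult_left eq' m_assoc)
  then show ?case
    using k z e by (intro bexI[of _ "comm G q (inv e) \<otimes> comm G z y"]) (auto simp: eq q_def e_def[symmetric])
qed

text \<open>Elements of \<open>B'\<close> commute with \<open>g\<close>, so
  \<open>correction\<close> depends on \<open>engel G x m y\<close> only modulo \<open>B'\<close>,
  and there inversion of \<open>x\<close> passes through by \<open>engel_inv_mod\<close>. This
  reduces statement (ii), which is about \<open>b^{-1}\<close>, to the corrections for
  \<open>b\<close>.\<close>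

lemma correction_inv_left:
  assumes "g \<in> B"
  shows "correction (inv x) y g m = inv (correction x y g m)"
proof (induction m)
  case (Suc m)
  define e where "e = engel G x m y"
  have e: "e \<in> B" using x by (simp add: e_def)
  obtain z where z: "z \<in> B'" and eq: "engel G (inv x) m y = inv e \<otimes> z"
    using engel_inv_mod by (auto simp: e_def)
  have "inv y \<otimes> (inv e \<otimes> z) \<otimes> y = inv (inv y \<otimes> e \<otimes> y) \<otimes> (inv y \<otimes> z \<otimes> y)"
    using e z by (simp add: group_normalize)
  moreover have "inv y \<otimes> z \<otimes> y \<in> B'" using z by (simp add: B'.inv_op_closed1)
  ultimately have k: "comm G (inv y \<otimes> (inv e \<otimes> z) \<otimes> y) g = inv (comm G (inv y \<otimes> e \<otimes> y) g)"
    using e assms comm_mult_left_B[of "inv (inv y \<otimes> e \<otimes> y)" "inv y \<otimes> z \<otimes> y" g]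
      comm_inv_left_B[of "inv y \<otimes> e \<otimes> y" g]
    by (simp del: inv_mult_group)
  have "comm G (inv y \<otimes> e \<otimes> y) g \<in> B'" using e assms by (simp_all add: comm_B)
  moreover have "correction x y g m \<in> B'" using correction_in_B' assms by auto
  ultimately show ?case
    using Suc k by (simp add: eq e_def[symmetric] B'.comm_inv inv_mult_group B'.abelian)
qed simp

text \<open>In factor \<open>j\<close> the element \<open>g\<close> enters after
  \<open>m - 1 - j\<close> commutations with \<open>y\<close>, and \<open>j\<close> more
  follow.\<close>

lemma correction_eq_prod:
  assumes "g \<in> B"
  shows "correction x y g m =
    ordered_prod G (map (\<lambda>j. engel G (comm G (inv y \<otimes> engel G x (m - 1 - j) y \<otimes> y) g) j y) [0..<m])"
proof (induction m)
  case 0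
  then show ?case by (simp add: ordered_prod_def)
next
  case (Suc m)
  have "comm G (inv y \<otimes> engel G x (m - 1 - j) y \<otimes> y) g \<in> B'" for j
    using x assms by (simp_all add: comm_B)
  then show ?case
    unfolding ordered_prod_Suc_shift using Suc by (simp add: B'.comm_ordered_prod)
qed

end

subsection \<open>Expansion in powers of \<open>a\<close>\<close>

text \<open>\<open>engel_pow_right_expand\<close> asks for an abelian normal subgroup. The image of
  \<open>B\<close> in \<open>G Mod B'\<close> is one, and \<open>z\<close> is the price of lifting
  the result back.\<close>

lemma engel_pow_right_mod:
  assumes x: "x \<in> B"
  shows "\<exists>y\<in>B. \<exists>z\<in>B'. engel G x j (a [^] (r::int)) = engel G x j a [^] (r ^ j)
    \<otimes> engel G x (j + 1) a [^] (int j * r ^ (j - 1) * (r * (r - 1) div 2)) \<otimes> engel G y (j + 2) a \<otimes> z"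
proof -
  interpret h: group_hom G "G Mod B'" "\<lambda>x. B' #> x" by (rule B'.group_hom_rcoset)
  interpret A: abelian_normal "(\<lambda>x. B' #> x) ` B" "G Mod B'"
  proof (intro abelian_normal.intro abelian_normal_axioms.intro)
    show "(\<lambda>x. B' #> x) ` B \<lhd> G Mod B'"
      by (rule B.surj_hom_normal_subgroup[OF h.group_hom_axioms]) (simp add: carrier_FactGroup)
    fix P Q assume "P \<in> (\<lambda>x. B' #> x) ` B" "Q \<in> (\<lambda>x. B' #> x) ` B"
    then obtain x y where xy: "x \<in> B" "y \<in> B" "P = B' #> x" "Q = B' #> y" by auto
    have "comm (G Mod B') (B' #> x) (B' #> y) = B' #> comm G x y"
      using xy by (simp add: h.hom_comm)
    also have "\<dots> = \<one>\<^bsub>G Mod B'\<^esub>"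
      using xy comm_B[of x y] by (simp add: rcoset_eq_self_iff[OF subgroup_B'])
    finally show "P \<otimes>\<^bsub>G Mod B'\<^esub> Q = Q \<otimes>\<^bsub>G Mod B'\<^esub> P"
      using xy h.H.comm_eq_one_iff[of P Q] by (simp del: one_FactGroup mult_FactGroup)
  qed
  define C where "C = r * (r - 1) div 2"
  obtain y where y: "y \<in> B" and eq: "engel (G Mod B') (B' #> x) j ((B' #> a) [^]\<^bsub>G Mod B'\<^esub> r)
    = engel (G Mod B') (B' #> x) j (B' #> a) [^]\<^bsub>G Mod B'\<^esub> (r ^ j)
      \<otimes>\<^bsub>G Mod B'\<^esub> engel (G Mod B') (B' #> x) (j + 1) (B' #> a) [^]\<^bsub>G Mod B'\<^esub> (int j * r ^ (j - 1) * C)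
      \<otimes>\<^bsub>G Mod B'\<^esub> engel (G Mod B') (B' #> y) (j + 2) (B' #> a)"
    using A.engel_pow_right_expand[of "B' #> a" "B' #> x" j r] x h.hom_closed[OF a]
    unfolding C_def[symmetric] by blast
  define p where "p = engel G x j a [^] (r ^ j)
    \<otimes> engel G x (j + 1) a [^] (int j * r ^ (j - 1) * C) \<otimes> engel G y (j + 2) a"
  have p: "p \<in> carrier G" using x y by (simp add: p_def)
  have "B' #> p = B' #> engel G x j (a [^] r)"
    using eq x y by (simp add: p_def h.hom_engel h.hom_int_pow del: engel.simps mult_FactGroup)
  then have "inv p \<otimes> engel G x j (a [^] r) \<in> B'"
    using p x by (subst (asm) rcoset_eq_iff[OF normal_B']) auto
  moreover have "engel G x j (a [^] r) = p \<otimes> (inv p \<otimes> engel G x j (a [^] r))"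
    using p x by simp
  ultimately show ?thesis using y unfolding C_def[symmetric] p_def by blast
qed

end

context two_generator
begin

lemma abelian_normal_D: "abelian_normal (D k) G"
  by (intro abelian_normal.intro normal_D abelian_normal_axioms.intro)
     (use D_subset B'.abelian in blast)

lemma engel_D_pow: "x \<in> D k \<Longrightarrow> engel G x m (a [^] (r::int)) \<in> D (k + m)"
proof (induction m)
  case (Suc m)
  then have "engel G x m (a [^] r) \<in> D (k + m)" by simp
  then have "comm G (engel G x m (a [^] r)) (a [^] r) \<in> D (Suc (k + m))"
    by (intro comm_pow_right_in_normal normal_D D_comm) (auto dest: subsetD[OF D_subset])
  then show ?case by simp
qed simp

definition T :: "nat \<Rightarrow> nat \<Rightarrow> nat \<Rightarrow> 'a" where
  "T j i l = engel G (comm G (c i) (c l)) j a"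

lemma T_in_B' [simp]: "T j i l \<in> B'"
  by (simp add: T_def comm_B)

lemma T_trivial: "j + i + l > n \<Longrightarrow> T j i l = \<one>"
  unfolding T_def by (rule D_engel[OF comm_c_in_D]) simp

text \<open>The remainder of the general expansion has degree at least \<open>i + l + j + 2\<close>,
  which the hypothesis places beyond \<open>n\<close>.\<close>

lemma engel_comm_c_pow:
  assumes "n < i + j + l + 2"
  shows "engel G (comm G (c i) (c l)) j (a [^] (r::int))
    = T j i l [^] (r ^ j) \<otimes> T (j + 1) i l [^] (int j * r ^ (j - 1) * (r * (r - 1) div 2))"
proof -
  interpret D: abelian_normal "D (i + l)" G by (rule abelian_normal_D)
  obtain y where y: "y \<in> D (i + l)" and eq: "engel G (comm G (c i) (c l)) j (a [^] r)
    = T j i l [^] (r ^ j) \<otimes> T (j + 1) i l [^] (int j * r ^ (j - 1) * (r * (r - 1) div 2)) \<otimes> engel G y (j + 2) a"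
    using D.engel_pow_right_expand[OF a comm_c_in_D] unfolding T_def by blast
  have "engel G y (j + 2) a = \<one>" using assms by (intro D_engel[OF y]) auto
  with eq show ?thesis by (simp del: engel.simps)
qed

text \<open>\<open>BF.comm_Fil\<close> yields membership in \<open>B'\<close> only. The sharper
  degree is read off the generators: the \<open>c i\<close> satisfy \<open>comm_c_in_D\<close>, and
  the generators from \<open>B'\<close> commute with \<open>c l\<close>.\<close>

lemma comm_BF_Fil:
  assumes f: "f \<in> BF.Fil k"
  shows "comm G f (c l) \<in> D (k + l)"
proof -
  interpret D: normal "D (k + l)" G by (rule normal_D)
  have norm: "inv g \<otimes> z \<otimes> g \<in> D (k + l)"
    if "g \<in> generate G ({c l | l. k \<le> l} \<union> B')" "z \<in> D (k + l)" for g z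
    by (rule D.inv_op_closed1[OF generate_in_carrier[OF BF.Fil_generators_carrier that(1)] that(2)])
  have gen: "comm G s (c l) \<in> D (k + l)" if "s \<in> {c l | l. k \<le> l} \<union> B'" for s
    using that
  proof
    assume "s \<in> {c l | l. k \<le> l}"
    then obtain i where "s = c i" "k \<le> i" by auto
    then show ?thesis using D_mono[OF _ comm_c_in_D[of i l], of "k + l"] by auto
  qed simp
  from comm_generate_left[OF BF.Fil_generators_carrier c_in_carrier D.is_subgroup norm gen]
  show ?thesis using f by (simp add: BF.Fil_def)
qed

lemma comm_engel_b_pow:
  "\<exists>z\<in>D (m + 2 + l). comm G (engel G b m (a [^] (r::int))) (c l)
    = comm G (c m) (c l) [^] (r ^ m)
      \<otimes> comm G (c (m + 1)) (c l) [^] (int m * r ^ (m - 1) * (r * (r - 1) div 2)) \<otimes> z"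
proof -
  obtain y z where y: "y \<in> B" and z: "z \<in> B'" and eq: "engel G b m (a [^] r)
    = c m [^] (r ^ m) \<otimes> c (m + 1) [^] (int m * r ^ (m - 1) * (r * (r - 1) div 2)) \<otimes> engel G y (m + 2) a \<otimes> z"
    using engel_pow_right_mod[OF b_in_B, of m r] unfolding c_def by blast
  define f where "f = engel G y (m + 2) a"
  have f: "f \<in> B" using y by (simp add: f_def)
  have fD: "comm G f (c l) \<in> D (m + 2 + l)"
    using BF.engel_Fil[of y 0 "m + 2"] y unfolding f_def BF.B_eq_Fil by (intro comm_BF_Fil) simp
  show ?thesis
    unfolding eq f_def[symmetric] using f fD z
    by (intro bexI[of _ "comm G f (c l)"]) (simp_all add: comm_mult_left_B comm_pow_left_B comm_B)
qed

text \<open>This is factor \<open>j\<close> of \<open>correction_eq_prod\<close>, with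
  \<open>m\<close> commutations before \<open>c l\<close> enters and \<open>j\<close> after. The
  leading term has degree \<open>n - 1 + l\<close>, so at most one further order survives. The
  exponents containing \<open>j\<close> and \<open>m\<close> are the second-order coefficients of
  the outer and the inner commutations; \<open>r ^ n\<close> comes from the conjugation by
  \<open>a ^ r\<close>, which adds one more inner commutation.\<close>

lemma correction_term:
  assumes n: "n \<ge> 2" and j: "j + m + 1 = n"
  defines "C r \<equiv> r * (r - 1) div 2"
  shows "engel G (comm G (inv (a [^] (r::int)) \<otimes> engel G b m (a [^] r) \<otimes> a [^] r) (c l)) j (a [^] r)
    = T j m l [^] (r ^ (n - 1)) \<otimes> T (j + 1) m l [^] (int j * (r ^ (n - 2) * C r))
      \<otimes> T j (m + 1) l [^] (int m * (r ^ (n - 2) * C r) + r ^ n)"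
proof -
  define y where "y = a [^] r"
  have y [simp]: "y \<in> carrier G" by (simp add: y_def)
  define p where "p = comm G (c m) (c l)"
  define q where "q = comm G (c (m + 1)) (c l)"
  have pq [simp]: "p \<in> B'" "q \<in> B'" by (auto simp: p_def q_def comm_B)
  obtain z where z: "z \<in> D (m + 2 + l)" and eq: "comm G (engel G b m y) (c l)
      = p [^] (r ^ m) \<otimes> q [^] (int m * r ^ (m - 1) * C r) \<otimes> z"
    using comm_engel_b_pow unfolding C_def y_def p_def q_def by blast
  define s where "s = comm G (c (m + 2)) (c l)"
  have s: "s \<in> D (m + 2 + l)" using comm_c_in_D[of "m + 2" l] by (simp add: s_def)
  obtain z' where z': "z' \<in> D (m + 3 + l)" and eq': "comm G (engel G b (m + 1) y) (c l)
      = q [^] (r ^ (m + 1)) \<otimes> s [^] (int (m + 1) * r ^ m * C r) \<otimes> z'"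
    using comm_engel_b_pow[of "m + 1" l r] unfolding C_def y_def p_def q_def s_def
    by (auto simp: algebra_simps eval_nat_numeral)
  \<comment> \<open>\<open>d\<close> collects all contributions in \<open>D (m + 2 + l)\<close>; the
    \<open>j\<close> outer commutations carry it to \<open>D (n + 1 + l)\<close>, so it
    disappears.\<close>
  define d where "d = z \<otimes> s [^] (int (m + 1) * r ^ m * C r) \<otimes> z'"
  interpret D: subgroup "D (m + 2 + l)" G by (rule subgroup_D)
  have d: "d \<in> D (m + 2 + l)"
    unfolding d_def using D_mono[OF _ z', of "m + 2 + l"]
    by (intro D.m_closed z subgroup_int_pow_closed[OF subgroup_D s]) auto
  have zB: "z \<in> B'" "s \<in> B'" "z' \<in> B'" "d \<in> B'" using z s z' d D_subset by auto
  have "comm G (inv y \<otimes> engel G b m y \<otimes> y) (c l) = comm G (engel G b m y \<otimes> engel G b (m + 1) y) (c l)"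
    by (simp add: mult_comm)
  also have "\<dots> = comm G (engel G b m y) (c l) \<otimes> comm G (engel G b (m + 1) y) (c l)"
    by (intro comm_mult_left_B) auto
  also have "\<dots> = p [^] (r ^ m) \<otimes> (q [^] (int m * r ^ (m - 1) * C r) \<otimes> q [^] (r ^ (m + 1))) \<otimes> d"
    unfolding eq eq' d_def using zB by (simp add: B'.abelian_ac)
  also have "q [^] (int m * r ^ (m - 1) * C r) \<otimes> q [^] (r ^ (m + 1)) = q [^] (int m * r ^ (m - 1) * C r + r ^ (m + 1))"
    by (simp add: int_pow_mult)
  finally have main: "engel G (comm G (inv y \<otimes> engel G b m y \<otimes> y) (c l)) j y
    = engel G p j y [^] (r ^ m) \<otimes> engel G q j y [^] (int m * r ^ (m - 1) * C r + r ^ (m + 1)) \<otimes> engel G d j y"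
    using zB by (simp add: B'.engel_mult B'.engel_pow)
  have P: "engel G p j y = T j m l [^] (r ^ j) \<otimes> T (j + 1) m l [^] (int j * r ^ (j - 1) * C r)"
    unfolding p_def y_def C_def using j by (intro engel_comm_c_pow) auto
  have Q: "engel G q j y = T j (m + 1) l [^] (r ^ j)"
  proof -
    have "T (j + 1) (m + 1) l = \<one>" using j by (intro T_trivial) auto
    moreover have "engel G q j y = T j (m + 1) l [^] (r ^ j) \<otimes> T (j + 1) (m + 1) l [^] (int j * r ^ (j - 1) * C r)"
      unfolding q_def y_def C_def using j by (intro engel_comm_c_pow) auto
    ultimately show ?thesis by simp
  qed
  have dz: "engel G d j y = \<one>"
    using engel_D_pow[OF d, of j r] j by (auto simp: y_def intro: D_trivial)
  have e1: "r ^ j * r ^ m = r ^ (n - 1)"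
    using j by (auto simp flip: power_add)
  have e2: "int j * r ^ (j - 1) * C r * r ^ m = int j * (r ^ (n - 2) * C r)"
  proof (cases j)
    case (Suc i)
    then have "r ^ i * r ^ m = r ^ (n - 2)" using j by (auto simp flip: power_add)
    then show ?thesis using Suc by simp
  qed simp
  have e3: "r ^ j * (int m * r ^ (m - 1) * C r + r ^ (m + 1)) = int m * (r ^ (n - 2) * C r) + r ^ n"
  proof -
    have "r ^ j * r ^ (m + 1) = r ^ n" using j by (auto simp flip: power_add power_Suc)
    moreover have "r ^ j * (int m * r ^ (m - 1) * C r) = int m * (r ^ (n - 2) * C r)"
    proof (cases m)
      case (Suc i)
      then have "r ^ j * r ^ i = r ^ (n - 2)" using j by (auto simp flip: power_add)
      then show ?thesis using Suc by simp
    qed simp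
    ultimately show ?thesis by (simp only: distrib_left)
  qed
  show ?thesis
    unfolding y_def[symmetric]
    by (simp only: main P Q dz B'.abelian_pow_mult int_pow_pow T_in_B' B'_closed B'_carrier
        e1 e2 e3 r_one m_closed int_pow_closed)
qed

subsection \<open>The subgroup generated by \<open>u\<close>, \<open>vw\<close> and \<open>v t\<inverse>\<close>\<close>

definition "U j = engel G (comm G (engel G b (n - 1 - j) a) b) j a"
definition "u = ordered_prod G (map U [0..<n - 1])"
definition "v = comm G (U (n - 2)) a"
definition "w = ordered_prod G (map (\<lambda>j. comm G (U j) a) [0..<n - 2])"
definition "t = engel G b n a"
definition "N = generate G {u, v \<otimes> w, v \<otimes> inv t}"

lemma U_eq_T: "U j = T j (n - 1 - j) 0"
  by (simp add: U_def T_def c_def)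

lemma U_in_B' [simp]: "U j \<in> B'"
  by (simp add: U_eq_T)

lemma uvw_in_B' [simp]: "u \<in> B'" "v \<in> B'" "w \<in> B'"
  by (auto simp: u_def v_def w_def intro: B'.ordered_prod_in)

lemma t_in_B [simp]: "t \<in> B"
  by (simp add: t_def)

lemma comm_U: "j < n \<Longrightarrow> comm G (U j) a = T (j + 1) (n - (j + 1)) 0"
  unfolding U_eq_T T_def by (simp add: diff_diff_left)

lemma ordered_prod_cong:
  "(\<And>j. j < m \<Longrightarrow> f j = g j) \<Longrightarrow> ordered_prod G (map f [0..<m]) = ordered_prod G (map g [0..<m])"
  by (intro arg_cong[of _ _ "ordered_prod G"] map_cong) auto

text \<open>These boundary values, coming from \<open>[b,_n a,b] = 1\<close> and
  \<open>[b,b] = 1\<close>, let the products over \<open>j\<close> run over a full range and make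
  the telescope in \<open>correction_c_1\<close> collapse.\<close>

lemma T_ends: "T 0 n 0 = \<one>" "T j 0 0 = \<one>"
  using comm_engel_b_trivial by (auto simp: T_def c_def) (simp add: comm_def m_assoc)

lemma vw_eq: "n \<ge> 2 \<Longrightarrow> ordered_prod G (map (\<lambda>j. T j (n - j) 0) [0..<n]) = v \<otimes> w"
proof -
  assume n: "n \<ge> 2"
  then have n': "n - 1 = Suc (n - 2)" by simp
  have "ordered_prod G (map (\<lambda>j. T j (n - j) 0) [0..<Suc (n - 1)])
    = ordered_prod G (map (\<lambda>j. T (Suc j) (n - Suc j) 0) [0..<n - 1])"
    unfolding ordered_prod_Suc_shift
    using B'.ordered_prod_in[of "n - 1" "\<lambda>j. T (Suc j) (n - Suc j) 0"] by (simp add: T_ends)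
  also have "\<dots> = ordered_prod G (map (\<lambda>j. comm G (U j) a) [0..<Suc (n - 2)])"
    unfolding n' by (rule ordered_prod_cong) (use n in \<open>auto simp: comm_U\<close>)
  also have "\<dots> = w \<otimes> v"
    by (subst ordered_prod_Suc) (auto simp: v_def w_def)
  finally show ?thesis using n by (simp add: B'.abelian)
qed

text \<open>A normal subgroup containing \<open>u\<close> must therefore contain \<open>v w\<close>,
  which explains the second generator of \<open>N\<close>.\<close>

lemma comm_u_a: "n \<ge> 2 \<Longrightarrow> comm G u a = v \<otimes> w"
proof -
  assume n: "n \<ge> 2"
  then have 1: "n - 1 = Suc (n - 2)" by simp
  have "comm G u a = ordered_prod G (map (\<lambda>j. comm G (U j) a) [0..<Suc (n - 2)])"
    unfolding u_def 1 by (intro B'.comm_ordered_prod) auto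
  also have "\<dots> = w \<otimes> v"
    by (subst ordered_prod_Suc) (auto simp: v_def w_def)
  finally show ?thesis by (simp add: B'.abelian)
qed

lemma correction_c_0:
  assumes n: "n \<ge> 2"
  shows "correction b (a [^] (r::int)) (c 0) n
    = u [^] (r ^ (n - 1)) \<otimes> (v \<otimes> w) [^] ((int n - 2) * (r ^ (n - 2) * (r * (r - 1) div 2)) + r ^ n)"
proof -
  define K where "K = r ^ (n - 2) * (r * (r - 1) div 2)"
  define A where "A j = T j (n - j) 0" for j
  define f where "f j = U j [^] (r ^ (n - 1)) \<otimes> A (j + 1) [^] (int j * K) \<otimes> A j [^] (int (n - 1 - j) * K + r ^ n)" for j
  have [simp]: "A j \<in> B'" for j by (simp add: A_def)
  have fin [simp]: "f j \<in> B'" for j by (simp add: f_def)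
  have A0: "A 0 = \<one>" "A n = \<one>" by (simp_all add: A_def T_ends)
  have "correction b (a [^] r) (c 0) n = ordered_prod G (map f [0..<n])"
  proof (subst correction_eq_prod[OF b_in_B _ c_in_B], simp, rule ordered_prod_cong)
    fix j assume j: "j < n"
    then have eqs: "n - 1 - j + 1 = n - j" "n - 1 - j = n - (j + 1)" by auto
    show "engel G (comm G (inv (a [^] r) \<otimes> engel G b (n - 1 - j) (a [^] r) \<otimes> a [^] r) (c 0)) j (a [^] r) = f j"
      using correction_term[OF n, of j "n - 1 - j" r 0] j
      unfolding f_def A_def U_eq_T K_def eqs(1) by (simp add: eqs(2))
  qed
  \<comment> \<open>\<open>A k\<close> receives \<open>(k - 1) K\<close> from factor
    \<open>k - 1\<close> and \<open>(n - 1 - k) K + r ^ n\<close> from factor \<open>k\<close>, and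
    the sum is independent of \<open>k\<close>. The last power in the invariant is the part already
    received. At \<open>k = 0\<close> its exponent \<open>- K\<close> is harmless, since
    \<open>A 0\<close> is trivial; at \<open>k = n\<close> it drops out because \<open>A n\<close>
    is.\<close>
  also have "ordered_prod G (map f [0..<k]) = ordered_prod G (map U [0..<k]) [^] (r ^ (n - 1))
     \<otimes> ordered_prod G (map A [0..<k]) [^] ((int n - 2) * K + r ^ n) \<otimes> A k [^] ((int k - 1) * K)"
    if "k \<le> n" for k
    using that
  proof (induction k)
    case 0
    then show ?case by (simp add: ordered_prod_def A0)
  next
    case (Suc k)
    define P where "P = ordered_prod G (map U [0..<k])"
    define Q where "Q = ordered_prod G (map A [0..<k])"
    have [simp]: "P \<in> B'" "Q \<in> B'" by (auto simp: P_def Q_def intro: B'.ordered_prod_in)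
    have "int (n - 1 - k) = int n - 1 - int k" using Suc.prems by auto
    then have ex: "(int k - 1) * K + (int (n - 1 - k) * K + r ^ n) = (int n - 2) * K + r ^ n"
      by (simp add: algebra_simps)
    have "ordered_prod G (map f [0..<Suc k]) = ordered_prod G (map f [0..<k]) \<otimes> f k"
      by (rule ordered_prod_Suc) simp
    also have "\<dots> = (P [^] (r ^ (n - 1)) \<otimes> Q [^] ((int n - 2) * K + r ^ n) \<otimes> A k [^] ((int k - 1) * K)) \<otimes> f k"
      using Suc by (simp add: P_def Q_def)
    also have "\<dots> = (P [^] (r ^ (n - 1)) \<otimes> U k [^] (r ^ (n - 1))) \<otimes> (Q [^] ((int n - 2) * K + r ^ n)
       \<otimes> (A k [^] ((int k - 1) * K) \<otimes> A k [^] (int (n - 1 - k) * K + r ^ n))) \<otimes> A (k + 1) [^] (int k * K)"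
      unfolding f_def by (simp add: B'.abelian_ac)
    also have "A k [^] ((int k - 1) * K) \<otimes> A k [^] (int (n - 1 - k) * K + r ^ n) = A k [^] ((int n - 2) * K + r ^ n)"
      by (simp only: ex int_pow_mult[symmetric] B'_carrier \<open>\<And>j. A j \<in> B'\<close>)
    also have "P [^] (r ^ (n - 1)) \<otimes> U k [^] (r ^ (n - 1)) = ordered_prod G (map U [0..<Suc k]) [^] (r ^ (n - 1))"
      by (subst ordered_prod_Suc) (auto simp: P_def[symmetric] B'.abelian_pow_mult)
    also have "Q [^] ((int n - 2) * K + r ^ n) \<otimes> A k [^] ((int n - 2) * K + r ^ n)
      = ordered_prod G (map A [0..<Suc k]) [^] ((int n - 2) * K + r ^ n)"
      by (subst ordered_prod_Suc) (auto simp: Q_def[symmetric] B'.abelian_pow_mult)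
    finally show ?case by simp
  qed
  note this[OF order_refl]
  also have "ordered_prod G (map A [0..<n]) = v \<otimes> w"
    using vw_eq[OF n] by (simp add: A_def[abs_def])
  also have "ordered_prod G (map U [0..<n]) = u"
  proof -
    have "ordered_prod G (map U [0..<Suc (n - 1)]) = u \<otimes> U (n - 1)"
      by (subst ordered_prod_Suc) (auto simp: u_def)
    then show ?thesis using n by (simp add: U_eq_T T_ends)
  qed
  finally show ?thesis by (simp add: A0 K_def)
qed

text \<open>For \<open>m = n - 1 - j\<close> the element \<open>T j m 1\<close> has top degree
  \<open>n\<close>, where the quadratic term of \<open>comm_comm_a\<close> is trivial. The Leibniz
  rule then gives \<open>T j m 1 = A (j + 1) \<otimes> inv (A j)\<close>, so the product telescopes
  between two trivial ends.\<close>

lemma correction_c_1: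
  assumes n: "n \<ge> 2"
  shows "correction b (a [^] (r::int)) (c 1) n = \<one>"
proof -
  define A where "A j = T j (n - j) 0" for j
  define R where "R = r ^ (n - 1)"
  have [simp]: "A j \<in> B'" for j by (simp add: A_def)
  have A0: "A 0 = \<one>" "A n = \<one>" by (simp_all add: A_def T_ends)
  have "correction b (a [^] r) (c 1) n = ordered_prod G (map (\<lambda>j. (A (j + 1) \<otimes> inv (A j)) [^] R) [0..<n])"
  proof (subst correction_eq_prod[OF b_in_B _ c_in_B], simp, rule ordered_prod_cong)
    fix j assume j: "j < n"
    define m where "m = n - 1 - j"
    have m: "j + m + 1 = n" "n - j = m + 1" "n - (j + 1) = m" using j by (auto simp: m_def)
    have "comm G (comm G (c m) (c 0)) a = comm G (c m) (c 1) \<otimes> comm G (c (m + 1)) (c 0) \<otimes> comm G (c (m + 1)) (c 1)"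
      using comm_comm_a[of "c m" "c 0"] by (simp add: c_Suc)
    then have "T (j + 1) m 0 = T j m 1 \<otimes> T j (m + 1) 0 \<otimes> T j (m + 1) 1"
      using engel_Suc_left[of "comm G (c m) (c 0)" j a]
      by (simp add: T_def B'.engel_mult comm_B del: engel.simps)
    moreover have "T j (m + 1) 1 = \<one>" using m by (intro T_trivial) auto
    ultimately have "T (j + 1) m 0 = T j m 1 \<otimes> T j (m + 1) 0" by simp
    then have "T j m 1 = A (j + 1) \<otimes> inv (A j)"
      unfolding A_def m by (simp add: m_assoc)
    moreover have "T (j + 1) m 1 = \<one>" "T j (m + 1) 1 = \<one>" using m by (auto intro: T_trivial)
    ultimately show "engel G (comm G (inv (a [^] r) \<otimes> engel G b (n - 1 - j) (a [^] r) \<otimes> a [^] r) (c 1)) j (a [^] r)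
       = (A (j + 1) \<otimes> inv (A j)) [^] R"
      using correction_term[OF n m(1), of r 1] unfolding m_def[symmetric] by (simp add: R_def del: engel.simps)
  qed
  also have "ordered_prod G (map (\<lambda>j. (A (j + 1) \<otimes> inv (A j)) [^] R) [0..<k]) = A k [^] R" for k
  proof (induction k)
    case 0
    then show ?case by (simp add: ordered_prod_def A0)
  next
    case (Suc k)
    have "ordered_prod G (map (\<lambda>j. (A (j + 1) \<otimes> inv (A j)) [^] R) [0..<Suc k]) = A k [^] R \<otimes> (A (k + 1) \<otimes> inv (A k)) [^] R"
      using Suc by (subst ordered_prod_Suc) simp_all
    also have "\<dots> = (A k \<otimes> (A (k + 1) \<otimes> inv (A k))) [^] R"
      by (simp add: B'.abelian_pow_mult)
    also have "A k \<otimes> (A (k + 1) \<otimes> inv (A k)) = A (k + 1)"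
      using B'.abelian_left[of "A k" "A (k + 1)" "inv (A k)"] by simp
    finally show ?case by simp
  qed
  finally show ?thesis by (simp add: A0)
qed

lemma correction_c_ge_2:
  assumes n: "n \<ge> 2" and l: "l \<ge> 2"
  shows "correction b (a [^] (r::int)) (c l) n = \<one>"
proof -
  have "correction b (a [^] r) (c l) n = ordered_prod G (map (\<lambda>j. \<one>) [0..<n])"
  proof (subst correction_eq_prod[OF b_in_B _ c_in_B], simp, rule ordered_prod_cong)
    fix j assume j: "j < n"
    have "T j (n - 1 - j) l = \<one>" "T (j + 1) (n - 1 - j) l = \<one>" "T j (n - 1 - j + 1) l = \<one>"
      using j l by (auto intro!: T_trivial)
    then show "engel G (comm G (inv (a [^] r) \<otimes> engel G b (n - 1 - j) (a [^] r) \<otimes> a [^] r) (c l)) j (a [^] r) = \<one>"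
      using correction_term[OF n, of j "n - 1 - j" r l] j by simp
  qed
  also have "\<dots> = \<one>" by (induction n) (simp_all add: ordered_prod_def)
  finally show ?thesis .
qed

end

lemma (in group) commute_inv:
  assumes "x \<in> carrier G" "y \<in> carrier G" "x \<otimes> y = y \<otimes> x"
  shows "inv x \<otimes> y = y \<otimes> inv x"
  using commute_generate[of "{x}" y "inv x"] assms generate.inv[of x "{x}" G] by auto

section \<open>Central elements of top degree and normality of \<open>N\<close>\<close>

context two_generator
begin

lemma comm_generators_trivial:
  assumes "x \<in> carrier G" "comm G x a = \<one>" "comm G x b = \<one>" "y \<in> carrier G"
  shows "x \<otimes> y = y \<otimes> x"
proof -
  have xa: "a \<otimes> x = x \<otimes> a" and xb: "b \<otimes> x = x \<otimes> b"
    using assms comm_eq_one_iff[of x a] comm_eq_one_iff[of x b] by auto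
  have "y \<in> generate G {a, b}" using assms(4) generators by blast
  then have "y \<otimes> x = x \<otimes> y"
    using xa xb assms(1) by - (rule commute_generate[of "{a, b}"], auto)
  then show ?thesis ..
qed

lemma D_n_central:
  assumes x: "x \<in> D n" and y: "y \<in> carrier G"
  shows "x \<otimes> y = y \<otimes> x"
proof -
  have xB: "x \<in> B'" using x D_subset by blast
  have "comm G x a = \<one>" using D_trivial[OF D_comm[OF x]] by simp
  then show ?thesis using xB y by - (rule comm_generators_trivial, auto)
qed

lemma t_central: "y \<in> carrier G \<Longrightarrow> t \<otimes> y = y \<otimes> t"
  using engel_b_a_trivial comm_engel_b_trivial
  by - (rule comm_generators_trivial, auto simp: t_def)

lemma vw_in_D:
  assumes n: "n \<ge> 2"
  shows "v \<in> D n" "w \<in> D n"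
proof -
  interpret Dn: abelian_normal "D n" G by (rule abelian_normal_D)
  have "comm G (U j) a \<in> D n" if "j < n" for j
  proof -
    have "engel G (comm G (c (n - (j + 1))) (c 0)) (j + 1) (a [^] (1::int)) \<in> D (n - (j + 1) + 0 + (j + 1))"
      by (rule engel_D_pow[OF comm_c_in_D])
    then show ?thesis using that by (simp add: comm_U T_def del: engel.simps)
  qed
  then show "v \<in> D n" "w \<in> D n"
    using n by (auto simp: v_def w_def intro!: Dn.ordered_prod_in)
qed

lemma gens_N: "{u, v \<otimes> w, v \<otimes> inv t} \<subseteq> carrier G"
  by auto

lemma in_N: "u \<in> N" "v \<otimes> w \<in> N" "v \<otimes> inv t \<in> N"
  by (auto simp: N_def intro: generate.incl)

lemma subgroup_N: "subgroup N G"
  unfolding N_def by (rule generate_is_subgroup[OF gens_N])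

lemma vt_central:
  assumes "n \<ge> 2" "y \<in> carrier G"
  shows "(v \<otimes> inv t) \<otimes> y = y \<otimes> (v \<otimes> inv t)"
proof -
  have "inv t \<otimes> y = y \<otimes> inv t"
    using t_central[OF assms(2)] assms(2) by (intro commute_inv) auto
  then show ?thesis
    using D_n_central[OF vw_in_D(1)[OF assms(1)] assms(2)] assms(2)
    by (metis B_carrier inv_closed m_assoc t_in_B uvw_in_B'(2) B'_carrier)
qed

text \<open>\<open>v\<close> and \<open>w\<close> have top degree and \<open>t\<close> commutes with
  both generators, so \<open>v w\<close> and \<open>v t^{-1}\<close> are central. Only
  \<open>u\<close> moves: \<open>b\<close> fixes it, and \<open>u^a = u (v w)\<close>.\<close>

lemma normal_N:
  assumes n: "n \<ge> 2"
  shows "N \<lhd> G"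
  unfolding N_def
proof (rule normal_generate[OF _ generators gens_N]; (fold N_def)?)
  interpret N: subgroup N G by (rule subgroup_N)
  fix x s assume x: "x \<in> {a, b}" and s: "s \<in> {u, v \<otimes> w, v \<otimes> inv t}"
  have xG: "x \<in> carrier G" using x by auto
  have sG: "s \<in> carrier G" using s by auto
  have vw: "v \<otimes> w \<otimes> x = x \<otimes> (v \<otimes> w)"
    using D_n_central[OF subgroup.m_closed[OF subgroup_D vw_in_D[OF n]] xG] .
  show "inv x \<otimes> s \<otimes> x \<in> N"
  proof -
    consider "s = u" "x = a" | "s = u" "x = b" | "s \<otimes> x = x \<otimes> s"
      using s x vw vt_central[OF n xG] by auto
    then show ?thesis
    proof cases
      case 1
      then show ?thesis using mult_comm[of u a] comm_u_a[OF n] in_N by (metis B'_carrier N.m_closed a uvw_in_B'(1))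
    next
      case 2
      then show ?thesis using B'_central[of u b] in_N by (simp add: m_assoc)
    next
      case 3
      then have "inv x \<otimes> s \<otimes> x = s" using xG sG by (simp add: m_assoc)
      then show ?thesis using s in_N by auto
    qed
  qed
  show "x \<otimes> s \<otimes> inv x \<in> N"
  proof -
    consider "s = u" "x = a" | "s = u" "x = b" | "s \<otimes> x = x \<otimes> s"
      using s x vw vt_central[OF n xG] by auto
    then show ?thesis
    proof cases
      case 1
      define z where "z = v \<otimes> w"
      have z: "z \<in> carrier G" "z \<otimes> a = a \<otimes> z" using vw 1 by (auto simp: z_def)
      have "u \<otimes> a = a \<otimes> (u \<otimes> z)"
        using mult_comm[of u a] comm_u_a[OF n] by (simp add: z_def m_assoc)
      also have "\<dots> = a \<otimes> u \<otimes> z" using z by (simp add: m_assoc)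
      finally have "u \<otimes> a \<otimes> inv z = a \<otimes> u" using z by (simp add: m_assoc)
      moreover have "a \<otimes> inv z = inv z \<otimes> a"
        using commute_inv[OF z(1) a z(2)] by simp
      ultimately have "a \<otimes> u = u \<otimes> inv z \<otimes> a" using z by (simp add: m_assoc)
      then have "a \<otimes> u \<otimes> inv a = u \<otimes> inv z" using z by (simp add: m_assoc)
      then show ?thesis using 1 in_N by (simp add: z_def)
    next
      case 2
      have "b \<otimes> u \<otimes> inv b = u" using B'_central[of u b, symmetric] by (simp add: m_assoc)
      then show ?thesis using 2 in_N by simp
    next
      case 3
      then have "x \<otimes> s \<otimes> inv x = s" using xG sG by (simp add: m_assoc flip: 3)
      then show ?thesis using s in_N by auto
    qed
  qed
qed auto

section \<open>Iterated commutators of powers of \<open>b\<close> with \<open>a\<close>\<close>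

lemma comm_mult_left_a:
  assumes x: "x \<in> B" and y: "y \<in> B"
  shows "comm G (x \<otimes> y) a = comm G x a \<otimes> comm G y a \<otimes> comm G (comm G x a) y"
proof -
  have q: "comm G (comm G x a) y \<in> B'" using x y by (simp add: comm_B)
  have "comm G x a \<otimes> comm G (comm G x a) y = inv y \<otimes> comm G x a \<otimes> y"
    using x y by (intro mult_comm) auto
  then have "comm G (x \<otimes> y) a = comm G x a \<otimes> comm G (comm G x a) y \<otimes> comm G y a"
    using comm_mult_left[of x y a] x y by simp
  also have "\<dots> = comm G x a \<otimes> comm G y a \<otimes> comm G (comm G x a) y"
    using B'_central[OF q, of "comm G y a"] x y q by (simp add: m_assoc)
  finally show ?thesis .
qed

text \<open>The first commutation produces the error \<open>[[x,a],y]\<close>, which is kept. The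
  error of a later step is \<open>[[p,a],q]\<close> with \<open>p\<close> and \<open>q\<close> of
  degree \<open>m + 1\<close>; it has degree \<open>2 m + 3\<close> and is absorbed in
  \<open>D (m + 3)\<close>. For \<open>m = n - 1\<close> the remainder is trivial.\<close>

lemma engel_mult_left_expand:
  assumes x: "x \<in> B" and y: "y \<in> B"
  shows "\<exists>z\<in>D (m + 2). engel G (x \<otimes> y) (Suc m) a
    = engel G x (Suc m) a \<otimes> engel G y (Suc m) a \<otimes> engel G (comm G (comm G x a) y) m a \<otimes> z"
proof (induction m)
  case 0
  have "comm G (x \<otimes> y) a = comm G x a \<otimes> comm G y a \<otimes> comm G (comm G x a) y"
    using x y by (rule comm_mult_left_a)
  then show ?case
    using subgroup.one_closed[OF subgroup_D, of 2] x y by (intro bexI[of _ "\<one>"]) (auto simp: numeral_2_eq_2)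
next
  case (Suc m)
  define p where "p = engel G x (Suc m) a"
  define q where "q = engel G y (Suc m) a"
  define l where "l = engel G (comm G (comm G x a) y) m a"
  have l: "l \<in> B'" using x y by (simp add: l_def comm_B)
  have pq: "p \<in> B" "q \<in> B" using x y by (auto simp: p_def q_def simp del: engel.simps)
  obtain z where z: "z \<in> D (m + 2)" and eq: "engel G (x \<otimes> y) (Suc m) a = p \<otimes> q \<otimes> l \<otimes> z"
    using Suc unfolding p_def q_def l_def by blast
  have zB: "z \<in> B'" using z D_subset by auto
  have d: "comm G (comm G p a) q \<in> D (m + 3)"
  proof -
    have "comm G p a \<in> DF.Fil (m + 2)" "q \<in> DF.Fil (m + 1)"
      using x y DF.engel_Fil[of x 0 "m + 2"] DF.engel_Fil[of y 0 "m + 1"]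
      by (simp_all add: DF.B_eq_Fil p_def q_def)
    from DF.comm_Fil[OF this] show ?thesis by (rule D_mono[rotated]) simp
  qed
  have dB: "comm G (comm G p a) q \<in> B'" using d D_subset by auto
  have "comm G (p \<otimes> q) a = comm G p a \<otimes> comm G q a \<otimes> comm G (comm G p a) q"
    using pq by (rule comm_mult_left_a)
  moreover have "comm G (p \<otimes> q \<otimes> (l \<otimes> z)) a = comm G (p \<otimes> q) a \<otimes> comm G (l \<otimes> z) a"
    using pq l zB by (subst comm_mult_left_a) auto
  ultimately have "comm G (p \<otimes> q \<otimes> l \<otimes> z) a
    = comm G p a \<otimes> comm G q a \<otimes> comm G l a \<otimes> (comm G (comm G p a) q \<otimes> comm G z a)"
    using pq l zB dB by (simp add: m_assoc B'.comm_mult B'.abelian_left)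
  moreover have "comm G (comm G p a) q \<otimes> comm G z a \<in> D (Suc m + 2)"
    using d D_comm[OF z] subgroup_D[of "m + 3"] by (simp add: subgroup.m_closed eval_nat_numeral)
  ultimately show ?case
    unfolding eq[unfolded engel.simps] using eq
    by (intro bexI[of _ "comm G (comm G p a) q \<otimes> comm G z a"]) (auto simp: p_def q_def l_def)
qed

lemma v_eq: "n \<ge> 2 \<Longrightarrow> v = engel G (comm G (c 1) b) (n - 1) a"
  by (simp add: v_def U_def c_def flip: engel.simps(2)) (simp add: Suc_diff_Suc numeral_2_eq_2)

lemma engel_b_pow_step:
  assumes n: "n \<ge> 2"
  shows "engel G (b [^] (k + 1)) n a = engel G (b [^] (k::int)) n a \<otimes> t \<otimes> v [^] k"
proof -
  define x where "x = b [^] k"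
  have x: "x \<in> B" by (simp add: x_def)
  have n': "Suc (n - 1) = n" "n - 1 + 2 > n" using n by auto
  obtain z where z: "z \<in> D (n - 1 + 2)" and eq: "engel G (x \<otimes> b) n a
    = engel G x n a \<otimes> engel G b n a \<otimes> engel G (comm G (comm G x a) b) (n - 1) a \<otimes> z"
    using engel_mult_left_expand[OF x b_in_B, of "n - 1"] unfolding n' by blast
  have "z = \<one>" using D_trivial[OF z n'(2)] .
  \<comment> \<open>Only \<open>[x,a]\<close> modulo \<open>B'\<close> matters, since the next
    operation is commutation with \<open>b\<close>; modulo \<open>B'\<close> it is
    \<open>[b,a]^k\<close>.\<close>
  have "B' #> comm G x a = B' #> comm G b a [^] k"
    unfolding x_def by (intro comm_pow_left_mod normal_B' comm_B) auto
  then have "inv (comm G b a [^] k) \<otimes> comm G x a \<in> B'"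
    using x by (subst (asm) eq_commute, subst (asm) rcoset_eq_iff[OF normal_B']) auto
  moreover define y where "y = inv (comm G b a [^] k) \<otimes> comm G x a"
  ultimately have y: "y \<in> B'" by simp
  have "comm G x a = comm G b a [^] k \<otimes> y" using x by (simp add: y_def)
  then have "comm G (comm G x a) b = comm G (c 1) b [^] k"
    using y by (simp add: comm_mult_left_B comm_pow_left_B c_def comm_B)
  then have "engel G (comm G (comm G x a) b) (n - 1) a = v [^] k"
    using n by (simp add: v_eq B'.engel_pow comm_B)
  moreover have "b [^] (k + 1) = x \<otimes> b" by (simp add: x_def int_pow_mult)
  ultimately show ?thesis
    using eq \<open>z = \<one>\<close> x by (simp add: t_def[symmetric] x_def[symmetric])
qed

text \<open>Solving \<open>engel_b_pow_step\<close> at exponent \<open>-(k+1)\<close> shows that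
  passing from \<open>b^{-k}\<close> to \<open>b^{-(k+1)}\<close> multiplies by
  \<open>v^{k+1} t^{-1}\<close>; the exponents of \<open>v\<close> add up to
  \<open>1 + ... + k\<close>.\<close>

lemma engel_b_neg_pow:
  assumes n: "n \<ge> 2"
  shows "engel G (b [^] (- int k)) n a = v [^] int (Suc k choose 2) \<otimes> inv t [^] int k"
proof (induction k)
  case 0
  then show ?case by (simp add: numeral_2_eq_2)
next
  case (Suc k)
  have vt: "v [^] i \<otimes> t = t \<otimes> v [^] i" for i :: int
    using B'_central[of "v [^] i" t] by simp
  define e where "e = engel G (b [^] (- int (Suc k))) n a"
  have e: "e \<in> carrier G" by (simp add: e_def)
  have "v [^] int (Suc k choose 2) \<otimes> inv t [^] int k = e \<otimes> t \<otimes> v [^] (- int (Suc k))"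
    using engel_b_pow_step[OF n, of "- int (Suc k)"] Suc by (simp add: e_def)
  then have "e = v [^] int (Suc k choose 2) \<otimes> inv t [^] int k \<otimes> inv (v [^] (- int (Suc k))) \<otimes> inv t"
    using e by (simp add: m_assoc)
  also have "inv (v [^] (- int (Suc k))) = v [^] int (Suc k)"
    using int_pow_neg[of v "- int (Suc k)"] by (simp only: minus_minus B'_carrier uvw_in_B')
  also have "v [^] int (Suc k choose 2) \<otimes> inv t [^] int k \<otimes> v [^] int (Suc k) \<otimes> inv t
     = (v [^] int (Suc k choose 2) \<otimes> v [^] int (Suc k)) \<otimes> (inv t [^] int k \<otimes> inv t)"
  proof -
    have "inv t [^] int k \<otimes> (v [^] int (Suc k) \<otimes> inv t) = v [^] int (Suc k) \<otimes> (inv t [^] int k \<otimes> inv t)"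
      using B'_central[of "v [^] int (Suc k)" "inv t [^] int k"]
      by (simp flip: m_assoc del: of_nat_Suc)
    then show ?thesis by (simp add: m_assoc del: of_nat_Suc)
  qed
  also have "v [^] int (Suc k choose 2) \<otimes> v [^] int (Suc k) = v [^] int (Suc (Suc k) choose 2)"
    by (simp add: numeral_2_eq_2 add_ac flip: int_pow_mult)
  also have "inv t [^] int k \<otimes> inv t = inv t [^] int (Suc k)"
    using int_pow_mult[of "inv t" "int k" 1] by (simp add: add.commute)
  finally show ?case by (simp add: e_def)
qed

text \<open>As \<open>C(k+1,2) = C(k,2) + k\<close>, the surplus \<open>v^k\<close> combines with
  \<open>t^{-k}\<close> into \<open>(v t^{-1})^k\<close>, which lies in \<open>N\<close>.\<close>

lemma rcoset_engel_b_neg_pow: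
  assumes n: "n \<ge> 2"
  shows "N #> engel G (b [^] (- int k)) n a = N #> v [^] (k choose 2)"
proof -
  have "v \<otimes> inv t = inv t \<otimes> v" by (rule B'_central) auto
  then have "(v \<otimes> inv t) [^] int k = v [^] int k \<otimes> inv t [^] int k"
    by (intro int_pow_mult_distrib) auto
  moreover have "(v \<otimes> inv t) [^] int k \<in> N"
    using in_N(3) by (rule subgroup_int_pow_closed[OF subgroup_N])
  moreover have "engel G (b [^] (- int k)) n a = v [^] int (k choose 2) \<otimes> (v [^] int k \<otimes> inv t [^] int k)"
    unfolding engel_b_neg_pow[OF n]
    by (simp add: numeral_2_eq_2 add_ac flip: m_assoc int_pow_mult)
  ultimately have "inv (v [^] int (k choose 2)) \<otimes> engel G (b [^] (- int k)) n a \<in> N"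
    by simp
  then have "N #> v [^] int (k choose 2) = N #> engel G (b [^] (- int k)) n a"
    by (subst rcoset_eq_iff[OF normal_N[OF n]]) auto
  then show ?thesis by (simp add: int_pow_int)
qed

lemma rcoset_t: "n \<ge> 2 \<Longrightarrow> N #> t = N #> v"
proof -
  assume n: "n \<ge> 2"
  have "v \<otimes> inv t = inv t \<otimes> v" by (rule B'_central) auto
  then show ?thesis using in_N(3) by (subst rcoset_eq_iff[OF normal_N[OF n]]) auto
qed

section \<open>\<open>[b^{-1},_n h]\<close> lies in \<open>N\<close>, for powers of \<open>a\<close>
  and then for arbitrary \<open>h\<close>\<close>

lemma engel_inv_b_pow:
  assumes n: "n \<ge> 2"
  shows "engel G (inv b) n (a [^] (r::int)) \<in> N"
proof -
  interpret N: subgroup N G by (rule subgroup_N)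
  \<comment> \<open>Level \<open>n + 1\<close> of the filtration is trivial, so the congruence
    \<open>engel_pow_right_leading\<close> turns into an equality.\<close>
  have "DF.Fil (Suc n) = {\<one>}"
  proof -
    have "{c l | l. Suc n \<le> l} \<union> D (Suc n) \<subseteq> {\<one>}" using c_trivial D_trivial by auto
    then have "DF.Fil (Suc n) \<subseteq> {\<one>}"
      unfolding DF.Fil_def using generate_subgroup_incl[OF _ triv_subgroup] by blast
    then show ?thesis using subgroup.one_closed[OF DF.subgroup_Fil, of "Suc n"] by auto
  qed
  moreover have "{\<one>} #> x = {x}" if "x \<in> carrier G" for x
    using that by (simp add: r_coset_def)
  ultimately have "engel G (inv b) n (a [^] r) = engel G (inv b) n a [^] (r ^ n)"
    using DF.engel_pow_right_leading[of "inv b" n r] by simp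
  also have "engel G (inv b) n a = v \<otimes> inv t"
    using engel_b_neg_pow[OF n, of 1] by (simp add: int_pow_neg numeral_2_eq_2)
  finally show ?thesis using subgroup_int_pow_closed[OF subgroup_N in_N(3)] by simp
qed

lemma correction_in_N:
  assumes n: "n \<ge> 2" and g: "g \<in> B"
  shows "correction b (a [^] (r::int)) g n \<in> N"
proof -
  interpret N: subgroup N G by (rule subgroup_N)
  have ar: "a [^] r \<in> carrier G" by simp
  have base: "correction b (a [^] r) (c l) n \<in> N" for l
  proof -
    consider "l = 0" | "l = 1" | "l \<ge> 2" by linarith
    then show ?thesis
      using correction_c_0[OF n] correction_c_1[OF n] correction_c_ge_2[OF n]
        subgroup_int_pow_closed[OF subgroup_N] in_N by cases auto
  qed
  show ?thesis
    using g unfolding B_def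
  proof (induction rule: generate.induct)
    case one
    then show ?case by (simp add: correction_one[OF b_in_B ar])
  next
    case (eng g h)
    then show ?case by (fold B_def) (simp add: correction_mult[OF b_in_B ar])
  qed (use base in \<open>auto simp: correction_inv[OF b_in_B ar]\<close>)
qed

lemma carrier_decomposition:
  assumes "h \<in> carrier G"
  obtains r :: int and g where "g \<in> B" "h = a [^] r \<otimes> g"
proof -
  have "h \<in> generate G {a, b}" using assms generators by blast
  then have "\<exists>(r::int) g. g \<in> B \<and> h = a [^] r \<otimes> g"
  proof (induction rule: generate.induct)
    case one
    show ?case by (intro exI[of _ 0] exI[of _ "\<one>"]) auto
  next
    case (incl h)
    then consider "h = a" | "h = b" by auto
    then show ?case
    proof cases
      case 1
      then show ?thesis by (intro exI[of _ 1] exI[of _ "\<one>"]) auto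
    next
      case 2
      then show ?thesis by (intro exI[of _ 0] exI[of _ b]) auto
    qed
  next
    case (inv h)
    then consider "h = a" | "h = b" by auto
    then show ?case
    proof cases
      case 1
      then show ?thesis by (intro exI[of _ "-1"] exI[of _ "\<one>"]) (auto simp: int_pow_neg)
    next
      case 2
      then show ?thesis by (intro exI[of _ 0] exI[of _ "inv b"]) auto
    qed
  next
    case (eng h1 h2)
    then obtain r s :: int and g g' where *: "g \<in> B" "g' \<in> B" "h1 = a [^] r \<otimes> g" "h2 = a [^] s \<otimes> g'"
      by blast
    have "h1 \<otimes> h2 = a [^] (r + s) \<otimes> (inv (a [^] s) \<otimes> g \<otimes> a [^] s \<otimes> g')"
      using * by (simp add: int_pow_mult m_assoc)
    moreover have "inv (a [^] s) \<otimes> g \<otimes> a [^] s \<otimes> g' \<in> B" using * by auto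
    ultimately show ?case by blast
  qed
  then show ?thesis using that by blast
qed

lemma engel_inv_b_in_N:
  assumes n: "n \<ge> 2" and h: "h \<in> carrier G"
  shows "engel G (inv b) n h \<in> N"
proof -
  interpret N: subgroup N G by (rule subgroup_N)
  obtain r :: int and g where g: "g \<in> B" and h: "h = a [^] r \<otimes> g"
    using carrier_decomposition[OF h] .
  have "engel G (inv b) n h = engel G (inv b) n (a [^] r) \<otimes> inv (correction b (a [^] r) g n)"
    unfolding h using engel_mult_right[of "inv b" "a [^] r" g n] correction_inv_left[of b "a [^] r" g n] g by simp
  then show ?thesis
    using engel_inv_b_pow[OF n] correction_in_N[OF n g] by simp
qed

end

section \<open>Polynomial sequences\<close>

type_synonym sequence = "int \<Rightarrow> rat"

definition shift :: "int \<Rightarrow> sequence \<Rightarrow> sequence" where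
  "shift r p = (\<lambda>k. p (k + r))"

text \<open>Conjugation by \<open>a\<close> is going to be \<open>shift 1\<close>, so
  \<open>fdiff\<close> is the operator \<open>a - 1\<close>, the counterpart of
  \<open>[x,a]\<close>.\<close>

definition fdiff :: "sequence \<Rightarrow> sequence" where
  "fdiff p = shift 1 p - p"

lemma shift_apply: "shift r p k = p (k + r)"
  by (simp add: shift_def)

lemma shift_0 [simp]: "shift 0 p = p"
  by (simp add: shift_def)

lemma shift_shift: "shift r (shift s p) = shift (r + s) p"
  by (simp add: shift_def add_ac)

lemma shift_simps [simp]:
  "shift r (p + q) = shift r p + shift r q" "shift r (p - q) = shift r p - shift r q"
  "shift r (- p) = - shift r p" "shift r (p * q) = shift r p * shift r q" "shift r 0 = 0"
  by (auto simp: shift_def fun_eq_iff)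

lemma fdiff_simps [simp]:
  "fdiff (p + q) = fdiff p + fdiff q" "fdiff (p - q) = fdiff p - fdiff q"
  "fdiff (- p) = - fdiff p" "fdiff 0 = 0"
  by (auto simp: fdiff_def)

lemma fdiff_shift: "fdiff (shift r p) = shift r (fdiff p)"
  by (simp add: fdiff_def shift_shift add.commute)

lemma fdiff_mult: "fdiff (p * q) = fdiff p * q + p * fdiff q + fdiff p * fdiff q"
  by (simp add: fdiff_def algebra_simps)

lemma fdiff_funpow_simps [simp]:
  "(fdiff ^^ d) (p + q) = (fdiff ^^ d) p + (fdiff ^^ d) q"
  "(fdiff ^^ d) (p - q) = (fdiff ^^ d) p - (fdiff ^^ d) q"
  "(fdiff ^^ d) (- p) = - (fdiff ^^ d) p" "(fdiff ^^ d) 0 = 0"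
  "(fdiff ^^ d) (shift r p) = shift r ((fdiff ^^ d) p)"
  by (induction d) (auto simp: fdiff_shift)

lemma fdiff_funpow_sum: "(fdiff ^^ d) (sum f S) = (\<Sum>x\<in>S. (fdiff ^^ d) (f x))"
  by (induction S rule: infinite_finite_induct) (simp_all only: sum.infinite sum.empty sum.insert fdiff_funpow_simps not_False_eq_True)

text \<open>The polynomial functions of degree strictly below \<open>d\<close>. In this form,
  closure under the operations is read off from \<open>fdiff\<close>, and \<open>polys 0\<close>
  consists of zero alone.\<close>

definition polys :: "nat \<Rightarrow> sequence set" where
  "polys d = {p. (fdiff ^^ d) p = 0}"

lemma polys_0 [simp]: "p \<in> polys 0 \<longleftrightarrow> p = 0"
  by (simp add: polys_def)

lemma polys_Suc: "p \<in> polys (Suc d) \<longleftrightarrow> fdiff p \<in> polys d"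
  by (simp add: polys_def funpow_swap1)

lemma polys_closed [simp, intro]:
  "p \<in> polys d \<Longrightarrow> q \<in> polys d \<Longrightarrow> p + q \<in> polys d"
  "p \<in> polys d \<Longrightarrow> q \<in> polys d \<Longrightarrow> p - q \<in> polys d"
  "p \<in> polys d \<Longrightarrow> - p \<in> polys d" "0 \<in> polys d"
  "p \<in> polys d \<Longrightarrow> shift r p \<in> polys d"
  by (auto simp: polys_def)

lemma polys_mono: "d \<le> e \<Longrightarrow> p \<in> polys d \<Longrightarrow> p \<in> polys e"
  unfolding polys_def using funpow_add[of "e - d" d fdiff] by (auto simp: comp_def)

lemma fdiff_polys: "p \<in> polys d \<Longrightarrow> fdiff p \<in> polys (d - 1)"
  by (cases d) (auto simp: polys_Suc)

lemma fdiff_funpow_polys: "p \<in> polys d \<Longrightarrow> (fdiff ^^ i) p \<in> polys (d - i)"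
proof (induction i)
  case (Suc i)
  then show ?case using fdiff_polys[of "(fdiff ^^ i) p" "d - i"] by simp
qed simp

lemma shift_minus_polys: "p \<in> polys d \<Longrightarrow> shift r p - p \<in> polys (d - 1)"
proof (induction r rule: int_induct[where k = 0])
  case (step1 r)
  have "shift (r + 1) p - p = shift 1 (shift r p - p) + (shift 1 p - p)"
    by (simp add: shift_shift add.commute)
  moreover have "shift 1 p - p \<in> polys (d - 1)"
    using fdiff_polys[OF step1(3)] by (simp add: fdiff_def)
  ultimately show ?case using step1 by (metis polys_closed(1,5))
next
  case (step2 r)
  have "shift (r - 1) p - p = shift (-1) ((shift r p - p) - (shift 1 p - p))"
    by (simp add: shift_shift add.commute)
  moreover have "shift 1 p - p \<in> polys (d - 1)"
    using fdiff_polys[OF step2(3)] by (simp add: fdiff_def)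
  ultimately show ?case using step2 by (metis polys_closed(2,5))
qed simp

lemma mult_polys: "p \<in> polys d \<Longrightarrow> q \<in> polys e \<Longrightarrow> p * q \<in> polys (d + e - 1)"
proof (induction "d + e" arbitrary: d e p q rule: less_induct)
  case less
  show ?case
  proof (cases "d = 0 \<or> e = 0")
    case True
    then have "p * q = 0" using less.prems by auto
    then show ?thesis by simp
  next
    case False
    then obtain d' e' where de: "d = Suc d'" "e = Suc e'" by (meson not0_implies_Suc)
    have p': "fdiff p \<in> polys d'" and q': "fdiff q \<in> polys e'"
      using less.prems by (auto simp: de polys_Suc)
    have "fdiff p * q \<in> polys (d' + e')" "p * fdiff q \<in> polys (d' + e')"
      using less.hyps[of d' e "fdiff p" q] less.hyps[of d e' p "fdiff q"] less.prems p' q' by (auto simp: de)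
    moreover have "fdiff p * fdiff q \<in> polys (d' + e')"
      using less.hyps[of d' e' "fdiff p" "fdiff q"] p' q' polys_mono[of "d' + e' - 1" "d' + e'"] by (auto simp: de)
    ultimately have "fdiff (p * q) \<in> polys (d' + e')"
      unfolding fdiff_mult by (intro polys_closed)
    then show ?thesis by (simp add: de polys_Suc)
  qed
qed

text \<open>The first two alternatives concern a vanishing factor: truncated subtraction in a degree
  bound may yield \<open>0\<close> there, while \<open>d + e - 1\<close> still exceeds
  \<open>m\<close>.\<close>

lemma mult_polys_le:
  assumes "p \<in> polys d" "q \<in> polys e" "d = 0 \<or> e = 0 \<or> d + e - 1 \<le> m"
  shows "p * q \<in> polys m"
proof (cases "d = 0 \<or> e = 0")
  case True
  then have "p * q = 0" using assms by auto
  then show ?thesis by simp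
next
  case False
  then show ?thesis using assms mult_polys polys_mono by blast
qed

lemma scale_polys: "p \<in> polys d \<Longrightarrow> (\<lambda>k. c * p k) \<in> polys d"
proof -
  have "(fdiff ^^ d) (\<lambda>k. c * p k) = (\<lambda>k. c * (fdiff ^^ d) p k)"
    by (induction d) (auto simp: fdiff_def shift_def fun_eq_iff algebra_simps)
  then show "p \<in> polys d \<Longrightarrow> (\<lambda>k. c * p k) \<in> polys d"
    by (auto simp: polys_def fun_eq_iff)
qed

lemma polys_1_const: "p \<in> polys 1 \<Longrightarrow> p k = p 0"
proof -
  assume "p \<in> polys 1"
  then have "shift 1 p = p" by (simp add: polys_def fdiff_def)
  then have step: "p (i + 1) = p i" for i by (metis shift_apply)
  show ?thesis
  proof (induction k rule: int_induct[where k = 0])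
    case (step1 i) then show ?case using step[of i] by simp
  next
    case (step2 i) then show ?case using step[of "i - 1"] by simp
  qed simp
qed

text \<open>The Newton basis: \<open>fdiff\<close> lowers the index by one. The generalised
  coefficient keeps the function polynomial at negative integers.\<close>

definition binom :: "nat \<Rightarrow> sequence" where
  "binom i = (\<lambda>k. of_int k gchoose i)"

lemma fdiff_binom: "fdiff (binom i) = (if i = 0 then 0 else binom (i - 1))"
proof (cases i)
  case (Suc m)
  then show ?thesis
    by (auto simp: fdiff_def shift_def binom_def fun_eq_iff gbinomial_Suc_Suc)
qed (auto simp: fdiff_def shift_def binom_def fun_eq_iff)

lemma fdiff_funpow_binom: "(fdiff ^^ j) (binom i) = (if j \<le> i then binom (i - j) else 0)"
  by (induction j) (auto simp: fdiff_binom)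

lemma binom_polys: "binom i \<in> polys (Suc i)"
  by (simp add: polys_def fdiff_funpow_binom del: funpow.simps)

lemma binom_0: "binom 0 = 1"
  by (simp add: binom_def fun_eq_iff)

text \<open>The product has degree \<open>i + j\<close> and leading coefficient
  \<open>1/(i! j!)\<close>, and the \<open>(i+j)\<close>-th difference multiplies it by
  \<open>(i+j)!\<close>. The induction is Pascal's rule carried through \<open>fdiff_mult\<close>,
  whose quadratic term has too small a degree to contribute.\<close>

lemma fdiff_funpow_binom_mult:
  "(fdiff ^^ (i + j)) (binom i * binom j) = (\<lambda>_. of_nat ((i + j) choose i))"
proof (induction "i + j" arbitrary: i j)
  case 0
  then show ?case by (simp add: binom_0 fun_eq_iff)
next
  case (Suc m)
  show ?case
  proof (cases "i = 0 \<or> j = 0")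
    case True
    then show ?thesis by (auto simp: binom_0 fdiff_funpow_binom fun_eq_iff simp del: funpow.simps)
  next
    case False
    then obtain i' j' where ij: "i = Suc i'" "j = Suc j'" by (meson not0_implies_Suc)
    have m: "m = i' + j" "m = i + j'" "m = Suc (i' + j')" using Suc ij by auto
    have "binom i' * binom j' \<in> polys m"
      using mult_polys[OF binom_polys binom_polys, of i' j'] m by simp
    then have z: "(fdiff ^^ m) (binom i' * binom j') = 0" by (simp add: polys_def)
    have "(fdiff ^^ (i + j)) (binom i * binom j) = (fdiff ^^ m) (fdiff (binom i * binom j))"
      using Suc(2) by (simp add: funpow_swap1 flip: Suc(2))
    also have "\<dots> = (fdiff ^^ m) (binom i' * binom j) + (fdiff ^^ m) (binom i * binom j')"
      by (simp add: fdiff_mult fdiff_binom ij z)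
    also have "\<dots> = (\<lambda>_. of_nat (m choose i')) + (\<lambda>_. of_nat (m choose i))"
      using Suc(1)[OF m(1)] Suc(1)[OF m(2)] by (simp only: flip: m(1,2))
    also have "\<dots> = (\<lambda>_. of_nat ((i + j) choose i))"
      using Suc(2) by (auto simp: fun_eq_iff ij)
    finally show ?thesis .
  qed
qed

section \<open>A model with \<open>t\<close> of infinite order\<close>

text \<open>The exponent of \<open>a\<close>, then the coordinates modelling \<open>B/B'\<close> and
  \<open>B'\<close>.\<close>

type_synonym model_elt = "int \<times> sequence \<times> sequence"

locale model =
  fixes n :: nat and A :: rat
  assumes n: "n \<ge> 5"
begin

text \<open>The first two coefficients are, up to a common factor, the only ones for which \<open>vw\<close> becomes
  trivial; \<open>A\<close> remains free and is used below to make \<open>u\<close> trivial.\<close>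

definition form :: "sequence \<Rightarrow> sequence \<Rightarrow> sequence" where
  "form p q = (\<lambda>k.
      of_nat (n * (n - 4)) * (fdiff p * (fdiff ^^ (n - 1)) q - (fdiff ^^ (n - 1)) p * fdiff q) k
    - of_nat (3 * (n - 2)) * ((fdiff ^^ 2) p * (fdiff ^^ (n - 2)) q - (fdiff ^^ (n - 2)) p * (fdiff ^^ 2) q) k
    + A * (fdiff p * (fdiff ^^ n) q - (fdiff ^^ n) p * fdiff q) k)"

lemma form_simps [simp]:
  "form (p + p') q = form p q + form p' q" "form p (q + q') = form p q + form p q'"
  "form (p - p') q = form p q - form p' q" "form p (q - q') = form p q - form p q'"
  "form (- p) q = - form p q" "form p (- q) = - form p q"
  "form 0 q = 0" "form p 0 = 0" "form p p = 0"
  by (auto simp: form_def fun_eq_iff algebra_simps)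

lemma form_swap: "form q p = - form p q"
  by (auto simp: form_def fun_eq_iff algebra_simps)

lemma form_shift [simp]: "form (shift r p) (shift r q) = shift r (form p q)"
  by (simp add: form_def fdiff_shift fun_eq_iff) (simp add: shift_def)

lemma form_polys:
  assumes p: "p \<in> polys d" and q: "q \<in> polys e" and m: "d + e \<le> m + n + 1"
  shows "form p q \<in> polys m"
proof -
  have 1: "(fdiff ^^ i) p * (fdiff ^^ j) q \<in> polys m" if "n \<le> i + j" for i j
    by (rule mult_polys_le[OF fdiff_funpow_polys[OF p] fdiff_funpow_polys[OF q]]) (use that m in arith)
  have "fdiff p * (fdiff ^^ (n - 1)) q \<in> polys m" "(fdiff ^^ (n - 1)) p * fdiff q \<in> polys m"
    "(fdiff ^^ 2) p * (fdiff ^^ (n - 2)) q \<in> polys m" "(fdiff ^^ (n - 2)) p * (fdiff ^^ 2) q \<in> polys m"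
    "fdiff p * (fdiff ^^ n) q \<in> polys m" "(fdiff ^^ n) p * fdiff q \<in> polys m"
    using n 1[of 1 "n - 1"] 1[of "n - 1" 1] 1[of 2 "n - 2"] 1[of "n - 2" 2] 1[of 1 n] 1[of n 1] by auto
  then have "(\<lambda>k. of_nat (n * (n - 4)) * (fdiff p * (fdiff ^^ (n - 1)) q - (fdiff ^^ (n - 1)) p * fdiff q) k) \<in> polys m"
    "(\<lambda>k. of_nat (3 * (n - 2)) * ((fdiff ^^ 2) p * (fdiff ^^ (n - 2)) q - (fdiff ^^ (n - 2)) p * (fdiff ^^ 2) q) k) \<in> polys m"
    "(\<lambda>k. A * (fdiff p * (fdiff ^^ n) q - (fdiff ^^ n) p * fdiff q) k) \<in> polys m"
    by - (rule scale_polys, rule polys_closed(2), assumption, assumption)+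
  from polys_closed(1)[OF polys_closed(2)[OF this(1,2)] this(3)]
  show ?thesis by (simp add: form_def plus_fun_def fun_diff_def)
qed

text \<open>Every summand of \<open>form\<close> applies at least \<open>n - 2\<close> differences
  to one of its arguments. In weight \<open>4\<close> the middle coordinate lies in
  \<open>polys (n - 2)\<close>, so this makes \<open>\<gamma>_4\<close> of the model
  abelian.\<close>

lemma form_low_polys: "p \<in> polys (n - 2) \<Longrightarrow> q \<in> polys (n - 2) \<Longrightarrow> form p q = 0"
proof -
  have "(fdiff ^^ (n - 1)) r = 0 \<and> (fdiff ^^ (n - 2)) r = 0 \<and> (fdiff ^^ n) r = 0" if "r \<in> polys (n - 2)" for r
    using polys_mono[OF _ that, of "n - 1"] polys_mono[OF _ that, of n] that by (simp add: polys_def)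
  then show "p \<in> polys (n - 2) \<Longrightarrow> q \<in> polys (n - 2) \<Longrightarrow> form p q = 0"
    by (simp add: form_def fun_eq_iff)
qed

text \<open>The integers, acting by \<open>shift\<close>, extended by the class-two group with
  cocycle \<open>form\<close>. Associativity is bilinearity and shift invariance of
  \<open>form\<close>. Since \<open>form\<close> is alternating, inverses carry no correction, and
  commutators of elements with first coordinate \<open>0\<close> are
  \<open>2 form p q\<close>.\<close>

definition Q :: "model_elt monoid" where
  "Q = \<lparr>carrier = UNIV,
    monoid.mult = (\<lambda>(r, p, s) (r', p', s'). (r + r', shift r' p + p', shift r' s + s' + form (shift r' p) p')),
    one = (0, 0, 0)\<rparr>"

lemma carrier_Q [simp]: "x \<in> carrier Q"
  by (simp add: Q_def)

lemma mult_Q [simp]: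
  "(r, p, s) \<otimes>\<^bsub>Q\<^esub> (r', p', s') = (r + r', shift r' p + p', shift r' s + s' + form (shift r' p) p')"
  by (simp add: Q_def)

lemma one_Q [simp]: "\<one>\<^bsub>Q\<^esub> = (0, 0, 0)"
  by (simp add: Q_def)

lemma left_inverse_Q: "(- r, - shift (- r) p, - shift (- r) s) \<otimes>\<^bsub>Q\<^esub> (r, p, s) = \<one>\<^bsub>Q\<^esub>"
  by (simp add: shift_shift)

sublocale Q: group Q
proof (rule groupI)
  fix x y z :: model_elt
  show "x \<otimes>\<^bsub>Q\<^esub> y \<otimes>\<^bsub>Q\<^esub> z = x \<otimes>\<^bsub>Q\<^esub> (y \<otimes>\<^bsub>Q\<^esub> z)"
    by (cases x; cases y; cases z) (simp add: shift_shift algebra_simps flip: form_shift)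
  show "\<one>\<^bsub>Q\<^esub> \<otimes>\<^bsub>Q\<^esub> x = x"
    by (cases x) simp
  show "\<exists>y\<in>carrier Q. y \<otimes>\<^bsub>Q\<^esub> x = \<one>\<^bsub>Q\<^esub>"
    using left_inverse_Q by (cases x) (metis carrier_Q)
qed auto

lemma inv_Q: "inv\<^bsub>Q\<^esub> (r, p, s) = (- r, - shift (- r) p, - shift (- r) s)"
  by (intro Q.inv_equality left_inverse_Q) auto

lemma comm_Q:
  fixes r r' p p' s s'
  defines "p1 \<equiv> shift r' p + p'" and "p2 \<equiv> shift r p' + p"
  shows "comm Q (r, p, s) (r', p', s') = (0, p1 - p2,
    shift r' s - s - (shift r s' - s') + form (shift r' p) p' - form (shift r p') p - form p2 (p1 - p2))"
proof -
  have "comm Q (r, p, s) (r', p', s') = inv\<^bsub>Q\<^esub> ((r', p', s') \<otimes>\<^bsub>Q\<^esub> (r, p, s)) \<otimes>\<^bsub>Q\<^esub> ((r, p, s) \<otimes>\<^bsub>Q\<^esub> (r', p', s'))"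
    by (simp add: comm_def Q.inv_mult_group Q.m_assoc del: mult_Q)
  also have "\<dots> = (0, p1 - p2,
    shift r' s - s - (shift r s' - s') + form (shift r' p) p' - form (shift r p') p - form p2 (p1 - p2))"
    unfolding mult_Q inv_Q p1_def p2_def by (simp add: shift_shift algebra_simps)
  finally show ?thesis .
qed

subsection \<open>The defining relations\<close>

text \<open>An upper bound for the image of \<open>\<gamma>_k\<close>: each commutation lowers both
  degrees by one. The bound for \<open>s\<close> is larger by one, because \<open>s\<close> may
  first arise in weight \<open>2\<close>, where \<open>form\<close> of two sequences of degree
  \<open>n\<close> can have degree \<open>n\<close>. At \<open>k = n + 3\<close> both bounds are
  zero, which is the class \<open>n + 2\<close>.\<close>

definition weight :: "nat \<Rightarrow> model_elt set" where
  "weight k = {(r, p, s). (k \<ge> 2 \<longrightarrow> r = 0) \<and> p \<in> polys (n + 2 - k) \<and> s \<in> polys (n + 3 - k)}"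

lemma subgroup_weight:
  assumes k: "k \<ge> 1"
  shows "subgroup (weight k) Q"
proof (rule Q.subgroupI)
  have "(0, 0, 0) \<in> weight k" by (simp add: weight_def)
  then show "weight k \<noteq> {}" by auto
  fix x assume x: "x \<in> weight k"
  then show "inv\<^bsub>Q\<^esub> x \<in> weight k" by (cases x) (auto simp: weight_def inv_Q)
  fix y assume y: "y \<in> weight k"
  obtain r p s r' p' s' where xy: "x = (r, p, s)" "y = (r', p', s')" by (metis prod.exhaust)
  have "form (shift r' p) p' \<in> polys (n + 3 - k)"
    using x y k n by (intro form_polys[of _ "n + 2 - k" _ "n + 2 - k"]) (auto simp: weight_def xy)
  then show "x \<otimes>\<^bsub>Q\<^esub> y \<in> weight k" using x y by (auto simp: weight_def xy)
qed auto

lemma comm_weight: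
  assumes k: "k \<ge> 1" and x: "x \<in> weight k" and y: "y \<in> weight 1"
  shows "comm Q x y \<in> weight (Suc k)"
proof -
  obtain r p s r' p' s' where xy: "x = (r, p, s)" "y = (r', p', s')" by (metis prod.exhaust)
  define p1 where "p1 = shift r' p + p'"
  define p2 where "p2 = shift r p' + p"
  have p: "p \<in> polys (n + 2 - k)" and s: "s \<in> polys (n + 3 - k)" and r: "k \<ge> 2 \<Longrightarrow> r = 0"
    using x by (auto simp: weight_def xy)
  have p': "p' \<in> polys (n + 1)" and s': "s' \<in> polys (n + 2)"
    using y by (auto simp: weight_def xy eval_nat_numeral)
  have pn: "p \<in> polys (n + 1)" by (rule polys_mono[OF _ p]) (use k in auto)
  have e: "n + 2 - Suc k = n + 2 - k - 1" "n + 3 - Suc k = n + 3 - k - 1" "n + 3 - Suc k = n + 2 - k" by auto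
  have "shift r p' - p' \<in> polys (n + 2 - Suc k)"
  \<comment> \<open>Only for \<open>k = 1\<close> can \<open>r\<close> be nonzero, and then
    \<open>p'\<close> obeys the same degree bound as \<open>p\<close>, so losing one degree is
    enough.\<close>
  proof (cases "k = 1")
    case True
    then show ?thesis using shift_minus_polys[OF p', of r] by simp
  next
    case False
    then show ?thesis using r k by simp
  qed
  then have d: "p1 - p2 \<in> polys (n + 2 - Suc k)"
    using polys_closed(2)[OF shift_minus_polys[OF p, of r'], of "shift r p' - p'"]
    by (simp add: p1_def p2_def e(1) algebra_simps)
  have "shift r s' - s' \<in> polys (n + 3 - Suc k)"
  proof (cases "k = 1")
    case True
    then show ?thesis using shift_minus_polys[OF s', of r] by (simp add: eval_nat_numeral)
  next
    case False
    then show ?thesis using r k by simp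
  qed
  moreover have "shift r' s - s \<in> polys (n + 3 - Suc k)"
    unfolding e(2) by (rule shift_minus_polys[OF s])
  moreover have "form (shift r' p) p' \<in> polys (n + 3 - Suc k)"
    by (rule form_polys[of _ "n + 2 - k" _ "n + 1"]) (use p p' in auto)
  moreover have "form (shift r p') p \<in> polys (n + 3 - Suc k)"
    by (rule form_polys[of _ "n + 1" _ "n + 2 - k"]) (use p p' in auto)
  moreover have "form p2 (p1 - p2) \<in> polys (n + 3 - Suc k)"
    by (rule form_polys[OF _ d, of _ "n + 1"]) (use pn p' in \<open>auto simp: p2_def\<close>)
  ultimately show ?thesis
    unfolding xy comm_Q p1_def[symmetric] p2_def[symmetric] weight_def
    using d by (auto simp del: form_simps)
qed

lemma weight_top: "k \<ge> n + 3 \<Longrightarrow> x \<in> weight k \<Longrightarrow> x = \<one>\<^bsub>Q\<^esub>"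
  by (cases x) (auto simp: weight_def)

lemma weight_4_commute:
  assumes "x \<in> weight 4" "y \<in> weight 4"
  shows "comm Q x y = \<one>\<^bsub>Q\<^esub>"
proof -
  have "n + 2 - 4 = n - 2" by simp
  then show ?thesis
    using assms form_low_polys by (cases x; cases y) (auto simp: weight_def comm_Q)
qed

text \<open>Not an honest grading by coordinates: in degree \<open>1\<close> the last coordinate has
  to be allowed, because \<open>[(0,p,s),a]\<close> already picks up
  \<open>- form p (fdiff p)\<close>. What counts is that degree \<open>2\<close> kills
  \<open>p\<close> and degree \<open>3\<close> kills everything.\<close>

definition b_degree :: "nat \<Rightarrow> model_elt \<Rightarrow> bool" where
  "b_degree k x = (case x of (r, p, s) \<Rightarrow>
    (k \<noteq> 0 \<longrightarrow> r = 0) \<and> (k \<noteq> 1 \<longrightarrow> p = 0) \<and> (k \<noteq> 1 \<and> k \<noteq> 2 \<longrightarrow> s = 0))"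

lemma b_degree_comm: "b_degree k x \<Longrightarrow> b_degree l y \<Longrightarrow> b_degree (k + l) (comm Q x y)"
  by (cases x; cases y) (auto simp: b_degree_def comm_Q)

definition qa :: model_elt where "qa = (1, 0, 0)"
text \<open>\<open>binom n\<close> makes the middle coordinate of \<open>[b,_m a]\<close> equal to
  \<open>binom (n - m)\<close>, a chain of length exactly \<open>n + 1\<close> that ends in the
  constant \<open>1\<close>, the middle coordinate of \<open>t\<close>.\<close>

definition qb :: model_elt where "qb = (0, binom n, 0)"

lemma b_degree_commutator_in: "commutator_in Q qa qb k x \<Longrightarrow> b_degree k x"
proof (induction rule: commutator_in.induct)
  case (bracket k x l y)
  then show ?case using b_degree_comm by blast
qed (auto simp: b_degree_def qa_def qb_def)

lemma b_degree_3: "k \<ge> 3 \<Longrightarrow> b_degree k x \<Longrightarrow> x = \<one>\<^bsub>Q\<^esub>"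
  by (cases x) (auto simp: b_degree_def)

lemma ab_weight: "qa \<in> weight 1" "qb \<in> weight 1"
  using binom_polys[of n] by (auto simp: qa_def qb_def weight_def)

lemma comm_qa: "comm Q (0, p, s) qa = (0, fdiff p, fdiff s - form p (fdiff p))"
  by (simp add: qa_def comm_Q fdiff_def)

text \<open>The last coordinate is left implicit except for its degree, which forces it to vanish at
  \<open>m = n + 1\<close>.\<close>

lemma engel_qb: "\<exists>s\<in>polys (n + 1 - m). engel Q qb m qa = (0, (fdiff ^^ m) (binom n), s)"
proof (induction m)
  case 0
  then show ?case by (auto simp: qb_def)
next
  case (Suc m)
  define p where "p = (fdiff ^^ m) (binom n)"
  obtain s where s: "s \<in> polys (n + 1 - m)" and eq: "engel Q qb m qa = (0, p, s)"
    using Suc by (auto simp: p_def)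
  have p: "p \<in> polys (n + 1 - m)"
    using fdiff_funpow_polys[OF binom_polys, of m n] by (simp add: p_def)
  have "form p (fdiff p) \<in> polys (n - m)"
    by (rule form_polys[OF p fdiff_polys[OF p]]) auto
  then have "fdiff s - form p (fdiff p) \<in> polys (n + 1 - Suc m)"
    using fdiff_polys[OF s] by simp
  then show ?case by (auto simp: eq comm_qa p_def)
qed

lemma engel_qb_trivial: "engel Q qb (n + 1) qa = \<one>\<^bsub>Q\<^esub>"
  using engel_qb[of "n + 1"] by (auto simp: fdiff_funpow_binom zero_fun_def simp del: funpow.simps engel.simps)

lemma comm_qb: "comm Q (0, p, s) qb = (0, 0, form p (binom n) + form p (binom n))"
  by (simp add: qb_def comm_Q form_swap[of p "binom n"])

text \<open>All orders of differences in \<open>form\<close> are positive, so constants lie in its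
  radical. This realises the relation \<open>[b,_n a,b] = 1\<close>.\<close>

lemma form_const: "form 1 p = 0" "form p 1 = 0"
proof -
  have z: "(fdiff ^^ i) 1 = 0" if "i > 0" for i
    using that fdiff_funpow_binom[of i 0] by (simp add: binom_0)
  then have "fdiff 1 = 0" using z[of 1] by simp
  then show "form 1 p = 0" using z n by (simp add: form_def fun_eq_iff)
  then show "form p 1 = 0" using form_swap[of p 1] by simp
qed

lemma comm_engel_qb_trivial: "comm Q (engel Q qb n qa) qb = \<one>\<^bsub>Q\<^esub>"
  using engel_qb[of n] by (auto simp: fdiff_funpow_binom comm_qb binom_0 form_const)

end

declare zero_fun_apply [simp del] plus_fun_apply [simp del] times_fun_apply [simp del] one_fun_apply [simp del]

lemmas sequence_apply = zero_fun_apply plus_fun_apply times_fun_apply one_fun_apply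

definition scale :: "rat \<Rightarrow> sequence \<Rightarrow> sequence" where
  "scale c p = (\<lambda>k. c * p k)"

lemma fdiff_funpow_scale: "(fdiff ^^ d) (scale c p) = scale c ((fdiff ^^ d) p)"
  by (induction d) (auto simp: scale_def fdiff_def shift_def fun_eq_iff sequence_apply algebra_simps)

lemma sum_sequence_apply: "(sum f S :: sequence) k = (\<Sum>x\<in>S. f x k)"
  by (induction S rule: infinite_finite_induct) (auto simp: sequence_apply)

lemma of_nat_Suc_choose_two: "(of_nat (Suc j choose 2) :: rat) = of_nat j * (of_nat j + 1) / 2"
  by (induction j) (auto simp: numeral_2_eq_2 field_simps)

lemma sum_of_nat_Suc: "(\<Sum>j<N. of_nat (Suc j) :: rat) = of_nat N * (of_nat N + 1) / 2"
  by (induction N) (auto simp: field_simps)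

lemma sum_of_nat_Suc_choose_two:
  "(\<Sum>j<N. of_nat (Suc j choose 2) :: rat) = (of_nat N + 1) * of_nat N * (of_nat N - 1) / 6"
  by (induction N) (auto simp: of_nat_Suc_choose_two field_simps)

context model
begin

lemma form_eq_scale: "form p q =
    scale (of_nat (n * (n - 4))) (fdiff p * (fdiff ^^ (n - 1)) q - (fdiff ^^ (n - 1)) p * fdiff q)
  - scale (of_nat (3 * (n - 2))) ((fdiff ^^ 2) p * (fdiff ^^ (n - 2)) q - (fdiff ^^ (n - 2)) p * (fdiff ^^ 2) q)
  + scale A (fdiff p * (fdiff ^^ n) q - (fdiff ^^ n) p * fdiff q)"
  by (simp add: form_def scale_def fun_eq_iff sequence_apply)

text \<open>The constant \<open>m\<close>-th difference of \<open>form (binom m) (binom n)\<close>.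
  The conditional terms stem from the swapped summands, in which \<open>binom m\<close> is
  differenced \<open>n - 1\<close> or \<open>n - 2\<close> times and vanishes for smaller
  \<open>m\<close>.\<close>

definition \<alpha> :: "nat \<Rightarrow> rat" where
  "\<alpha> m = of_nat (n * (n - 4)) * (of_nat m - (if m = n - 1 then 1 else 0))
    - of_nat (3 * (n - 2)) * (of_nat (m choose 2) - (if m = n - 1 then of_nat (n - 1) else 0) - (if m = n - 2 then 1 else 0))"

lemma fdiff_funpow_form_binom:
  assumes m: "1 \<le> m" "m \<le> n - 1"
  shows "(fdiff ^^ m) (form (binom m) (binom n)) = (\<lambda>_. \<alpha> m)"
proof -
  have fd: "fdiff (binom i) = binom (i - 1)" if "i \<ge> 1" for i
    using that by (simp add: fdiff_binom)
  have t1: "(fdiff ^^ m) (fdiff (binom m) * (fdiff ^^ (n - 1)) (binom n)) = (\<lambda>_. of_nat m)"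
    using fdiff_funpow_binom_mult[of "m - 1" 1] m n binomial_symmetric[of 1 m]
    by (simp add: fd fdiff_funpow_binom del: funpow.simps)
  have t2: "(fdiff ^^ m) ((fdiff ^^ (n - 1)) (binom m) * fdiff (binom n)) = (\<lambda>_. if m = n - 1 then 1 else 0)"
  proof (cases "m = n - 1")
    case True
    then show ?thesis
      using fdiff_funpow_binom_mult[of 0 "n - 1"] n by (simp add: fd fdiff_funpow_binom del: funpow.simps)
  next
    case False
    then have "(fdiff ^^ (n - 1)) (binom m) = 0"
      using m by (simp add: fdiff_funpow_binom del: funpow.simps)
    then show ?thesis using False by (simp flip: zero_fun_def)
  qed
  have t3: "(fdiff ^^ m) ((fdiff ^^ 2) (binom m) * (fdiff ^^ (n - 2)) (binom n)) = (\<lambda>_. of_nat (m choose 2))"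
  proof (cases "m = 1")
    case True
    then show ?thesis using n by (simp add: fdiff_funpow_binom binomial_eq_0 del: funpow.simps flip: zero_fun_def)
  next
    case False
    then have m2: "2 \<le> m" "m - 2 + 2 = m" using m by auto
    then have "m choose (m - 2) = m choose 2" by (metis binomial_symmetric diff_diff_cancel diff_le_self)
    then show ?thesis
      using fdiff_funpow_binom_mult[of "m - 2" 2] m2 n by (simp add: fdiff_funpow_binom del: funpow.simps)
  qed
  have t4: "(fdiff ^^ m) ((fdiff ^^ (n - 2)) (binom m) * (fdiff ^^ 2) (binom n))
    = (\<lambda>_. (if m = n - 1 then of_nat (n - 1) else 0) + (if m = n - 2 then 1 else 0))"
  proof -
    consider "m = n - 1" | "m = n - 2" | "m < n - 2" using m by linarith
    then show ?thesis
    proof cases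
      case 1
      then have "m - (n - 2) = 1" "1 + (n - 2) = m" using n by auto
      then show ?thesis
        using 1 fdiff_funpow_binom_mult[of 1 "n - 2"] n by (simp add: fdiff_funpow_binom del: funpow.simps)
    next
      case 2
      then show ?thesis
        using fdiff_funpow_binom_mult[of 0 "n - 2"] n by (simp add: fdiff_funpow_binom del: funpow.simps)
    next
      case 3
      then show ?thesis using n by (simp add: fdiff_funpow_binom binomial_eq_0 del: funpow.simps flip: zero_fun_def)
    qed
  qed
  \<comment> \<open>The summands with coefficient \<open>A\<close> have total order
    \<open>n + 1\<close>: here the degree is only \<open>m - 1\<close>, so they do not influence
    \<open>\<alpha>\<close>.\<close>
  have t5: "(fdiff ^^ m) (fdiff (binom m) * (fdiff ^^ n) (binom n)) = 0"
    using m by (simp add: fd fdiff_funpow_binom binom_0 del: funpow.simps)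
  have t6: "(fdiff ^^ n) (binom m) = 0"
    using m n by (simp add: fdiff_funpow_binom del: funpow.simps)
  show ?thesis
    unfolding form_eq_scale fdiff_funpow_simps fdiff_funpow_scale t1 t2 t3 t4 t5 t6
    by (simp add: \<alpha>_def scale_def fun_eq_iff sequence_apply)
qed

text \<open>Without its coefficient, the pair of orders \<open>(1, n-1)\<close> contributes
  \<open>(n-2)(n+1)/2\<close> and the pair \<open>(2, n-2)\<close> contributes
  \<open>n(n-4)(n+1)/6\<close>; the coefficients \<open>n(n-4)\<close> and \<open>3(n-2)\<close>
  balance them. Twice this sum is the last coordinate of the image of \<open>v w\<close>.\<close>

lemma sum_\<alpha>: "(\<Sum>j<n - 1. \<alpha> (Suc j)) = 0"
proof -
  obtain m where m: "n = m + 5" by (rule that[of "n - 5"]) (use n in simp)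
  have "(\<Sum>j<n - 1. \<alpha> (Suc j)) = of_nat (n * (n - 4)) * ((\<Sum>j<n - 1. of_nat (Suc j)) - 1)
    - of_nat (3 * (n - 2)) * ((\<Sum>j<n - 1. of_nat (Suc j choose 2)) - of_nat (n - 1) - 1)"
  proof -
    have 1: "(\<Sum>j<n - 1. if Suc j = n - 1 then c else (0::rat)) = c" for c
    proof -
        have "(\<Sum>j<n - 1. if Suc j = n - 1 then c else 0) = (\<Sum>j<n - 1. if j = n - 2 then c else 0)"
          using m by (intro sum.cong) auto
        then show ?thesis using m by simp
      qed
    have 2: "(\<Sum>j<n - 1. if Suc j = n - 2 then c else (0::rat)) = c" for c
    proof -
        have "(\<Sum>j<n - 1. if Suc j = n - 2 then c else 0) = (\<Sum>j<n - 1. if j = n - 3 then c else 0)"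
          using m by (intro sum.cong) auto
        then show ?thesis using m by simp
      qed
    show ?thesis
      unfolding \<alpha>_def sum_subtractf sum_distrib_left[symmetric] 1 2 by simp
  qed
  also have "\<dots> = 0"
    unfolding sum_of_nat_Suc sum_of_nat_Suc_choose_two by (simp add: m field_simps)
  finally show ?thesis .
qed

text \<open>The value is \<open>-(n-2)(n-3)(n-4)/2\<close>, nonzero because
  \<open>n \<ge> 5\<close>. It is what keeps \<open>v\<close> alive in the model.\<close>

lemma \<alpha>_top: "\<alpha> (n - 1) \<noteq> 0"
proof -
  obtain m where m: "n = m + 5" by (rule that[of "n - 5"]) (use n in simp)
  have c: "(of_nat (m + 4 choose 2) :: rat) = (of_nat m + 3) * (of_nat m + 4) / 2"
    using of_nat_Suc_choose_two[of "m + 3"] by (simp add: field_simps)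
  have "\<alpha> (n - 1) = of_nat ((m + 5) * (m + 1) * (m + 3)) - of_nat (3 * (m + 3)) * (of_nat (m + 4 choose 2) - of_nat (m + 4))"
    unfolding \<alpha>_def by (simp add: m algebra_simps)
  also have "\<dots> = - (of_nat ((m + 1) * (m + 2) * (m + 3)) / 2)"
    unfolding c by (simp add: field_simps)
  finally have "\<alpha> (n - 1) = - (of_nat ((m + 1) * (m + 2) * (m + 3)) / 2)" .
  then show ?thesis by (simp del: of_nat_mult)
qed

subsection \<open>The images of \<open>u\<close>, \<open>v\<close> and \<open>w\<close>\<close>

text \<open>The last coordinate of \<open>[[b,_{n-i} a],b]\<close> for
  \<open>i \<le> n\<close>.\<close>

definition gap :: "nat \<Rightarrow> sequence" where
  "gap i = form (binom i) (binom n) + form (binom i) (binom n)"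

definition qU :: "nat \<Rightarrow> model_elt" where
  "qU j = engel Q (comm Q (engel Q qb (n - 1 - j) qa) qb) j qa"

lemma engel_central: "engel Q (0, 0, s) j qa = (0, 0, (fdiff ^^ j) s)"
  by (induction j) (auto simp: comm_qa)

lemma qU_eq: "j < n \<Longrightarrow> qU j = (0, 0, (fdiff ^^ j) (gap (Suc j)))"
proof -
  assume j: "j < n"
  then have "n - (n - 1 - j) = Suc j" by auto
  then show ?thesis
    using engel_qb[of "n - 1 - j"] j
    by (auto simp: qU_def fdiff_funpow_binom comm_qb engel_central gap_def)
qed

lemma ordered_prod_central:
  "ordered_prod Q (map (\<lambda>j. (0, 0, g j)) [0..<m]) = (0, 0, \<Sum>j<m. g j)"
proof (induction m)
  case (Suc m)
  have "ordered_prod Q (map (\<lambda>j. (0, 0, g j)) [0..<Suc m])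
    = ordered_prod Q (map (\<lambda>j. (0, 0, g j)) [0..<m]) \<otimes>\<^bsub>Q\<^esub> (0, 0, g m)"
    by (rule Q.ordered_prod_Suc) simp
  then show ?case using Suc by simp
qed (simp add: ordered_prod_def)

definition useq :: sequence where
  "useq = (\<Sum>j<n - 1. (fdiff ^^ j) (gap (Suc j)))"

lemma qu_eq: "ordered_prod Q (map qU [0..<n - 1]) = (0, 0, useq)"
proof -
  have "map qU [0..<n - 1] = map (\<lambda>j. (0, 0, (fdiff ^^ j) (gap (Suc j)))) [0..<n - 1]"
    by (auto simp: qU_eq)
  then show ?thesis by (simp only: ordered_prod_central useq_def)
qed

lemma fdiff_gap: "j < n - 1 \<Longrightarrow> (fdiff ^^ Suc j) (gap (Suc j)) = (\<lambda>_. 2 * \<alpha> (Suc j))"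
  unfolding gap_def fdiff_funpow_simps(1)
  by (subst (1 2) fdiff_funpow_form_binom) (auto simp: fun_eq_iff sequence_apply)

lemma qv_eq: "comm Q (qU (n - 2)) qa = (0, 0, \<lambda>_. 2 * \<alpha> (n - 1))"
proof -
  have 1: "n - 2 < n - 1" and 2: "Suc (n - 2) = n - 1" using n by auto
  have "fdiff ((fdiff ^^ (n - 2)) (gap (Suc (n - 2)))) = (\<lambda>_. 2 * \<alpha> (n - 1))"
    using fdiff_gap[OF 1, unfolded funpow.simps comp_apply] by (simp only: 2)
  then show ?thesis using n by (simp add: qU_eq comm_qa)
qed

lemma qw_eq: "ordered_prod Q (map (\<lambda>j. comm Q (qU j) qa) [0..<n - 2]) = (0, 0, \<lambda>_. \<Sum>j<n - 2. 2 * \<alpha> (Suc j))"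
proof -
  have "map (\<lambda>j. comm Q (qU j) qa) [0..<n - 2] = map (\<lambda>j. (0, 0, \<lambda>_. 2 * \<alpha> (Suc j))) [0..<n - 2]"
    using fdiff_gap by (auto simp: qU_eq comm_qa)
  then show ?thesis by (simp only: ordered_prod_central) (simp add: sum_sequence_apply fun_eq_iff sequence_apply)
qed

lemma qvw_eq:
  "comm Q (qU (n - 2)) qa \<otimes>\<^bsub>Q\<^esub> ordered_prod Q (map (\<lambda>j. comm Q (qU j) qa) [0..<n - 2]) = \<one>\<^bsub>Q\<^esub>"
proof -
  have "n - 1 = Suc (n - 2)" using n by auto
  then have "(\<Sum>j<n - 2. 2 * \<alpha> (Suc j)) + 2 * \<alpha> (n - 1) = 2 * (\<Sum>j<n - 1. \<alpha> (Suc j))"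
    by (simp add: sum_distrib_left)
  then show ?thesis
    unfolding qv_eq qw_eq using sum_\<alpha> by (simp add: fun_eq_iff sequence_apply shift_def add.commute)
qed

text \<open>The difference of \<open>useq\<close> is the last coordinate of
  \<open>[u,a] = v w\<close>, which is already zero. A single constant thus remains to be removed
  from \<open>u\<close>.\<close>

lemma useq_const: "useq k = useq 0"
proof -
  have "fdiff useq = (fdiff ^^ 1) useq" by simp
  also have "\<dots> = (\<Sum>j<n - 1. (fdiff ^^ Suc j) (gap (Suc j)))"
    unfolding useq_def fdiff_funpow_sum by simp
  also have "\<dots> = (\<Sum>j<n - 1. (\<lambda>_. 2 * \<alpha> (Suc j)))"
    using fdiff_gap by (intro sum.cong) auto
  also have "\<dots> = 0"
    using sum_\<alpha> by (auto simp: fun_eq_iff sequence_apply sum_sequence_apply simp flip: sum_distrib_left)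
  finally have "useq \<in> polys 1" by (simp add: polys_def)
  then show ?thesis by (rule polys_1_const)
qed

end

text \<open>The last summand of \<open>form\<close> contributes only to \<open>u\<close>, by the constant \<open>2 A (n - 1)\<close>.\<close>

lemma exists_useq_zero:
  assumes n: "n \<ge> 5"
  shows "\<exists>A. model.useq n A = 0"
proof -
  interpret m0: model n 0 by unfold_locales (rule n)
  define A where "A = - m0.useq 0 / (2 * of_nat (n - 1))"
  interpret m: model n A by unfold_locales (rule n)
  have gap: "m.gap (Suc j) = m0.gap (Suc j) + scale (2 * A) (binom j)" if "j < n - 1" for j
  proof -
    have "(fdiff ^^ n) (binom (Suc j)) = 0" "(fdiff ^^ n) (binom n) = 1"
      using that by (auto simp: fdiff_funpow_binom binom_0 simp del: funpow.simps)
    then show ?thesis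
      by (simp add: m.gap_def m0.gap_def m.form_def m0.form_def scale_def fun_eq_iff sequence_apply fdiff_binom)
  qed
  have "m.useq = m0.useq + (\<Sum>j<n - 1. (fdiff ^^ j) (scale (2 * A) (binom j)))"
    unfolding m.useq_def m0.useq_def sum.distrib[symmetric] by (intro sum.cong) (auto simp: gap)
  moreover have "(fdiff ^^ j) (scale (2 * A) (binom j)) = (\<lambda>_. 2 * A)" for j
    by (simp add: fdiff_funpow_scale fdiff_funpow_binom binom_0) (simp add: scale_def fun_eq_iff sequence_apply)
  ultimately have "m.useq k = m0.useq k + of_nat (n - 1) * (2 * A)" for k
    by (simp add: sum_sequence_apply sequence_apply)
  moreover have "of_nat (n - 1) * (2 * A) = - m0.useq 0"
  proof -
    have "(of_nat (n - 1) :: rat) \<noteq> 0" using n by simp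
    then show ?thesis unfolding A_def by (simp del: of_nat_diff)
  qed
  ultimately have "m.useq k = 0" for k
    using m0.useq_const[of k] by simp
  then show ?thesis by (intro exI[of _ A]) (simp add: fun_eq_iff sequence_apply)
qed

section \<open>Infinite order of \<open>t\<close> modulo the image of \<open>N\<close>\<close>

locale reduced_model = model +
  assumes useq_zero: "useq = 0"
begin

definition qt :: model_elt where "qt = engel Q qb n qa"
definition qv :: model_elt where "qv = comm Q (qU (n - 2)) qa"

text \<open>With \<open>u\<close> and \<open>v w\<close> trivial, the subgroup consists of the
  powers of \<open>v t^{-1} = (0, -1, c - s)\<close>. If the \<open>g\<close>-th power equals
  \<open>t^k = (0, k, k s)\<close>, the middle coordinates give \<open>g = -k\<close>, and the last
  ones leave \<open>k c = 0\<close>, where \<open>c\<close> is the nonzero value of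
  \<open>v\<close>.\<close>

lemma qt_powers:
  assumes x: "x \<in> generate Q {ordered_prod Q (map qU [0..<n - 1]),
      qv \<otimes>\<^bsub>Q\<^esub> ordered_prod Q (map (\<lambda>j. comm Q (qU j) qa) [0..<n - 2]), qv \<otimes>\<^bsub>Q\<^esub> inv\<^bsub>Q\<^esub> qt}"
    and eq: "x = qt [^]\<^bsub>Q\<^esub> (k::nat)"
  shows "k = 0"
proof -
  obtain s where s: "qt = (0, 1, s)"
    using engel_qb[of n] by (auto simp: qt_def fdiff_funpow_binom binom_0)
  define c where "c = 2 * \<alpha> (n - 1)"
  have const: "form (\<lambda>_. x) p = 0" "form p (\<lambda>_. x) = 0" for x p
  proof -
    have sc: "form (scale x 1) p = scale x (form 1 p)" for x p
      by (simp add: form_eq_scale fdiff_funpow_scale fdiff_funpow_scale[of 1, simplified])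
         (simp add: scale_def fun_eq_iff sequence_apply algebra_simps)
    show 1: "form (\<lambda>_. x) p = 0" for x p
    proof -
      have "(\<lambda>_. x) = scale x 1" "scale x 0 = 0"
        by (auto simp: scale_def fun_eq_iff sequence_apply)
      then show ?thesis by (simp only: sc form_const)
    qed
    show "form p (\<lambda>_. x) = 0" using form_swap[of "\<lambda>_. x" p] by (simp add: 1)
  qed
  have t_pow: "qt [^]\<^bsub>Q\<^esub> (k::nat) = (0, \<lambda>_. of_nat k, \<lambda>i. of_nat k * s i)" for k
  proof (induction k)
    case (Suc k)
    then show ?case by (simp add: s const fun_eq_iff sequence_apply algebra_simps)
  qed (simp add: zero_fun_def)
  have vt: "qv \<otimes>\<^bsub>Q\<^esub> inv\<^bsub>Q\<^esub> qt = (0, \<lambda>_. -1, \<lambda>i. c - s i)"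
    unfolding qv_def qv_eq s inv_Q by (simp add: c_def fun_eq_iff sequence_apply)
  have "\<exists>g::int. x = (0, \<lambda>_. - of_int g, \<lambda>i. of_int g * (c - s i))"
    using x unfolding qu_eq useq_zero qvw_eq[folded qv_def] vt
  proof (induction rule: generate.induct)
    case one
    then show ?case by (intro exI[of _ 0]) (simp add: zero_fun_def)
  next
    case (incl h)
    then show ?case
      using exI[of "\<lambda>g::int. h = (0, \<lambda>_. - of_int g, \<lambda>i. of_int g * (c - s i))" 0]
        exI[of "\<lambda>g::int. h = (0, \<lambda>_. - of_int g, \<lambda>i. of_int g * (c - s i))" 1]
      by (auto simp: zero_fun_def)
  next
    case (inv h)
    then show ?case
      using exI[of "\<lambda>g::int. inv\<^bsub>Q\<^esub> h = (0, \<lambda>_. - of_int g, \<lambda>i. of_int g * (c - s i))" 0]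
        exI[of "\<lambda>g::int. inv\<^bsub>Q\<^esub> h = (0, \<lambda>_. - of_int g, \<lambda>i. of_int g * (c - s i))" "-1"]
      by (auto simp: zero_fun_def inv_Q fun_eq_iff sequence_apply)
  next
    case (eng h1 h2)
    then obtain g1 g2 :: int where g: "h1 = (0, \<lambda>_. - of_int g1, \<lambda>i. of_int g1 * (c - s i))"
      "h2 = (0, \<lambda>_. - of_int g2, \<lambda>i. of_int g2 * (c - s i))"
      by blast
    show ?case
      unfolding g by (intro exI[of _ "g1 + g2"]) (simp add: const fun_eq_iff sequence_apply algebra_simps)
  qed
  then obtain g :: int where "x = (0, \<lambda>_. - of_int g, \<lambda>i. of_int g * (c - s i))" by blast
  then have g: "(of_int g :: rat) = - of_nat k" and "of_int g * (c - s 0) = of_nat k * s 0"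
    using eq unfolding t_pow by (auto simp: fun_eq_iff sequence_apply)
  then have "of_nat k * c = 0" unfolding g by (simp add: algebra_simps)
  then show ?thesis using \<alpha>_top by (simp add: c_def)
qed

end

section \<open>Lower central series, normal closures and homomorphisms on quotients\<close>

context group
begin

lemma comm_subgroup_normal:
  assumes S: "S \<lhd> G" and T: "T \<lhd> G"
  shows "comm_subgroup G S T \<lhd> G"
proof -
  interpret S: normal S G by fact
  interpret T: normal T G by fact
  show ?thesis
    unfolding comm_subgroup_def
  proof (rule normal_generateI)
    show "{comm G x y |x y. x \<in> S \<and> y \<in> T} \<subseteq> carrier G" by auto
    fix h g assume "h \<in> {comm G x y |x y. x \<in> S \<and> y \<in> T}" and g: "g \<in> carrier G"
    then obtain x y where xy: "x \<in> S" "y \<in> T" "h = comm G x y" by auto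
    have "g \<otimes> h \<otimes> inv g = comm G (g \<otimes> x \<otimes> inv g) (g \<otimes> y \<otimes> inv g)"
      using xy g by (simp add: comm_def group_normalize)
    then show "g \<otimes> h \<otimes> inv g \<in> {comm G x y |x y. x \<in> S \<and> y \<in> T}"
      using xy g S.inv_op_closed2 T.inv_op_closed2 by blast
  qed
qed

lemma lcs_normal: "lcs G k \<lhd> G"
proof -
  have "lcs G (Suc k) \<lhd> G" for k
    by (induction k) (auto simp: normal_self intro: comm_subgroup_normal)
  then show ?thesis by (cases k) (auto simp: normal_self)
qed

lemma lcs_carrier: "x \<in> lcs G k \<Longrightarrow> x \<in> carrier G"
  by (rule subgroup.mem_carrier[OF normal_imp_subgroup[OF lcs_normal]])

lemma comm_lcs: "x \<in> lcs G (Suc k) \<Longrightarrow> y \<in> carrier G \<Longrightarrow> comm G x y \<in> lcs G (Suc (Suc k))"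
  by (auto simp: comm_subgroup_def intro: generate.incl)

lemma engel_lcs: "x \<in> lcs G (Suc k) \<Longrightarrow> y \<in> carrier G \<Longrightarrow> engel G x m y \<in> lcs G (Suc k + m)"
  using comm_lcs by (induction m) auto

lemma lcs_Suc_subset: "lcs G (Suc (Suc k)) \<subseteq> lcs G (Suc k)"
proof -
  interpret N: normal "lcs G (Suc k)" G by (rule lcs_normal)
  have "{comm G x y |x y. x \<in> lcs G (Suc k) \<and> y \<in> carrier G} \<subseteq> lcs G (Suc k)"
    using comm_in_normal(1)[OF N.normal_axioms] by auto
  then show ?thesis
    using generate_subgroup_incl[OF _ N.is_subgroup] by (simp add: comm_subgroup_def)
qed

lemma lcs_mono: "k \<le> l \<Longrightarrow> x \<in> lcs G (Suc l) \<Longrightarrow> x \<in> lcs G (Suc k)"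
proof (induction l rule: nat_induct_at_least)
  case (Suc l)
  then show ?case using lcs_Suc_subset[of l] by blast
qed auto

lemma normal_set_mult:
  assumes N: "N \<lhd> G" and K: "K \<lhd> G"
  shows "N <#> K \<lhd> G" "N \<subseteq> N <#> K" "K \<subseteq> N <#> K"
proof -
  interpret N: normal N G by fact
  interpret K: normal K G by fact
  have sub: "subgroup (N <#> K) G"
  proof (rule subgroupI)
    show "N <#> K \<subseteq> carrier G" by (auto simp: set_mult_def)
    show "N <#> K \<noteq> {}" unfolding set_mult_def using N.one_closed K.one_closed by blast
    fix g assume "g \<in> N <#> K"
    then obtain x y where xy: "x \<in> N" "y \<in> K" "g = x \<otimes> y" by (auto simp: set_mult_def)
    have "inv g = (inv y \<otimes> inv x \<otimes> y) \<otimes> inv y"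
      using xy by (simp add: group_normalize)
    then show "inv g \<in> N <#> K"
      using xy N.inv_op_closed1[of y "inv x"] unfolding set_mult_def by auto
    fix h assume "h \<in> N <#> K"
    then obtain x' y' where xy': "x' \<in> N" "y' \<in> K" "h = x' \<otimes> y'" by (auto simp: set_mult_def)
    have gh: "g \<otimes> h = (x \<otimes> (y \<otimes> x' \<otimes> inv y)) \<otimes> (y \<otimes> y')"
      using xy xy' by (simp add: group_normalize)
    have "x \<otimes> (y \<otimes> x' \<otimes> inv y) \<in> N" "y \<otimes> y' \<in> K"
      using xy xy' N.inv_op_closed2[of y x'] by auto
    then show "g \<otimes> h \<in> N <#> K"
      unfolding gh set_mult_def by blast
  qed
  show "N <#> K \<lhd> G"
  proof (rule normal_invI[OF sub])
    fix g h assume g: "g \<in> carrier G" and "h \<in> N <#> K"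
    then obtain x y where xy: "x \<in> N" "y \<in> K" "h = x \<otimes> y" by (auto simp: set_mult_def)
    have "g \<otimes> h \<otimes> inv g = (g \<otimes> x \<otimes> inv g) \<otimes> (g \<otimes> y \<otimes> inv g)"
      using xy g by (simp add: group_normalize)
    moreover have "g \<otimes> x \<otimes> inv g \<in> N" "g \<otimes> y \<otimes> inv g \<in> K"
      using N.inv_op_closed2[OF g xy(1)] K.inv_op_closed2[OF g xy(2)] .
    ultimately show "g \<otimes> h \<otimes> inv g \<in> N <#> K"
      unfolding set_mult_def by auto
  qed
  show "N \<subseteq> N <#> K" "K \<subseteq> N <#> K"
  proof -
    have "x \<otimes> \<one> \<in> N <#> K" if "x \<in> N" for x
      using that K.one_closed unfolding set_mult_def by blast
    then have "x \<in> N <#> K" if "x \<in> N" for x using that N.mem_carrier[of x] by fastforce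
    then show "N \<subseteq> N <#> K" by blast
    have "\<one> \<otimes> x \<in> N <#> K" if "x \<in> K" for x
      using that N.one_closed unfolding set_mult_def by blast
    then have "x \<in> N <#> K" if "x \<in> K" for x using that K.mem_carrier[of x] by fastforce
    then show "K \<subseteq> N <#> K" by blast
  qed
qed

lemma normal_closure_normal:
  assumes "S \<subseteq> carrier G"
  shows "normal_closure G S \<lhd> G" "S \<subseteq> normal_closure G S"
proof -
  have ne: "{N. N \<lhd> G \<and> S \<subseteq> N} \<noteq> {}" using assms normal_self by auto
  have "subgroup (normal_closure G S) G"
    unfolding normal_closure_def using ne by (intro subgroups_Inter) (auto simp: normal_imp_subgroup)
  moreover have "g \<otimes> h \<otimes> inv g \<in> normal_closure G S" if "g \<in> carrier G" "h \<in> normal_closure G S" for g h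
    using that by (auto simp: normal_closure_def intro: normal.inv_op_closed2)
  ultimately show "normal_closure G S \<lhd> G" by (rule normal_invI)
  show "S \<subseteq> normal_closure G S" by (auto simp: normal_closure_def)
qed

lemma normal_closure_minimal: "N \<lhd> G \<Longrightarrow> S \<subseteq> N \<Longrightarrow> normal_closure G S \<subseteq> N"
  by (auto simp: normal_closure_def)

lemma engel_commutator_in: "commutator_in G a b 1 (engel G b i a)"
proof (induction i)
  case (Suc i)
  from commutator_in.bracket[OF this commutator_in.entry_a] show ?case by simp
qed (simp add: commutator_in.entry_b[simplified])

lemma commutator_in_carrier: "commutator_in G a b k x \<Longrightarrow> a \<in> carrier G \<Longrightarrow> b \<in> carrier G \<Longrightarrow> x \<in> carrier G"
  by (induction rule: commutator_in.induct) auto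

lemma FactGroup_lift:
  assumes H: "group H" and h: "h \<in> hom G H" and N: "N \<lhd> G" and triv: "\<And>x. x \<in> N \<Longrightarrow> h x = \<one>\<^bsub>H\<^esub>"
  obtains g where "g \<in> hom (G Mod N) H" "\<And>x. x \<in> carrier G \<Longrightarrow> g (N #> x) = h x"
proof (rule FactGroup_universal[OF h N])
  interpret h: group_hom G H h using H h by (simp add: group_hom_def group_hom_axioms_def group_axioms)
  fix x y assume xy: "x \<in> carrier G" "y \<in> carrier G" "N #> x = N #> y"
  then have "inv x \<otimes> y \<in> N" using rcoset_eq_iff[OF N] by blast
  then have "inv\<^bsub>H\<^esub> h x \<otimes>\<^bsub>H\<^esub> h y = \<one>\<^bsub>H\<^esub>" using triv[of "inv x \<otimes> y"] xy by simp
  then show "h x = h y" using xy by (metis h.H.inv_comm h.H.inv_equality h.H.inv_inv h.H.inv_closed h.hom_closed)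
qed (use that in auto)

end

lemma (in group_hom) hom_commutator_in:
  "commutator_in G a b k x \<Longrightarrow> a \<in> carrier G \<Longrightarrow> b \<in> carrier G \<Longrightarrow> commutator_in H (h a) (h b) k (h x)"
proof (induction rule: commutator_in.induct)
  case (bracket k x l y)
  then show ?case
    using G.commutator_in_carrier hom_comm commutator_in.bracket[of H "h a" "h b" k "h x" l "h y"] by simp
qed (auto intro: commutator_in.intros commutator_in.entry_b[simplified])

lemma (in group_hom) hom_ordered_prod:
  "set xs \<subseteq> carrier G \<Longrightarrow> h (ordered_prod G xs) = ordered_prod H (map h xs)"
proof (induction xs)
  case (Cons x xs)
  have "ordered_prod G xs \<in> carrier G"
    using Cons.prems by (induction xs) (auto simp: ordered_prod_def)
  then show ?case using Cons by (simp add: ordered_prod_def)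
qed (simp add: ordered_prod_def)

section \<open>The groups \<open>F\<close> and \<open>H\<close>\<close>

definition letter_value :: "('a, 'c) monoid_scheme \<Rightarrow> ('g \<Rightarrow> 'a) \<Rightarrow> bool \<times> 'g \<Rightarrow> 'a" where
  "letter_value G f x = (if fst x then f (snd x) else inv\<^bsub>G\<^esub> f (snd x))"

definition word_value :: "('a, 'c) monoid_scheme \<Rightarrow> ('g \<Rightarrow> 'a) \<Rightarrow> 'g word \<Rightarrow> 'a" where
  "word_value G f w = foldr (\<lambda>x y. letter_value G f x \<otimes>\<^bsub>G\<^esub> y) w \<one>\<^bsub>G\<^esub>"

context group
begin

text \<open>Universal property of the free group: a cancellation performed by \<open>push\<close> is
  matched by the values of a letter and its formal inverse.\<close>

lemma word_value_hom:
  assumes f: "\<And>g. f g \<in> carrier G"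
  shows "word_value G f \<in> hom free_group G"
proof -
  have l [simp]: "letter_value G f x \<in> carrier G" for x
    using f by (auto simp: letter_value_def)
  have w [simp]: "word_value G f w \<in> carrier G" for w
    by (induction w) (auto simp: word_value_def)
  have Cons: "word_value G f (x # w) = letter_value G f x \<otimes> word_value G f w" for x w
    by (simp add: word_value_def)
  have inv: "letter_value G f (letter_inv x) = inv (letter_value G f x)" for x
    using f by (auto simp: letter_value_def letter_inv_def)
  have push: "word_value G f (push x w) = letter_value G f x \<otimes> word_value G f w" for x w
    by (cases w) (auto simp: Cons inv)
  have "word_value G f (foldr push u w) = word_value G f u \<otimes> word_value G f w" for u w
  proof (induction u)
    case Nil
    then show ?case by (simp add: word_value_def[of G f "[]"])
  next
    case (Cons x u)
    then show ?case by (simp add: push \<open>\<And>x w. word_value G f (x # w) = _\<close> m_assoc)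
  qed
  then show ?thesis by (auto simp: hom_def free_group_def)
qed

end

lemma free_group_generated:
  "carrier (free_group :: 'g word monoid) = generate free_group (range (\<lambda>g. [(True, g)]))"
proof
  interpret group "free_group :: 'g word monoid" by (rule group_free_group)
  let ?S = "range (\<lambda>g. [(True, g)]) :: 'g word set"
  have S: "?S \<subseteq> carrier free_group" by (auto simp: free_group_def reduced_def)
  show "generate free_group ?S \<subseteq> carrier free_group"
    by (rule generate_incl[OF S])
  have letter: "[x] \<in> generate free_group ?S" for x :: "bool \<times> 'g"
  proof (cases "fst x")
    case True
    then show ?thesis by (cases x) (auto intro: generate.incl)
  next
    case False
    then have x: "x = (False, snd x)" by (metis prod.collapse)
    have "inv\<^bsub>free_group\<^esub> [(True, snd x)] = [x]"
      by (rule inv_equality) (subst x, simp_all add: free_group_def reduced_def letter_inv_def)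
    then show ?thesis using generate.inv[of "[(True, snd x)]" ?S free_group] by simp
  qed
  have "w \<in> generate free_group ?S" if "reduced w" for w
    using that
  proof (induction w)
    case Nil
    show ?case using generate.one[of free_group ?S] by (simp add: free_group_def)
  next
    case (Cons x w)
    have "reduced w" using Cons.prems by (cases w) (auto simp: reduced_def)
    then have w: "w \<in> generate free_group ?S" by (rule Cons.IH)
    have "[x] \<otimes>\<^bsub>free_group\<^esub> w = x # w"
      using Cons.prems by (cases w) (auto simp: free_group_def reduced_def)
    then show ?case using generate.eng[OF letter[of x] w] by simp
  qed
  then show "carrier free_group \<subseteq> generate free_group ?S" by (auto simp: free_group_def)
qed

abbreviation "a2 \<equiv> [(True, Gen_a)] :: generator word"
abbreviation "b2 \<equiv> [(True, Gen_b)] :: generator word"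

interpretation F2: group F2
  unfolding F2_def by (rule group_free_group)

lemma F2_letters [simp]: "[(True, g)] \<in> carrier F2"
  by (simp add: F2_def free_group_def reduced_def)

lemma F2_generated: "carrier F2 = generate F2 {a2, b2}"
proof -
  have "range (\<lambda>g. [(True, g)]) = {a2, b2}"
    using generator.exhaust by (auto simp: image_iff)
  then show ?thesis using free_group_generated[where 'g = generator] by (simp add: F2_def)
qed

lemma F_rel_normal: "F_rel n \<lhd> F2"
  and lcs_F_rel: "lcs F2 (n + 3) \<subseteq> F_rel n"
  using F2.normal_set_mult[OF F2.lcs_normal F2.comm_subgroup_normal[OF F2.lcs_normal F2.lcs_normal]]
  by (simp_all add: F_rel_def)

interpretation F: group "F_grp n" for n
  unfolding F_grp_def by (rule normal.factorgroup_is_group[OF F_rel_normal])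

lemma F_hom: "group_hom F2 (F_grp n) (\<lambda>x. F_rel n #>\<^bsub>F2\<^esub> x)"
  unfolding F_grp_def by (rule normal.group_hom_rcoset[OF F_rel_normal])

lemma F_letters [simp]: "F_a n \<in> carrier (F_grp n)" "F_b n \<in> carrier (F_grp n)"
  using group_hom.hom_closed[OF F_hom] by (simp_all add: F_a_def F_b_def)

definition M_gens :: "nat \<Rightarrow> generator word set set" where
  "M_gens n = {x. \<exists>k\<ge>3. commutator_in (F_grp n) (F_a n) (F_b n) k x} \<union>
      {engel (F_grp n) (F_b n) (n + 1) (F_a n),
       comm (F_grp n) (engel (F_grp n) (F_b n) n (F_a n)) (F_b n)}"

lemma M_sub_eq: "M_sub n = normal_closure (F_grp n) (M_gens n)"
  by (simp only: M_sub_def M_gens_def)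

lemma M_gens_carrier: "M_gens n \<subseteq> carrier (F_grp n)"
  using F.commutator_in_carrier[OF _ F_letters] by (auto simp: M_gens_def simp del: engel.simps)

lemma M_sub_normal: "M_sub n \<lhd> F_grp n" and M_gens_M_sub: "M_gens n \<subseteq> M_sub n"
  unfolding M_sub_eq using F.normal_closure_normal[OF M_gens_carrier] by auto

interpretation H: group "H_grp n" for n
  unfolding H_grp_def by (rule normal.factorgroup_is_group[OF M_sub_normal])

lemma H_hom: "group_hom (F_grp n) (H_grp n) (\<lambda>x. M_sub n #>\<^bsub>F_grp n\<^esub> x)"
  unfolding H_grp_def by (rule normal.group_hom_rcoset[OF M_sub_normal])

lemma M_trivial: "x \<in> M_sub n \<Longrightarrow> M_sub n #>\<^bsub>F_grp n\<^esub> x = \<one>\<^bsub>H_grp n\<^esub>"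
  using F.rcoset_eq_self_iff[OF normal_imp_subgroup[OF M_sub_normal]]
    subgroup.mem_carrier[OF normal_imp_subgroup[OF M_sub_normal]]
  by (simp add: H_grp_def)

lemma two_generator_H: "two_generator (H_grp n) (H_a n) (H_b n) n"
proof -
  interpret p: group_hom F2 "F_grp n" "\<lambda>x. F_rel n #>\<^bsub>F2\<^esub> x" by (rule F_hom)
  interpret q: group_hom "F_grp n" "H_grp n" "\<lambda>x. M_sub n #>\<^bsub>F_grp n\<^esub> x" by (rule H_hom)
  let ?q = "\<lambda>x. M_sub n #>\<^bsub>F_grp n\<^esub> x"
  have Fa: "F_a n = F_rel n #>\<^bsub>F2\<^esub> a2" "F_b n = F_rel n #>\<^bsub>F2\<^esub> b2" by (simp_all add: F_a_def F_b_def)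
  have engel_H: "engel (H_grp n) (H_b n) i (H_a n) = ?q (engel (F_grp n) (F_b n) i (F_a n))" for i
    by (simp add: H_a_def H_b_def q.hom_engel)
  have genF: "carrier (F_grp n) = generate (F_grp n) {F_a n, F_b n}"
  proof -
    have "carrier (F_grp n) = (\<lambda>x. F_rel n #>\<^bsub>F2\<^esub> x) ` carrier F2"
      by (simp add: F_grp_def carrier_FactGroup)
    also have "\<dots> = generate (F_grp n) ((\<lambda>x. F_rel n #>\<^bsub>F2\<^esub> x) ` {a2, b2})"
      by (subst F2_generated, subst p.generate_img) auto
    finally show ?thesis by (simp add: Fa)
  qed
  have genH: "carrier (H_grp n) = generate (H_grp n) {H_a n, H_b n}"
  proof -
    have "carrier (H_grp n) = ?q ` carrier (F_grp n)"
      by (simp add: H_grp_def carrier_FactGroup)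
    also have "\<dots> = generate (H_grp n) (?q ` {F_a n, F_b n})"
      by (subst genF, subst q.generate_img) auto
    finally show ?thesis by (simp add: H_a_def H_b_def)
  qed
  show ?thesis
  proof (intro two_generator.intro two_generator_axioms.intro H.group_axioms)
    show "H_a n \<in> carrier (H_grp n)" "H_b n \<in> carrier (H_grp n)"
      by (simp_all add: H_a_def H_b_def)
    show "carrier (H_grp n) = generate (H_grp n) {H_a n, H_b n}" by (rule genH)
    have "engel (F_grp n) (F_b n) (n + 1) (F_a n) \<in> M_sub n"
      using M_gens_M_sub by (auto simp: M_gens_def simp del: engel.simps)
    then show "engel (H_grp n) (H_b n) (Suc n) (H_a n) = \<one>\<^bsub>H_grp n\<^esub>"
      by (simp only: engel_H Suc_eq_plus1 M_trivial)
    have "comm (F_grp n) (engel (F_grp n) (F_b n) n (F_a n)) (F_b n) \<in> M_sub n"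
      using M_gens_M_sub by (auto simp: M_gens_def)
    moreover have "comm (H_grp n) (engel (H_grp n) (H_b n) n (H_a n)) (H_b n)
      = ?q (comm (F_grp n) (engel (F_grp n) (F_b n) n (F_a n)) (F_b n))"
      by (simp add: engel_H q.hom_comm) (simp add: H_b_def)
    ultimately show "comm (H_grp n) (engel (H_grp n) (H_b n) n (H_a n)) (H_b n) = \<one>\<^bsub>H_grp n\<^esub>"
      by (simp only: M_trivial)
    fix i j k
    \<comment> \<open>Each \<open>[b,_i a]\<close> has exactly one entry \<open>b\<close>, so the
      double bracket has three and is among the generators of \<open>M_sub\<close>.\<close>
    have "commutator_in (F_grp n) (F_a n) (F_b n) 3
      (comm (F_grp n) (comm (F_grp n) (engel (F_grp n) (F_b n) i (F_a n)) (engel (F_grp n) (F_b n) j (F_a n)))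
        (engel (F_grp n) (F_b n) k (F_a n)))"
      using commutator_in.bracket[OF commutator_in.bracket[OF F.engel_commutator_in F.engel_commutator_in]
          F.engel_commutator_in, of n "F_a n" "F_b n" i j k] by (simp add: numeral_3_eq_3)
    then have "comm (F_grp n) (comm (F_grp n) (engel (F_grp n) (F_b n) i (F_a n)) (engel (F_grp n) (F_b n) j (F_a n)))
        (engel (F_grp n) (F_b n) k (F_a n)) \<in> M_gens n"
      unfolding M_gens_def by (intro UnI1 CollectI exI[of _ 3]) simp
    then show "comm (H_grp n) (comm (H_grp n) (engel (H_grp n) (H_b n) i (H_a n)) (engel (H_grp n) (H_b n) j (H_a n)))
        (engel (H_grp n) (H_b n) k (H_a n)) = \<one>\<^bsub>H_grp n\<^esub>"
      using M_trivial[OF subsetD[OF M_gens_M_sub]] by (simp add: engel_H flip: q.hom_comm)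
  next
    fix i m assume im: "n < i + m"
    define x where "x = engel F2 (comm F2 (engel F2 b2 i a2) b2) m a2"
    have "engel F2 b2 i a2 \<in> lcs F2 (Suc i)"
      using F2.engel_lcs[of b2 0 a2 i] by simp
    then have "x \<in> lcs F2 (Suc (Suc i) + m)"
      unfolding x_def by (intro F2.engel_lcs F2.comm_lcs) auto
    \<comment> \<open>The weight is \<open>i + m + 2\<close>, and \<open>i + m > n\<close> makes it
      at least \<open>n + 3\<close>, the term of the lower central series contained in
      \<open>F_rel\<close>.\<close>
    then have "x \<in> lcs F2 (Suc (n + 2))"
      by (intro F2.lcs_mono[of "n + 2" "Suc i + m"]) (use im in auto)
    then have "x \<in> F_rel n" using lcs_F_rel[of n] by (auto simp: eval_nat_numeral)
    then have "F_rel n #>\<^bsub>F2\<^esub> x = \<one>\<^bsub>F_grp n\<^esub>"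
      using F2.rcoset_eq_self_iff[OF normal_imp_subgroup[OF F_rel_normal]]
        subgroup.mem_carrier[OF normal_imp_subgroup[OF F_rel_normal]] by (simp add: F_grp_def)
    then have "engel (F_grp n) (comm (F_grp n) (engel (F_grp n) (F_b n) i (F_a n)) (F_b n)) m (F_a n) = \<one>\<^bsub>F_grp n\<^esub>"
      by (simp add: x_def p.hom_engel p.hom_comm Fa)
    then have "?q (engel (F_grp n) (comm (F_grp n) (engel (F_grp n) (F_b n) i (F_a n)) (F_b n)) m (F_a n)) = \<one>\<^bsub>H_grp n\<^esub>"
      by simp
    then show "engel (H_grp n) (comm (H_grp n) (engel (H_grp n) (H_b n) i (H_a n)) (H_b n)) m (H_a n) = \<one>\<^bsub>H_grp n\<^esub>"
      by (simp add: q.hom_engel q.hom_comm H_a_def H_b_def)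
  qed
qed

text \<open>The relators are checked by two kinds of bookkeeping: \<open>weight\<close> disposes of
  \<open>\<gamma>_{n+3}\<close> and \<open>[\<gamma>_4,\<gamma>_4]\<close>, \<open>b_degree\<close>
  of the commutators with three entries \<open>b\<close>. The two remaining generators of
  \<open>M_sub\<close> are explicit computations in the model.\<close>

lemma exists_hom_to_model:
  assumes "model n"
  obtains \<chi> where "\<chi> \<in> hom (H_grp n) (model.Q n A)" "\<chi> (H_a n) = model.qa" "\<chi> (H_b n) = model.qb n"
proof -
  interpret model n A by fact
  define \<phi> where "\<phi> = word_value Q (\<lambda>g. case g of Gen_a \<Rightarrow> qa | Gen_b \<Rightarrow> qb)"
  have hom: "\<phi> \<in> hom F2 Q" unfolding \<phi>_def F2_def by (rule Q.word_value_hom) simp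
  interpret \<phi>: group_hom F2 Q \<phi>
    using hom by (simp add: group_hom_def group_hom_axioms_def F2.group_axioms Q.group_axioms)
  have letters: "\<phi> a2 = qa" "\<phi> b2 = qb"
    by (simp_all add: \<phi>_def word_value_def letter_value_def del: one_Q)
  have weight1: "\<phi> x \<in> weight 1" if "x \<in> carrier F2" for x
  proof -
    have "\<phi> ` carrier F2 = generate Q (\<phi> ` {a2, b2})"
      by (subst F2_generated, subst \<phi>.generate_img) auto
    also have "\<dots> \<subseteq> weight 1"
      using ab_weight by (intro Q.generate_subgroup_incl subgroup_weight) (auto simp: letters)
    finally show ?thesis using that by auto
  qed
  have lcs: "\<phi> ` lcs F2 (Suc k) \<subseteq> weight (Suc k)" for k
  proof (induction k)
    case 0
    then show ?case using weight1 by auto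
  next
    case (Suc k)
    let ?C = "{comm F2 x y |x y. x \<in> lcs F2 (Suc k) \<and> y \<in> carrier F2}"
    have "?C \<subseteq> carrier F2" using F2.lcs_carrier by blast
    then have "\<phi> ` lcs F2 (Suc (Suc k)) = generate Q (\<phi> ` ?C)"
      by (simp add: comm_subgroup_def \<phi>.generate_img)
    also have "\<dots> \<subseteq> weight (Suc (Suc k))"
    proof (intro Q.generate_subgroup_incl subgroup_weight)
      show "\<phi> ` ?C \<subseteq> weight (Suc (Suc k))"
      proof (rule image_subsetI)
        fix z assume "z \<in> ?C"
        then obtain x y where z: "z = comm F2 x y" and xy: "x \<in> lcs F2 (Suc k)" "y \<in> carrier F2" by blast
        then have "\<phi> (comm F2 x y) = comm Q (\<phi> x) (\<phi> y)" using F2.lcs_carrier by (intro \<phi>.hom_comm)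
        then show "\<phi> z \<in> weight (Suc (Suc k))"
          unfolding z using comm_weight[of "Suc k" "\<phi> x" "\<phi> y"] xy Suc weight1 by auto
      qed
    qed simp
    finally show ?case .
  qed
  have "\<phi> x = \<one>\<^bsub>Q\<^esub>" if x: "x \<in> F_rel n" for x
  proof -
    obtain y z where yz: "y \<in> lcs F2 (n + 3)" "z \<in> comm_subgroup F2 (lcs F2 4) (lcs F2 4)" "x = y \<otimes>\<^bsub>F2\<^esub> z"
      using x unfolding F_rel_def set_mult_def by blast
    have "\<phi> y = \<one>\<^bsub>Q\<^esub>"
      using lcs[of "n + 2"] yz(1) by (intro weight_top[of "n + 3"]) (auto simp: add_2_eq_Suc' numeral_3_eq_3 simp del: lcs.simps)
    moreover have "\<phi> z = \<one>\<^bsub>Q\<^esub>"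
    proof -
      let ?C = "{comm F2 x y |x y. x \<in> lcs F2 4 \<and> y \<in> lcs F2 4}"
      have C: "?C \<subseteq> carrier F2" using F2.lcs_carrier by blast
      have "\<phi> ` ?C \<subseteq> {\<one>\<^bsub>Q\<^esub>}"
      proof (rule image_subsetI)
        fix z assume "z \<in> ?C"
        then obtain x y where z: "z = comm F2 x y" and xy: "x \<in> lcs F2 4" "y \<in> lcs F2 4" by blast
        have w4: "\<phi> ` lcs F2 4 \<subseteq> weight 4" using lcs[of 3] by (simp add: eval_nat_numeral)
        have "\<phi> (comm F2 x y) = comm Q (\<phi> x) (\<phi> y)" using F2.lcs_carrier xy by (intro \<phi>.hom_comm)
        also have "\<dots> = \<one>\<^bsub>Q\<^esub>" using w4 xy by (intro weight_4_commute) auto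
        finally show "\<phi> z \<in> {\<one>\<^bsub>Q\<^esub>}" by (simp only: z singletonI)
      qed
      then have "generate Q (\<phi> ` ?C) \<subseteq> {\<one>\<^bsub>Q\<^esub>}"
        by (intro Q.generate_subgroup_incl Q.triv_subgroup)
      then show ?thesis using yz(2) C by (auto simp: comm_subgroup_def \<phi>.generate_img)
    qed
    ultimately show ?thesis
      using yz F2.lcs_carrier subgroup.mem_carrier[OF normal_imp_subgroup[OF F2.comm_subgroup_normal[OF F2.lcs_normal F2.lcs_normal]]]
      by (simp del: one_Q add: Q.l_one)
  qed
  from F2.FactGroup_lift[OF Q.group_axioms hom F_rel_normal this]
  obtain \<psi> where \<psi>: "\<psi> \<in> hom (F_grp n) Q" "\<And>x. x \<in> carrier F2 \<Longrightarrow> \<psi> (F_rel n #>\<^bsub>F2\<^esub> x) = \<phi> x"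
    unfolding F_grp_def by blast
  interpret \<psi>: group_hom "F_grp n" Q \<psi>
    using \<psi> by (simp add: group_hom_def group_hom_axioms_def F.group_axioms Q.group_axioms)
  have \<psi>_letters: "\<psi> (F_a n) = qa" "\<psi> (F_b n) = qb"
    using \<psi>(2) letters by (simp_all add: F_a_def F_b_def)
  have "\<psi> x = \<one>\<^bsub>Q\<^esub>" if "x \<in> M_gens n" for x
    using that unfolding M_gens_def
  proof (elim UnE)
    assume "x \<in> {x. \<exists>k\<ge>3. commutator_in (F_grp n) (F_a n) (F_b n) k x}"
    then obtain k where "k \<ge> 3" "commutator_in (F_grp n) (F_a n) (F_b n) k x" by auto
    then show ?thesis
      using \<psi>.hom_commutator_in[OF _ F_letters] b_degree_commutator_in b_degree_3 unfolding \<psi>_letters by blast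
  next
    assume "x \<in> {engel (F_grp n) (F_b n) (n + 1) (F_a n), comm (F_grp n) (engel (F_grp n) (F_b n) n (F_a n)) (F_b n)}"
    then show ?thesis
      using engel_qb_trivial comm_engel_qb_trivial
      by (auto simp: \<psi>.hom_engel \<psi>.hom_comm \<psi>_letters simp del: engel.simps one_Q)
  qed
  then have "M_sub n \<subseteq> kernel (F_grp n) Q \<psi>"
    unfolding M_sub_eq using M_gens_carrier by (intro F.normal_closure_minimal \<psi>.normal_kernel) (auto simp: kernel_def)
  then have "\<psi> x = \<one>\<^bsub>Q\<^esub>" if "x \<in> M_sub n" for x using that by (auto simp: kernel_def)
  from F.FactGroup_lift[OF Q.group_axioms \<psi>(1) M_sub_normal this]
  obtain \<chi> where \<chi>: "\<chi> \<in> hom (H_grp n) Q" "\<And>x. x \<in> carrier (F_grp n) \<Longrightarrow> \<chi> (M_sub n #>\<^bsub>F_grp n\<^esub> x) = \<psi> x"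
    unfolding H_grp_def by blast
  show ?thesis
    by (rule that[OF \<chi>(1)]) (use \<chi>(2) \<psi>_letters in \<open>simp_all add: H_a_def H_b_def\<close>)
qed

lemma t_power_in_N:
  assumes n: "n \<ge> 5" and k: "two_generator.t (H_grp n) (H_a n) (H_b n) n [^]\<^bsub>H_grp n\<^esub> (k :: nat)
    \<in> two_generator.N (H_grp n) (H_a n) (H_b n) n"
  shows "k = 0"
proof -
  interpret two_generator "H_grp n" "H_a n" "H_b n" n by (rule two_generator_H)
  obtain A where A: "model.useq n A = 0" using exists_useq_zero[OF n] by blast
  have mod: "model n" by unfold_locales (rule n)
  interpret M: reduced_model n A by unfold_locales (rule n, rule A)
  obtain \<chi> where \<chi>: "\<chi> \<in> hom (H_grp n) M.Q" "\<chi> (H_a n) = M.qa" "\<chi> (H_b n) = M.qb"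
    using exists_hom_to_model[OF mod] .
  interpret \<chi>: group_hom "H_grp n" M.Q \<chi>
    using \<chi>(1) by (simp add: group_hom_def group_hom_axioms_def M.Q.group_axioms H.group_axioms)
  have U: "\<chi> (U j) = M.qU j" for j
    by (simp add: U_def M.qU_def \<chi>.hom_engel \<chi>.hom_comm \<chi>(2,3))
  have u: "\<chi> u = ordered_prod M.Q (map M.qU [0..<n - 1])"
    unfolding u_def by (subst \<chi>.hom_ordered_prod) (auto simp: U comp_def)
  have w: "\<chi> w = ordered_prod M.Q (map (\<lambda>j. comm M.Q (M.qU j) M.qa) [0..<n - 2])"
    unfolding w_def by (subst \<chi>.hom_ordered_prod) (auto simp: U comp_def \<chi>.hom_comm \<chi>(2))
  have v: "\<chi> v = M.qv" and t: "\<chi> t = M.qt"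
    by (simp_all add: v_def M.qv_def t_def M.qt_def U \<chi>.hom_comm \<chi>.hom_engel \<chi>(2,3))
  have "\<chi> ` N = generate M.Q (\<chi> ` {u, v \<otimes>\<^bsub>H_grp n\<^esub> w, v \<otimes>\<^bsub>H_grp n\<^esub> inv\<^bsub>H_grp n\<^esub> t})"
    unfolding N_def by (rule \<chi>.generate_img[symmetric, OF gens_N])
  also have "\<chi> ` {u, v \<otimes>\<^bsub>H_grp n\<^esub> w, v \<otimes>\<^bsub>H_grp n\<^esub> inv\<^bsub>H_grp n\<^esub> t} = {\<chi> u, \<chi> v \<otimes>\<^bsub>M.Q\<^esub> \<chi> w, \<chi> v \<otimes>\<^bsub>M.Q\<^esub> inv\<^bsub>M.Q\<^esub> \<chi> t}"
    by (simp add: \<chi>.hom_mult del: M.mult_Q)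
  finally have "\<chi> (t [^]\<^bsub>H_grp n\<^esub> k) \<in> generate M.Q {\<chi> u, \<chi> v \<otimes>\<^bsub>M.Q\<^esub> \<chi> w, \<chi> v \<otimes>\<^bsub>M.Q\<^esub> inv\<^bsub>M.Q\<^esub> \<chi> t}"
    using k by blast
  moreover have "\<chi> (t [^]\<^bsub>H_grp n\<^esub> k) = M.qt [^]\<^bsub>M.Q\<^esub> k"
    by (simp add: \<chi>.hom_nat_pow t)
  ultimately show ?thesis
    unfolding u v w t using M.qt_powers by blast
qed

theorem theorem4p1:
  fixes n :: nat
  assumes "n \<ge> 5"
  shows "(N0 n #>\<^bsub>H_grp n\<^esub> engel (H_grp n) (H_b n) n (H_a n)
            = N0 n #>\<^bsub>H_grp n\<^esub> engel (H_grp n) (H_b n [^]\<^bsub>H_grp n\<^esub> (-2 :: int)) n (H_a n)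
          \<and> group.ord (H_grp n Mod N0 n)
              (N0 n #>\<^bsub>H_grp n\<^esub> engel (H_grp n) (H_b n) n (H_a n)) = 0)
       \<and> (\<forall>h \<in> carrier (H_grp n). engel (H_grp n) (inv\<^bsub>H_grp n\<^esub> H_b n) n h \<in> N0 n)
       \<and> (\<forall>k::nat. k \<ge> 2 \<longrightarrow>
            N0 n #>\<^bsub>H_grp n\<^esub> engel (H_grp n) (H_b n [^]\<^bsub>H_grp n\<^esub> (- int k)) n (H_a n)
            = N0 n #>\<^bsub>H_grp n\<^esub> (v_elt n [^]\<^bsub>H_grp n\<^esub> (k choose 2)))"
proof -
  interpret two_generator "H_grp n" "H_a n" "H_b n" n by (rule two_generator_H)
  have n: "n \<ge> 2" using assms by simp
  have U: "uj_elt n = U" by (simp add: fun_eq_iff uj_elt_def U_def)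
  have elts: "t_elt n = t" "u_elt n = u" "v_elt n = v" "w_elt n = w"
    by (simp_all only: t_elt_def t_def u_elt_def u_def v_elt_def v_def w_elt_def w_def U)
  have N: "N0 n = N" by (simp only: N0_def N_def elts)
  interpret N: normal N "H_grp n" by (rule normal_N[OF n])
  interpret q: group_hom "H_grp n" "H_grp n Mod N" "\<lambda>x. N #>\<^bsub>H_grp n\<^esub> x" by (rule N.group_hom_rcoset)
  \<comment> \<open>At exponent \<open>2\<close> the binomial coefficient is \<open>1\<close>, so
    \<open>[b^{-2},_n a]\<close> lies in the coset of \<open>v\<close>, which
    \<open>v t^{-1} \<in> N\<close> identifies with that of \<open>t\<close>.\<close>
  have "N #>\<^bsub>H_grp n\<^esub> t = N #>\<^bsub>H_grp n\<^esub> engel (H_grp n) (H_b n [^]\<^bsub>H_grp n\<^esub> (-2 :: int)) n (H_a n)"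
    using rcoset_engel_b_neg_pow[OF n, of 2] rcoset_t[OF n] by simp
  \<comment> \<open>The value \<open>0\<close> of \<open>ord\<close> stands for infinite
    order.\<close>
  moreover have "q.H.ord (N #>\<^bsub>H_grp n\<^esub> t) = 0"
  proof -
    have "(N #>\<^bsub>H_grp n\<^esub> t) [^]\<^bsub>H_grp n Mod N\<^esub> k \<noteq> \<one>\<^bsub>H_grp n Mod N\<^esub>" if "k \<noteq> 0" for k :: nat
    proof
      assume "(N #>\<^bsub>H_grp n\<^esub> t) [^]\<^bsub>H_grp n Mod N\<^esub> k = \<one>\<^bsub>H_grp n Mod N\<^esub>"
      then have "N #>\<^bsub>H_grp n\<^esub> (t [^]\<^bsub>H_grp n\<^esub> k) = N"
        by (simp add: q.hom_nat_pow)
      then have "t [^]\<^bsub>H_grp n\<^esub> k \<in> N"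
        by (simp add: H.rcoset_eq_self_iff[OF subgroup_N])
      then show False using t_power_in_N[OF assms] that by blast
    qed
    then show ?thesis by (subst q.H.ord_eq_0) (auto intro: q.hom_closed)
  qed
  ultimately show ?thesis
    unfolding N elts t_def[symmetric]
    using engel_inv_b_in_N[OF n] rcoset_engel_b_neg_pow[OF n] by blast
qed

end
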